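(* Each of the open intervals $$\left(\frac{\sqrt{238}}5,\ \sqrt{10}\right)\quad\text{and}\quad\left(\sqrt{10},\ \frac{2124\sqrt2+48\sqrt{238}}{1177}\right)$$ is a maximal gap in the Markoff spectrum $\mathscr M(\mathbf H_4)$ and also a maximal gap in the Lagrange spectrum $\mathscr L(\mathbf H_4)$ of the Hecke group $\mathbf H_4$.
   Context: $\mathbf H_4$ is the subgroup of $\mathrm{PSL}_2(\mathbb R)$ generated by $S=\begin{pmatrix}0&-1\\1&0\end{pmatrix}$ and $T=\begin{pmatrix}1&\sqrt2\\0&1\end{pmatrix}$. It acts on $\hat{\mathbb R}=\mathbb R\cup\{\infty\}$ by linear fractional transformations $\begin{pmatrix}a&b\\c&d\end{pmatrix}\cdot z=\frac{az+b}{cz+d}$. The orbit of $\infty$ is $\mathbb Q(\mathbf H_4)=\sqrt2\,\mathbb Q\cup\{\infty\}$. Markoff spectrum: $\mathscr M(\mathbf H_4)$ is the set of all finite values of $\sup_{M\in\mathbf H_4}|M^{-1}\cdot\xi-M^{-1}\cdot\eta|$ over all $\xi\neq\eta$ in $\hat{\mathbb R}$ (where $|x-y|=\infty$ if exactly one of $x,y$ is $\infty$). Lagrange spectrum: for $\xi\in\mathbb R\setminus\sqrt2\,\mathbb Q$, let $L_{\mathbf H_4}(\xi)$ be the supremum of all $L>0$ such that $\left|\xi-\frac ac\right|<\frac1{Lc^2}$ holds for infinitely many points $M\cdot\infty=\frac ac$ with $M=\begin{pmatrix}a&b\\c&d\end{pmatrix}\in\mathbf H_4$, $c\ne0$. Then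 $\mathscr L(\mathbf H_4)$ is the set of all finite values $L_{\mathbf H_4}(\xi)$, $\xi\in\mathbb R\setminus\sqrt2\,\mathbb Q$. An open interval $(a,b)$ is a maximal gap of a spectrum if it does not intersect the spectrum and is not a proper subset of a larger open interval that does not intersect the spectrum. *)

theory Defs
  imports "HOL-Analysis.Analysis" "HOL-Algebra.Coset" "HOL-Algebra.Generated_Groups"
begin

type_synonym mat2 = "real^2^2"

definition SL2R :: "mat2 monoid" where
  "SL2R = \<lparr>carrier = {A. det A = 1}, mult = (**), one = mat 1\<rparr>"

definition PSL2R :: "mat2 set monoid" where
  "PSL2R = SL2R Mod {mat 1, - mat 1}"

definition S_mat :: mat2 where
  "S_mat = vector [vector [0, -1], vector [1, 0]]"

definition T_mat :: mat2 where
  "T_mat = vector [vector [1, sqrt 2], vector [0, 1]]"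

definition H4 :: "mat2 set set" where
  "H4 = generate PSL2R {{S_mat, - S_mat}, {T_mat, - T_mat}}"

text \<open>An element of \<open>H4\<close> is a class \<open>{A, - A}\<close>; all expressions below take the same
  value on both representatives, so they range over the matrices representing elements of \<open>H4\<close>.\<close>

definition H4_mats :: "mat2 set" where
  "H4_mats = \<Union>H4"

datatype proj_real = Fin real | Infty

fun mobius :: "mat2 \<Rightarrow> proj_real \<Rightarrow> proj_real" where
  "mobius A (Fin x) =
     (if A$2$1 * x + A$2$2 = 0 then Infty else Fin ((A$1$1 * x + A$1$2) / (A$2$1 * x + A$2$2)))"
| "mobius A Infty = (if A$2$1 = 0 then Infty else Fin (A$1$1 / A$2$1))"

text \<open>The value at two infinite arguments is a dummy: the spectra only use distinct points.\<close>

fun proj_dist :: "proj_real \<Rightarrow> proj_real \<Rightarrow> ereal" where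
  "proj_dist (Fin x) (Fin y) = ereal \<bar>x - y\<bar>"
| "proj_dist (Fin x) Infty = \<infinity>"
| "proj_dist Infty (Fin y) = \<infinity>"
| "proj_dist Infty Infty = 0"

definition markoff_value :: "proj_real \<Rightarrow> proj_real \<Rightarrow> ereal" where
  "markoff_value \<xi> \<eta> =
     (SUP M\<in>H4_mats. proj_dist (mobius (matrix_inv M) \<xi>) (mobius (matrix_inv M) \<eta>))"

definition markoff_spectrum :: "real set" where
  "markoff_spectrum = {m. \<exists>\<xi> \<eta>. \<xi> \<noteq> \<eta> \<and> markoff_value \<xi> \<eta> = ereal m}"

text \<open>What is counted are the points \<open>a / c\<close>, not the matrices: the stabiliser of
  \<open>\<infinity>\<close> is infinite, but \<open>c\<^sup>2\<close> depends only on the point \<open>a / c\<close>.\<close>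

definition good_approximants :: "real \<Rightarrow> real \<Rightarrow> real set" where
  "good_approximants \<xi> L =
     {a / c | a c. \<exists>M\<in>H4_mats. a = M$1$1 \<and> c = M$2$1 \<and> c \<noteq> 0 \<and> \<bar>\<xi> - a / c\<bar> < 1 / (L * c\<^sup>2)}"

definition lagrange_value :: "real \<Rightarrow> ereal" where
  "lagrange_value \<xi> = Sup {ereal L | L. L > 0 \<and> infinite (good_approximants \<xi> L)}"

definition lagrange_spectrum :: "real set" where
  "lagrange_spectrum = {l. \<exists>\<xi>. \<xi> \<notin> (*) (sqrt 2) ` \<rat> \<and> lagrange_value \<xi> = ereal l}"

text \<open>Open intervals, bounded or not, are the open convex subsets of the line.\<close>

definition open_interval :: "real set \<Rightarrow> bool" where
  "open_interval I \<longleftrightarrow> open I \<and> is_interval I \<and> I \<noteq> {}"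

definition maximal_gap :: "real set \<Rightarrow> real set \<Rightarrow> bool" where
  "maximal_gap X I \<longleftrightarrow> open_interval I \<and> I \<inter> X = {} \<and>
     \<not> (\<exists>J. open_interval J \<and> I \<subset> J \<and> J \<inter> X = {})"

lemma group_SL2R: "group SL2R"
proof (rule groupI)
  fix A assume "A \<in> carrier SL2R"
  then have d: "det A = 1" by (simp add: SL2R_def)
  then obtain B where B: "A ** B = mat 1" "B ** A = mat 1"
    using invertible_det_nz[of A] by (auto simp: invertible_def)
  from B(2) have "det B * det A = 1" by (metis det_mul det_I)
  with d B show "\<exists>B\<in>carrier SL2R. B \<otimes>\<^bsub>SL2R\<^esub> A = \<one>\<^bsub>SL2R\<^esub>"
    by (auto simp: SL2R_def)
qed (auto simp: SL2R_def det_mul det_I matrix_mul_assoc)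

lemma uminus_mat_mult: "(- A) ** B = - (A ** B)" "A ** (- B) = - (A ** B)" for A B :: mat2
  by (simp_all add: matrix_matrix_mult_def vec_eq_iff sum_2)

lemma normal_pm_one: "{mat 1, - mat 1} \<lhd> SL2R"
proof -
  interpret group SL2R by (rule group_SL2R)
  have d: "det (- mat 1 :: mat2) = 1" by (simp add: det_2 mat_def)
  have "subgroup {mat 1, - mat 1} SL2R"
  proof (rule subgroupI)
    fix a assume "a \<in> {mat 1, - mat 1 :: mat2}"
    then have "inv\<^bsub>SL2R\<^esub> a = a"
      using d by (intro inv_equality) (auto simp: SL2R_def uminus_mat_mult)
    then show "inv\<^bsub>SL2R\<^esub> a \<in> {mat 1, - mat 1}" using \<open>a \<in> _\<close> by simp
  qed (use d in \<open>auto simp: SL2R_def uminus_mat_mult\<close>)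
  then show ?thesis
    by (rule normalI) (auto simp: SL2R_def r_coset_def l_coset_def uminus_mat_mult)
qed

lemma PSL2R_class: "{mat 1, - mat 1} #>\<^bsub>SL2R\<^esub> A = {A, - A}"
  by (auto simp: r_coset_def SL2R_def uminus_mat_mult)

lemma generators_in_PSL2R: "{{S_mat, - S_mat}, {T_mat, - T_mat}} \<subseteq> carrier PSL2R"
proof -
  have "S_mat \<in> carrier SL2R" "T_mat \<in> carrier SL2R"
    by (simp_all add: SL2R_def S_mat_def T_mat_def det_2)
  then show ?thesis
    unfolding PSL2R_def FactGroup_def RCOSETS_def using PSL2R_class by fastforce
qed

lemma mobius_uminus: "mobius (- A) z = mobius A z"
proof (cases z)
  case (Fin x)
  have neg: "- A$2$1 * x + - A$2$2 = - (A$2$1 * x + A$2$2)"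
       "- A$1$1 * x + - A$1$2 = - (A$1$1 * x + A$1$2)" by simp_all
  show ?thesis unfolding Fin mobius.simps uminus_vec_def vec_lambda_beta neg
    by (simp only: neg_equal_0_iff_equal minus_divide_divide)
qed simp

end

theory Submission imports Defs begin

text \<open>In the coordinate \<open>z = \<surd>2 w\<close> the tessellation of the upper half plane by the ideal quadrilaterals
  of \<open>H4\<close> codes a geodesic by a bi-infinite word in the digit maps \<open>A w = 1 + w\<close>,
  \<open>B w = (2 w + 1) / (2 w + 2)\<close>, \<open>C w = w / (1 + 2 w)\<close>, and its Markoff value is \<open>\<surd>2\<close> times the supremum
  of \<open>x + y\<close> and \<open>1 / (2 x) + 1 / (2 y)\<close> over all ways to cut the word into tails \<open>x\<close> and \<open>y\<close>.
  Inversion \<open>w \<mapsto> 1 / (2 w)\<close> exchanges \<open>A\<close> and \<open>C\<close>.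

  Below the upper end of the second gap neither \<open>AA\<close> nor \<open>CC\<close> occurs, and a block \<open>BAB\<close> extends to
  \<open>CBABC\<close>. If there is no such block, then the value is at most that of the periodic word \<open>ABAC\<close>, namely
  \<open>\<surd>238 / 5\<close>. If there is one, then either the word is periodic with period \<open>ABCB\<close> and value \<open>\<surd>10\<close>, or two
  neighbouring centres \<open>A\<close> and \<open>C\<close> of such blocks have values whose sum is at least twice the upper end
  of the second gap.

  For the Lagrange spectrum, a limit of the images of the pair \<open>(\<xi>, \<infinity>)\<close> along the best approximations is
  a geodesic attaining the Lagrange value of \<open>\<xi>\<close> as its Markoff value. Conversely the values of periodic
  words belong to both spectra, and the words \<open>(CACB)\<^sup>n ABCBAC (ABAC)\<^sup>n B\<close> have values tending to the upper
  end of the second gap.\<close>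

section \<open>The group and its bottom rows\<close>

text \<open>An element with bottom row \<open>(r, s)\<close> divides the distance of
  \<open>u\<close> and \<open>v\<close> by \<open>\<bar>r u + s\<bar> \<bar>r v + s\<bar>\<close>,
  so both spectra depend on the set of bottom rows alone, and a value at most \<open>t\<close> means
  one quadratic inequality for each row. The two directions use these inequalities differently.
  Emptiness of the gaps evaluates only the rows of the four vertices \<open>0\<close>,
  \<open>1/2\<close>, \<open>1\<close>, \<open>\<infinity>\<close> of one quadrilateral, but at
  every state of the geodesic: no word is built, a digit is read off by comparing a tail with
  \<open>1/2\<close> and \<open>1\<close>, and the whole family of inequalities is carried along by
  the shifts. Realising a value needs all rows at once; there a descent on \<open>r^2 + s^2\<close>
  leads from an arbitrary cusp to \<open>0\<close> or \<open>\<infinity>\<close>. The values at two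
  neighbouring centres cannot be bounded one by one: they are \<open>mixed p q\<close> and
  \<open>mixed q p\<close>, and a parameter that raises one lowers the other. Hence the sum is
  estimated, and \<open>p\<close> and \<open>q\<close> are compared with
  \<open>1 / (2 * amax)\<close>, where \<open>amax\<close> is the tail of the periodic word
  \<open>ABAC\<close>. The upper end of the second gap is the case in which both parameters have
  this value.\<close>

definition mk :: "real \<Rightarrow> real \<Rightarrow> real \<Rightarrow> real \<Rightarrow> mat2" where
  "mk a b c d = vector [vector [a, b], vector [c, d]]"

lemma mk_nth [simp]:
  "mk a b c d $ 1 $ 1 = a" "mk a b c d $ 1 $ 2 = b"
  "mk a b c d $ 2 $ 1 = c" "mk a b c d $ 2 $ 2 = d"
  by (simp_all add: mk_def)

lemma mat2_eq_iff: "A = B \<longleftrightarrow> A$1$1 = B$1$1 \<and> A$1$2 = B$1$2 \<and> A$2$1 = B$2$1 \<and> A$2$2 = B$2$2"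
  for A B :: mat2
  by (auto simp: vec_eq_iff forall_2)

lemma mat2_mult_nth:
  "(A ** B) $ i $ j = A$i$1 * B$1$j + A$i$2 * B$2$j" for A B :: mat2
  by (simp add: matrix_matrix_mult_def sum_2)

lemma mk_mult: "mk a b c d ** mk a' b' c' d' =
    mk (a*a' + b*c') (a*b' + b*d') (c*a' + d*c') (c*b' + d*d')"
  by (simp add: mat2_eq_iff mat2_mult_nth)

lemma S_mat_eq: "S_mat = mk 0 (-1) 1 0" and T_mat_eq: "T_mat = mk 1 (sqrt 2) 0 1"
  and mat_1_eq: "(mat 1 :: mat2) = mk 1 0 0 1"
  by (simp_all add: S_mat_def T_mat_def mk_def mat2_eq_iff mat_def)

lemma uminus_mk: "- mk a b c d = mk (-a) (-b) (-c) (-d)"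
  by (simp add: mat2_eq_iff)

lemma group_PSL2R: "group PSL2R"
  unfolding PSL2R_def by (rule normal.factorgroup_is_group[OF normal_pm_one])

lemma PSL2R_carrierD:
  assumes "X \<in> carrier PSL2R"
  obtains A where "X = {A, - A}" "det A = 1"
  using assms unfolding PSL2R_def FactGroup_def RCOSETS_def
  by (auto simp: PSL2R_class) (auto simp: SL2R_def)

lemma PSL2R_mult: "{A, - A} \<otimes>\<^bsub>PSL2R\<^esub> {B, - B} = {A ** B, - (A ** B)}"
  by (auto simp: PSL2R_def FactGroup_def set_mult_def SL2R_def uminus_mat_mult)

lemma PSL2R_one: "\<one>\<^bsub>PSL2R\<^esub> = {mat 1, - mat 1}"
  by (simp add: PSL2R_def FactGroup_def)

lemma subgroup_H4: "subgroup H4 PSL2R"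
  unfolding H4_def by (rule group.generate_is_subgroup[OF group_PSL2R generators_in_PSL2R])

lemma H4_mats_iff: "A \<in> H4_mats \<longleftrightarrow> {A, - A} \<in> H4"
proof
  assume "A \<in> H4_mats"
  then obtain X where X: "X \<in> H4" "A \<in> X" by (auto simp: H4_mats_def)
  then have "X \<in> carrier PSL2R" using subgroup.subset[OF subgroup_H4] by auto
  then obtain B where "X = {B, - B}" by (rule PSL2R_carrierD)
  with X show "{A, - A} \<in> H4" by (auto simp: insert_commute)
qed (auto simp: H4_mats_def)

lemma H4_mats_det: "A \<in> H4_mats \<Longrightarrow> det A = 1"
proof -
  assume "A \<in> H4_mats"
  then have "{A, - A} \<in> carrier PSL2R"
    using subgroup.subset[OF subgroup_H4] by (auto simp: H4_mats_iff)
  then obtain B where "{A, - A} = {B, - B}" "det B = 1" by (rule PSL2R_carrierD)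
  then have "A = B \<or> A = - B" by (auto simp: doubleton_eq_iff)
  then show ?thesis using \<open>det B = 1\<close> by (auto simp: det_2)
qed

lemma H4_mats_uminus: "A \<in> H4_mats \<Longrightarrow> - A \<in> H4_mats"
  by (simp add: H4_mats_iff insert_commute)

lemma H4_mats_mult: "A \<in> H4_mats \<Longrightarrow> B \<in> H4_mats \<Longrightarrow> A ** B \<in> H4_mats"
  using subgroup.m_closed[OF subgroup_H4, of "{A, - A}" "{B, - B}"]
  by (simp add: H4_mats_iff PSL2R_mult)

lemma H4_mats_one: "mat 1 \<in> H4_mats"
  using subgroup.one_closed[OF subgroup_H4] by (simp add: H4_mats_iff PSL2R_one)

lemma S_in_H4: "S_mat \<in> H4_mats" and T_in_H4: "T_mat \<in> H4_mats"
  by (auto simp: H4_mats_iff H4_def intro: generate.incl)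

definition adj :: "mat2 \<Rightarrow> mat2" where
  "adj A = mk (A$2$2) (- A$1$2) (- A$2$1) (A$1$1)"

lemma adj_mult: "det A = 1 \<Longrightarrow> A ** adj A = mat 1" "det A = 1 \<Longrightarrow> adj A ** A = mat 1"
  by (simp_all add: adj_def mat2_eq_iff mat2_mult_nth mat_1_eq det_2 algebra_simps)

lemma matrix_inv_adj:
  assumes "det A = 1"
  shows "matrix_inv A = adj A"
proof -
  have "\<exists>B. A ** B = mat 1 \<and> B ** A = mat 1" using adj_mult[OF assms] by blast
  then have "A ** matrix_inv A = mat 1" unfolding matrix_inv_def by (rule someI2_ex) blast
  then show ?thesis
    by (metis adj_mult(2)[OF assms] matrix_mul_assoc matrix_mul_rid matrix_mul_lid)
qed

text \<open>The inverse of the class \<open>{A, - A}\<close> is again some class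
  \<open>{B, - B}\<close>, and \<open>B ** A\<close> being \<open>1\<close> or \<open>- 1\<close>
  determines \<open>B\<close> up to the sign that classes ignore.\<close>

lemma H4_mats_adj: "A \<in> H4_mats \<Longrightarrow> adj A \<in> H4_mats"
proof -
  assume A: "A \<in> H4_mats"
  then have h: "{A, - A} \<in> H4" by (simp add: H4_mats_iff)
  interpret group PSL2R by (rule group_PSL2R)
  have c: "{A, - A} \<in> carrier PSL2R" using h subgroup.subset[OF subgroup_H4] by auto
  have i: "inv\<^bsub>PSL2R\<^esub> {A, - A} \<in> H4" by (rule subgroup.m_inv_closed[OF subgroup_H4 h])
  then have "inv\<^bsub>PSL2R\<^esub> {A, - A} \<in> carrier PSL2R" using c by simp
  then obtain B where B: "inv\<^bsub>PSL2R\<^esub> {A, - A} = {B, - B}" by (rule PSL2R_carrierD)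
  have "{B, - B} \<otimes>\<^bsub>PSL2R\<^esub> {A, - A} = \<one>\<^bsub>PSL2R\<^esub>" using c B by (metis l_inv)
  then have "B ** A = mat 1 \<or> B ** A = - mat 1"
    by (auto simp: PSL2R_mult PSL2R_one doubleton_eq_iff)
  then have "B = adj A \<or> B = - adj A"
    using adj_mult[OF H4_mats_det[OF A]]
    by (metis matrix_mul_assoc matrix_mul_rid matrix_mul_lid uminus_mat_mult(1))
  then have "adj A \<in> {B, - B}" by auto
  then show ?thesis using i B by (auto simp: H4_mats_def)
qed

text \<open>Conjugation by the diagonal matrix with entries \<open>1\<close> and \<open>-1\<close>,
  that is, by the reflection \<open>z \<mapsto> - z\<close> of the boundary.\<close>

definition refl22 :: "mat2 \<Rightarrow> mat2" where
  "refl22 A = mk (A$1$1) (- A$1$2) (- A$2$1) (A$2$2)"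

text \<open>The two shapes of elements of \<open>H4\<close>: the matrices with integral diagonal, and the coset of
  \<open>S_mat\<close>, for which \<open>\<surd>2\<close> divides the diagonal instead.\<close>

definition shape :: "mat2 \<Rightarrow> bool" where
  "shape A \<longleftrightarrow>
     (\<exists>p q r s. A = mk (of_int p) (sqrt 2 * of_int q) (sqrt 2 * of_int r) (of_int s) \<and> odd p \<and> odd s) \<or>
     (\<exists>p q r s. A = mk (sqrt 2 * of_int p) (of_int q) (of_int r) (sqrt 2 * of_int s) \<and> odd q \<and> odd r)"

lemma sqrt2_mult: "sqrt 2 * x * (sqrt 2 * y) = 2 * (x * y)" "sqrt 2 * (sqrt 2 * y) = 2 * y"
  by (metis mult.assoc mult.left_commute real_sqrt_mult_self abs_numeral)
     (metis mult.assoc real_sqrt_mult_self abs_numeral)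

lemma shape_mult: assumes "shape A" "shape B" shows "shape (A ** B)"
proof -
  consider (11) p q r s p' q' r' s' :: int where
      "A = mk p (sqrt 2 * q) (sqrt 2 * r) s" "odd p" "odd s"
      "B = mk p' (sqrt 2 * q') (sqrt 2 * r') s'" "odd p'" "odd s'"
    | (12) p q r s p' q' r' s' :: int where
      "A = mk p (sqrt 2 * q) (sqrt 2 * r) s" "odd p" "odd s"
      "B = mk (sqrt 2 * p') q' r' (sqrt 2 * s')" "odd q'" "odd r'"
    | (21) p q r s p' q' r' s' :: int where
      "A = mk (sqrt 2 * p) q r (sqrt 2 * s)" "odd q" "odd r"
      "B = mk p' (sqrt 2 * q') (sqrt 2 * r') s'" "odd p'" "odd s'"
    | (22) p q r s p' q' r' s' :: int where
      "A = mk (sqrt 2 * p) q r (sqrt 2 * s)" "odd q" "odd r"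
      "B = mk (sqrt 2 * p') q' r' (sqrt 2 * s')" "odd q'" "odd r'"
    using assms unfolding shape_def
    by (elim disjE exE conjE) (rule that; assumption)+
  then show ?thesis
  proof cases
    case 11
    have "A ** B = mk (p * p' + 2 * (q * r') :: int) (sqrt 2 * (p * q' + q * s' :: int))
                (sqrt 2 * (r * p' + s * r' :: int)) (2 * (r * q') + s * s' :: int)"
      by (simp add: 11 mk_mult sqrt2_mult algebra_simps)
    moreover have "odd (p * p' + 2 * (q * r'))" "odd (2 * (r * q') + s * s')" using 11 by auto
    ultimately show ?thesis unfolding shape_def by blast
  next
    case 12
    have "A ** B = mk (sqrt 2 * (p * p' + q * r' :: int)) (p * q' + 2 * (q * s') :: int)
                (2 * (r * p') + s * r' :: int) (sqrt 2 * (r * q' + s * s' :: int))"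
      by (simp add: 12 mk_mult sqrt2_mult algebra_simps)
    moreover have "odd (p * q' + 2 * (q * s'))" "odd (2 * (r * p') + s * r')" using 12 by auto
    ultimately show ?thesis unfolding shape_def by blast
  next
    case 21
    have "A ** B = mk (sqrt 2 * (p * p' + q * r' :: int)) (2 * (p * q') + q * s' :: int)
                (r * p' + 2 * (s * r') :: int) (sqrt 2 * (r * q' + s * s' :: int))"
      by (simp add: 21 mk_mult sqrt2_mult algebra_simps)
    moreover have "odd (2 * (p * q') + q * s')" "odd (r * p' + 2 * (s * r'))" using 21 by auto
    ultimately show ?thesis unfolding shape_def by blast
  next
    case 22
    have "A ** B = mk (2 * (p * p') + q * r' :: int) (sqrt 2 * (p * q' + q * s' :: int))
                (sqrt 2 * (r * p' + s * r' :: int)) (r * q' + 2 * (s * s') :: int)"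
      by (simp add: 22 mk_mult sqrt2_mult algebra_simps)
    moreover have "odd (2 * (p * p') + q * r')" "odd (r * q' + 2 * (s * s'))" using 22 by auto
    ultimately show ?thesis unfolding shape_def by blast
  qed
qed

lemma shape_uminus: "shape A \<Longrightarrow> shape (- A)"
  unfolding shape_def
  apply (elim disjE exE)
  subgoal for p q r s
    by (rule disjI1, rule exI[of _ "-p"], rule exI[of _ "-q"], rule exI[of _ "-r"], rule exI[of _ "-s"])
       (simp add: uminus_mk)
  subgoal for p q r s
    by (rule disjI2, rule exI[of _ "-p"], rule exI[of _ "-q"], rule exI[of _ "-r"], rule exI[of _ "-s"])
       (simp add: uminus_mk)
  done

lemma shape_adj: "shape A \<Longrightarrow> shape (adj A)"
  unfolding shape_def adj_def
  apply (elim disjE exE)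
  subgoal for p q r s
    by (rule disjI1, rule exI[of _ "s"], rule exI[of _ "-q"], rule exI[of _ "-r"], rule exI[of _ "p"]) auto
  subgoal for p q r s
    by (rule disjI2, rule exI[of _ "s"], rule exI[of _ "-q"], rule exI[of _ "-r"], rule exI[of _ "p"]) auto
  done

lemma shape_generators: "shape (mat 1)" "shape S_mat" "shape T_mat"
proof -
  show "shape (mat 1)" unfolding shape_def mat_1_eq
    by (rule disjI1, rule exI[of _ 1], rule exI[of _ 0], rule exI[of _ 0], rule exI[of _ 1]) simp
  show "shape S_mat" unfolding shape_def S_mat_eq
    by (rule disjI2, rule exI[of _ 0], rule exI[of _ "-1"], rule exI[of _ 1], rule exI[of _ 0]) simp
  show "shape T_mat" unfolding shape_def T_mat_eq
    by (rule disjI1, rule exI[of _ 1], rule exI[of _ 1], rule exI[of _ 0], rule exI[of _ 1]) simp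
qed

lemma refl22_mult: "refl22 (A ** B) = refl22 A ** refl22 B"
  by (simp add: refl22_def mk_mult mat2_mult_nth algebra_simps)

text \<open>Induction over \<open>generate\<close> speaks of classes. The rule for
  \<open>uminus\<close> carries a predicate to both representatives, so that later inductions deal
  with matrices only.\<close>

lemma H4_mats_induct [consumes 1, case_names one S T uminus adj mult]:
  assumes "A \<in> H4_mats" "P (mat 1)" "P S_mat" "P T_mat" "\<And>A. P A \<Longrightarrow> P (- A)"
    "\<And>A. P A \<Longrightarrow> det A = 1 \<Longrightarrow> P (adj A)" "\<And>A B. P A \<Longrightarrow> P B \<Longrightarrow> P (A ** B)"
  shows "P A"
proof -
  have "\<forall>A\<in>X. P A" if "X \<in> generate PSL2R {{S_mat, - S_mat}, {T_mat, - T_mat}}" for X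
    using that
  proof induction
    case one
    then show ?case using assms by (auto simp: PSL2R_one)
  next
    case (incl h)
    then show ?case using assms by auto
  next
    case (inv h)
    then obtain G where G: "h = {G, - G}" "G = S_mat \<or> G = T_mat" by auto
    then have d: "det G = 1" and PG: "P G" and GH: "G \<in> H4_mats"
      using assms S_in_H4 T_in_H4 H4_mats_det by auto
    have "{adj G, - adj G} \<in> carrier PSL2R"
      using H4_mats_adj[OF GH] subgroup.subset[OF subgroup_H4] by (auto simp: H4_mats_iff)
    moreover have "h \<in> carrier PSL2R"
      using GH G subgroup.subset[OF subgroup_H4] by (auto simp: H4_mats_iff)
    moreover have "{adj G, - adj G} \<otimes>\<^bsub>PSL2R\<^esub> h = \<one>\<^bsub>PSL2R\<^esub>"
      by (simp add: G PSL2R_mult PSL2R_one adj_mult d)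
    ultimately have "inv\<^bsub>PSL2R\<^esub> h = {adj G, - adj G}"
      using group.inv_equality[OF group_PSL2R] by blast
    then show ?case using assms(5,6) PG d by auto
  next
    case (eng h1 h2)
    have "h1 \<in> carrier PSL2R" "h2 \<in> carrier PSL2R"
      using eng group.generate_in_carrier[OF group_PSL2R generators_in_PSL2R] by auto
    then obtain A B where "h1 = {A, - A}" "h2 = {B, - B}" by (metis PSL2R_carrierD)
    with eng show ?case using assms(5,7) by (auto simp: PSL2R_mult)
  qed
  with assms(1) show ?thesis by (auto simp: H4_mats_def H4_def)
qed

lemma H4_mats_shape: "A \<in> H4_mats \<Longrightarrow> shape A"
  by (induction rule: H4_mats_induct)
     (auto intro: shape_generators shape_uminus shape_adj shape_mult)

text \<open>The reflection sends \<open>S_mat\<close> to its negative and \<open>T_mat\<close> to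
  its inverse, so it normalises the group although its own determinant is \<open>-1\<close>. This is
  the source of the symmetry \<open>s \<mapsto> - s\<close> of bottom rows.\<close>

lemma H4_mats_refl: "A \<in> H4_mats \<Longrightarrow> refl22 A \<in> H4_mats"
proof (induction rule: H4_mats_induct)
  case one
  have "refl22 (mat 1) = mat 1" by (simp add: refl22_def mat_1_eq)
  then show ?case by (simp add: H4_mats_one)
next
  case S
  have "refl22 S_mat = - S_mat" by (simp add: refl22_def S_mat_eq uminus_mk)
  then show ?case by (simp add: H4_mats_uminus S_in_H4)
next
  case T
  have "refl22 T_mat = adj T_mat" by (simp add: refl22_def T_mat_eq adj_def)
  then show ?case by (simp add: H4_mats_adj T_in_H4)
next
  case (uminus A)
  have "refl22 (- A) = - refl22 A" by (simp add: refl22_def uminus_mk)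
  then show ?case using uminus by (simp add: H4_mats_uminus)
next
  case (adj A)
  have "refl22 (adj A) = adj (refl22 A)" by (simp add: refl22_def adj_def)
  then show ?case using adj by (simp add: H4_mats_adj)
next
  case (mult A B)
  then show ?case by (simp add: refl22_mult H4_mats_mult)
qed

section \<open>Bottom rows and their symmetries\<close>

definition bottom_rows :: "(real \<times> real) set" where
  "bottom_rows = {(A$2$1, A$2$2) | A. A \<in> H4_mats}"

lemma rowsI: "A \<in> H4_mats \<Longrightarrow> (A$2$1, A$2$2) \<in> bottom_rows"
  unfolding bottom_rows_def by blast

lemma rowsE:
  assumes "(r, s) \<in> bottom_rows"
  obtains A where "A \<in> H4_mats" "A$2$1 = r" "A$2$2 = s" "A$1$1 * s - A$1$2 * r = 1"
proof -
  from assms obtain A where A: "A \<in> H4_mats" "r = A$2$1" "s = A$2$2" unfolding bottom_rows_def by blast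
  with H4_mats_det[OF A(1)] that[of A] show ?thesis by (simp add: det_2)
qed

text \<open>Inversion in the group turns first columns into bottom rows: the point
  \<open>a / c\<close> is the zero of the row \<open>(- c, a)\<close>.\<close>

lemma column_iff_row: "(\<exists>M\<in>H4_mats. a = M$1$1 \<and> c = M$2$1) \<longleftrightarrow> (- c, a) \<in> bottom_rows"
proof
  assume "\<exists>M\<in>H4_mats. a = M$1$1 \<and> c = M$2$1"
  then obtain M where "M \<in> H4_mats" "a = M$1$1" "c = M$2$1" by blast
  then show "(- c, a) \<in> bottom_rows" using rowsI[OF H4_mats_adj[of M]] by (simp add: adj_def)
next
  assume "(- c, a) \<in> bottom_rows"
  then obtain A where A: "A \<in> H4_mats" "A$2$1 = - c" "A$2$2 = a" by (rule rowsE)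
  have "adj A $ 1 $ 1 = a" "adj A $ 2 $ 1 = c" using A by (simp_all add: adj_def)
  then show "\<exists>M\<in>H4_mats. a = M$1$1 \<and> c = M$2$1" using H4_mats_adj[OF A(1)] by metis
qed

lemma rows_mult:
  assumes "(r, s) \<in> bottom_rows" "B \<in> H4_mats"
  shows "(r * B$1$1 + s * B$2$1, r * B$1$2 + s * B$2$2) \<in> bottom_rows"
proof -
  obtain A where A: "A \<in> H4_mats" "A$2$1 = r" "A$2$2 = s" using assms(1) by (rule rowsE)
  show ?thesis using rowsI[OF H4_mats_mult[OF A(1) assms(2)]] A by (simp add: mat2_mult_nth)
qed

lemma rows_0_1: "(0, 1) \<in> bottom_rows"
  using rowsI[OF H4_mats_one] by (simp add: mat_1_eq)

lemma rows_uminus: "(r, s) \<in> bottom_rows \<Longrightarrow> (- r, - s) \<in> bottom_rows"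
proof -
  assume "(r, s) \<in> bottom_rows"
  then obtain A where A: "A \<in> H4_mats" "A$2$1 = r" "A$2$2 = s" by (rule rowsE)
  show ?thesis using rowsI[OF H4_mats_uminus[OF A(1)]] A by simp
qed

lemma rows_refl: "(r, s) \<in> bottom_rows \<Longrightarrow> (r, - s) \<in> bottom_rows"
proof -
  assume "(r, s) \<in> bottom_rows"
  then obtain A where A: "A \<in> H4_mats" "A$2$1 = r" "A$2$2 = s" by (rule rowsE)
  show ?thesis using rows_uminus[OF rowsI[OF H4_mats_refl[OF A(1)]]] A by (simp add: refl22_def)
qed

text \<open>Right multiplication by \<open>S_mat\<close> exchanges the entries up to a sign, which
  the reflection removes. On the boundary this is \<open>z \<mapsto> 1 / z\<close>.\<close>

lemma rows_swap: "(r, s) \<in> bottom_rows \<Longrightarrow> (s, r) \<in> bottom_rows"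
proof -
  assume "(r, s) \<in> bottom_rows"
  from rows_refl[OF rows_mult[OF this S_in_H4]] show ?thesis by (simp add: S_mat_eq)
qed

lemma rows_1_0: "(1, 0) \<in> bottom_rows"
  by (rule rows_swap[OF rows_0_1])

lemma rows_T: "(r, s) \<in> bottom_rows \<Longrightarrow> (r, s + sqrt 2 * r) \<in> bottom_rows"
  and rows_T': "(r, s) \<in> bottom_rows \<Longrightarrow> (r, s - sqrt 2 * r) \<in> bottom_rows"
  using rows_mult[OF _ T_in_H4, of r s] rows_mult[OF _ H4_mats_adj[OF T_in_H4], of r s]
  by (simp_all add: T_mat_eq adj_def algebra_simps)

lemma rows_C: "(r, s) \<in> bottom_rows \<Longrightarrow> (r + sqrt 2 * s, s) \<in> bottom_rows"
  and rows_C': "(r, s) \<in> bottom_rows \<Longrightarrow> (r - sqrt 2 * s, s) \<in> bottom_rows"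
  using rows_swap[OF rows_T[OF rows_swap]] rows_swap[OF rows_T'[OF rows_swap]] by blast+

text \<open>The row is multiplied by the matrix of the digit \<open>B\<close>, with rows
  \<open>(sqrt 2, 1)\<close> and \<open>(1, sqrt 2)\<close>; it is composed of two translations with
  a swap and a reflection in between.\<close>

lemma rows_B: "(r, s) \<in> bottom_rows \<Longrightarrow> (sqrt 2 * r + s, r + sqrt 2 * s) \<in> bottom_rows"
proof -
  assume "(r, s) \<in> bottom_rows"
  from rows_T[OF rows_refl[OF rows_swap[OF rows_T[OF this]]]] show ?thesis
    by (simp add: algebra_simps sqrt2_mult)
qed

lemma rows_B': "(r, s) \<in> bottom_rows \<Longrightarrow> (sqrt 2 * r - s, sqrt 2 * s - r) \<in> bottom_rows"
proof -
  assume "(r, s) \<in> bottom_rows"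
  from rows_refl[OF rows_B[OF rows_refl[OF this]]] show ?thesis by simp
qed

lemma rows_T_int: "(r, s) \<in> bottom_rows \<Longrightarrow> (r, s + of_int k * (sqrt 2 * r)) \<in> bottom_rows"
proof (induction k rule: int_induct[where k = 0])
  case (step1 i) then show ?case using rows_T[of r "s + of_int i * (sqrt 2 * r)"] by (simp add: algebra_simps)
next
  case (step2 i) then show ?case using rows_T'[of r "s + of_int i * (sqrt 2 * r)"] by (simp add: algebra_simps)
qed simp

lemma rows_shape:
  fixes r s :: real
  assumes "(r, s) \<in> bottom_rows"
  shows "(\<exists>i j::int. r = sqrt 2 * of_int i \<and> s = of_int j \<and> odd j) \<or>
    (\<exists>i j::int. r = of_int i \<and> s = sqrt 2 * of_int j \<and> odd i)"
proof -
  obtain A where A: "A \<in> H4_mats" "A$2$1 = r" "A$2$2 = s" using assms by (rule rowsE)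
  show ?thesis using H4_mats_shape[OF A(1)] A(2,3) unfolding shape_def by fastforce
qed

lemma rows_abs_ge_1: "(r, s) \<in> bottom_rows \<Longrightarrow> r \<noteq> 0 \<Longrightarrow> \<bar>r\<bar> \<ge> 1"
proof -
  assume "(r, s) \<in> bottom_rows" "r \<noteq> 0"
  then consider i where "r = sqrt 2 * of_int i" "i \<noteq> 0" | i where "r = of_int i" "i \<noteq> 0"
    using rows_shape[of r s] by auto
  then show ?thesis
  proof cases
    case 1
    have "1 * 1 \<le> sqrt 2 * \<bar>real_of_int i\<bar>" by (rule mult_mono) (use 1 in auto)
    then show ?thesis using 1 by (simp add: abs_mult)
  qed auto
qed

text \<open>Both diagonal entries have modulus at least \<open>1\<close> by integrality, and their
  product is \<open>1\<close>.\<close>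

lemma row_zero: "(0, s) \<in> bottom_rows \<Longrightarrow> \<bar>s\<bar> = 1"
proof -
  assume "(0, s) \<in> bottom_rows"
  then obtain A where A: "A \<in> H4_mats" "A$2$1 = 0" "A$2$2 = s" "A$1$1 * s = 1" by (rule rowsE) auto
  have "\<bar>s\<bar> \<ge> 1" using rows_abs_ge_1[OF rows_swap[OF \<open>(0, s) \<in> bottom_rows\<close>]] A(4) by force
  moreover have "\<bar>A$1$1\<bar> \<ge> 1"
  proof -
    have "(- A$2$1, A$1$1) \<in> bottom_rows" using column_iff_row A(1) by blast
    then show ?thesis using rows_abs_ge_1[OF rows_swap] A by fastforce
  qed
  moreover have "\<bar>A$1$1\<bar> * \<bar>s\<bar> = 1" using A by (metis abs_mult abs_one)
  ultimately show ?thesis by (smt (verit) mult_le_cancel_right1)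
qed

section \<open>Geodesics of height below the second gap\<close>

definition dB :: "real \<Rightarrow> real" where "dB z = (2*z + 1) / (2*z + 2)"
definition dC :: "real \<Rightarrow> real" where "dC z = z / (1 + 2*z)"

text \<open>The condition says that the geodesic from \<open>- \<surd>2 v\<close> to \<open>\<surd>2 w\<close> has Markoff value at most
  \<open>\<surd>2 t\<close>: the element of \<open>H4\<close> with bottom row \<open>(r, s)\<close> sends \<open>- s / r\<close> to \<open>\<infinity>\<close> and divides the distance of
  the endpoints by \<open>\<bar>\<surd>2 r w + s\<bar> \<bar>s - \<surd>2 r v\<bar>\<close>.\<close>

definition adm :: "real \<Rightarrow> real \<Rightarrow> real \<Rightarrow> bool" where
  "adm t w v \<longleftrightarrow> w > 0 \<and> v > 0 \<and>
     (\<forall>(r, s)\<in>bottom_rows. w + v \<le> t * (\<bar>sqrt 2 * r * w + s\<bar> * \<bar>s - sqrt 2 * r * v\<bar>))"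

lemma admD: "adm t w v \<Longrightarrow> (r, s) \<in> bottom_rows \<Longrightarrow>
    w + v \<le> t * (\<bar>sqrt 2 * r * w + s\<bar> * \<bar>s - sqrt 2 * r * v\<bar>)"
  by (auto simp: adm_def)

lemma adm_pos: "adm t w v \<Longrightarrow> w > 0" "adm t w v \<Longrightarrow> v > 0"
  by (auto simp: adm_def)

lemma adm_sum: "adm t w v \<Longrightarrow> w + v \<le> t"
  using admD[OF _ rows_0_1] by fastforce

text \<open>The reflection \<open>z \<mapsto> - z\<close> exchanges the roles of the two ends and
  sends the row \<open>(r, s)\<close> to \<open>(- r, s)\<close>.\<close>

lemma adm_swap: "adm t w v \<Longrightarrow> adm t v w"
proof -
  assume a: "adm t w v"
  have "v + w \<le> t * (\<bar>sqrt 2 * r * v + s\<bar> * \<bar>s - sqrt 2 * r * w\<bar>)" if "(r, s) \<in> bottom_rows" for r s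
  proof -
    have "(- r, s) \<in> bottom_rows" using rows_uminus[OF rows_refl[OF that]] by simp
    from admD[OF a this] show ?thesis by (simp add: algebra_simps)
  qed
  with a show ?thesis by (auto simp: adm_def)
qed

text \<open>The map \<open>z \<mapsto> 1 / z\<close> swaps the entries of a row, and both sides of
  each inequality are divided by the same number \<open>2 * w * v\<close>.\<close>

lemma adm_inv: "adm t w v \<Longrightarrow> adm t (1 / (2*w)) (1 / (2 * v))"
proof -
  assume a: "adm t w v"
  note p = adm_pos[OF a]
  have "1/(2*w) + 1/(2 * v) \<le> t * (\<bar>sqrt 2 * r * (1/(2*w)) + s\<bar> * \<bar>s - sqrt 2 * r * (1/(2 * v))\<bar>)"
    if rs: "(r, s) \<in> bottom_rows" for r s
  proof -
    have e: "2*w * (sqrt 2 * r * (1/(2*w)) + s) = sqrt 2 * (sqrt 2 * s * w + r)"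
         "2 * v * (s - sqrt 2 * r * (1/(2 * v))) = - sqrt 2 * (r - sqrt 2 * s * v)"
      using p by (simp_all add: field_simps sqrt2_mult)
    have "(2*w * \<bar>sqrt 2 * r * (1/(2*w)) + s\<bar>) * (2 * v * \<bar>s - sqrt 2 * r * (1/(2 * v))\<bar>) =
        \<bar>2*w * (sqrt 2 * r * (1/(2*w)) + s)\<bar> * \<bar>2 * v * (s - sqrt 2 * r * (1/(2 * v)))\<bar>"
      using p by (simp add: abs_mult)
    also have "\<dots> = 2 * (\<bar>sqrt 2 * s * w + r\<bar> * \<bar>r - sqrt 2 * s * v\<bar>)"
      unfolding e abs_mult by (simp add: sqrt2_mult)
    finally have "2*w * v * (\<bar>sqrt 2 * r * (1/(2*w)) + s\<bar> * \<bar>s - sqrt 2 * r * (1/(2 * v))\<bar>) =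
        \<bar>sqrt 2 * s * w + r\<bar> * \<bar>r - sqrt 2 * s * v\<bar>" by (simp add: algebra_simps)
    with admD[OF a rows_swap[OF rs]]
    have "w + v \<le> t * (2*w * v * (\<bar>sqrt 2 * r * (1/(2*w)) + s\<bar> * \<bar>s - sqrt 2 * r * (1/(2 * v))\<bar>))"
      by simp
    then have "(w + v) / (2*w * v) \<le> t * (\<bar>sqrt 2 * r * (1/(2*w)) + s\<bar> * \<bar>s - sqrt 2 * r * (1/(2 * v))\<bar>)"
      using p by (simp add: pos_divide_le_eq mult_ac)
    then show ?thesis using p by (simp add: field_simps)
  qed
  with p show ?thesis by (auto simp: adm_def)
qed

text \<open>Moving the first digit of the future \<open>w\<close> to the past \<open>v\<close>
  applies one group element to both ends, which merely permutes the inequalities.\<close>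

lemma adm_A: "adm t (1 + w) v \<Longrightarrow> w > 0 \<Longrightarrow> adm t w (1 + v)"
proof -
  assume a: "adm t (1 + w) v" and w: "w > 0"
  have "w + (1 + v) \<le> t * (\<bar>sqrt 2 * r * w + s\<bar> * \<bar>s - sqrt 2 * r * (1 + v)\<bar>)"
    if "(r, s) \<in> bottom_rows" for r s
    using admD[OF a rows_T'[OF that]] by (simp add: algebra_simps)
  with w adm_pos[OF a] show ?thesis by (auto simp: adm_def)
qed

lemma inv_dC: "w > 0 \<Longrightarrow> 1 / (2 * dC w) = 1 + 1 / (2*w)"
  and inv_1: "w > 0 \<Longrightarrow> 1 / (2 * (1 + w)) = dC (1 / (2*w))"
  and inv_dB: "w > 0 \<Longrightarrow> 1 / (2 * dB w) = dB (1 / (2*w))"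
  by (simp_all add: dC_def dB_def divide_simps) (simp_all add: algebra_simps)

lemma adm_C: "adm t (dC w) v \<Longrightarrow> w > 0 \<Longrightarrow> adm t w (dC v)"
proof -
  assume a: "adm t (dC w) v" and w: "w > 0"
  have "adm t (1 + 1 / (2*w)) (1 / (2 * v))" using adm_inv[OF a] inv_dC[OF w] by simp
  from adm_inv[OF adm_A[OF this]] show ?thesis
    using w adm_pos[OF a] inv_1[of "1 / (2 * v)"] by simp
qed

text \<open>Inversion fixes \<open>B\<close>, so this shift is not obtained from that of
  \<open>A\<close> as the one for \<open>C\<close> is. The two sides are compared directly;
  \<open>w + 1\<close> and \<open>v + 1\<close> are, up to a constant, the denominators of the digit
  map at the two ends.\<close>

lemma adm_B: "adm t (dB w) v \<Longrightarrow> w > 0 \<Longrightarrow> adm t w (dB v)"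
proof -
  assume a: "adm t (dB w) v" and w: "w > 0"
  note v = adm_pos(2)[OF a]
  have "w + dB v \<le> t * (\<bar>sqrt 2 * r * w + s\<bar> * \<bar>s - sqrt 2 * r * dB v\<bar>)"
    if rs: "(r, s) \<in> bottom_rows" for r s
  proof -
    let ?r = "sqrt 2 * r - s" and ?s = "sqrt 2 * s - r"
    have 1: "sqrt 2 * (w + 1) * (sqrt 2 * ?r * dB w + ?s) = sqrt 2 * r * w + s"
      using w by (simp add: dB_def field_simps sqrt2_mult)
    have 2: "?s - sqrt 2 * ?r * v = sqrt 2 * (v + 1) * (s - sqrt 2 * r * dB v)"
      using v by (simp add: dB_def field_simps sqrt2_mult)
    have "\<bar>sqrt 2 * r * w + s\<bar> = sqrt 2 * (w + 1) * \<bar>sqrt 2 * ?r * dB w + ?s\<bar>"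
      unfolding 1[symmetric] using w by (simp add: abs_mult)
    moreover have "\<bar>?s - sqrt 2 * ?r * v\<bar> = sqrt 2 * (v + 1) * \<bar>s - sqrt 2 * r * dB v\<bar>"
      unfolding 2 using v by (simp add: abs_mult)
    ultimately have 3: "(w + 1) * (\<bar>sqrt 2 * ?r * dB w + ?s\<bar> * \<bar>?s - sqrt 2 * ?r * v\<bar>)
        = (v + 1) * (\<bar>sqrt 2 * r * w + s\<bar> * \<bar>s - sqrt 2 * r * dB v\<bar>)"
      by (simp add: algebra_simps)
    have "(v + 1) * (w + dB v) = (w + 1) * (dB w + v)"
      using w v by (simp add: dB_def divide_simps) (simp add: algebra_simps)
    also have "\<dots> \<le> (w + 1) * (t * (\<bar>sqrt 2 * ?r * dB w + ?s\<bar> * \<bar>?s - sqrt 2 * ?r * v\<bar>))"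
      using admD[OF a rows_B'[OF rs]] w by simp
    also have "\<dots> = (v + 1) * (t * (\<bar>sqrt 2 * r * w + s\<bar> * \<bar>s - sqrt 2 * r * dB v\<bar>))"
      using arg_cong[OF 3, of "\<lambda>x. t * x"] by (simp only: mult_ac)
    finally show ?thesis using v by simp
  qed
  with w v show ?thesis by (auto simp: adm_def dB_def)
qed

text \<open>The points \<open>1\<close> and \<open>1/2\<close> are cusps: the row that vanishes
  there would force \<open>w + v \<le> 0\<close>. Hence the first digit of a tail is always well
  defined.\<close>

lemma adm_ne: assumes "adm t w v" shows "w \<noteq> 1" "w \<noteq> 1/2"
proof -
  note p = adm_pos[OF assms]
  show "w \<noteq> 1" using admD[OF assms rows_T'[OF rows_1_0]] p by auto
  show "w \<noteq> 1/2"
  proof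
    assume "w = 1/2"
    then have "2 * w - 1 = 0" by simp
    then show False using admD[OF assms rows_refl[OF rows_swap[OF rows_T[OF rows_1_0]]]] p
      by simp
  qed
qed

section \<open>Inverses, monotonicity and ranges of the digit maps\<close>

lemma dB_ex: assumes "1/2 < z" "z < 1" obtains w where "w > 0" "z = dB w"
proof
  show "(2*z - 1) / (2 - 2*z) > 0" using assms by simp
  show "z = dB ((2*z - 1) / (2 - 2*z))"
    using assms by (simp add: dB_def divide_simps)
qed

lemma dC_ex: assumes "0 < z" "z < 1/2" obtains w where "w > 0" "z = dC w"
proof
  show "z / (1 - 2*z) > 0" using assms by simp
  show "z = dC (z / (1 - 2*z))"
    using assms by (simp add: dC_def divide_simps)
qed

lemma dB_less_iff: "z > 0 \<Longrightarrow> w > 0 \<Longrightarrow> dB z < dB w \<longleftrightarrow> z < w"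
  and dC_less_iff: "z > 0 \<Longrightarrow> w > 0 \<Longrightarrow> dC z < dC w \<longleftrightarrow> z < w"
  by (simp_all add: dB_def dC_def divide_simps) (auto simp: algebra_simps)

lemma dB_le: "0 < z \<Longrightarrow> z \<le> w \<Longrightarrow> dB z \<le> dB w"
  and dC_le: "0 < z \<Longrightarrow> z \<le> w \<Longrightarrow> dC z \<le> dC w"
  using dB_less_iff[of z w] dC_less_iff[of z w] by (cases "z = w"; force)+

lemma dB_bounds: "z > 0 \<Longrightarrow> 1/2 < dB z" "z > 0 \<Longrightarrow> dB z < 1"
  and dC_bounds: "z > 0 \<Longrightarrow> 0 < dC z" "z > 0 \<Longrightarrow> dC z < 1/2"
  by (simp_all add: dB_def dC_def divide_simps)

text \<open>The fixed point of \<open>ABAC\<close>, the positive solution of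
  \<open>a = (7 + 18 a) / (4 + 10 a)\<close>. By \<open>tail_le\<close> it bounds every tail that
  follows a \<open>C\<close>.\<close>

definition amax :: real where "amax = (7 + sqrt 119) / 10"

lemma sqrt119: "sqrt 119 * sqrt 119 = 119" "10.9 < sqrt 119" "sqrt 119 < 10.91"
  by (simp, rule real_less_rsqrt, simp add: power2_eq_square, rule real_less_lsqrt)
     (simp_all add: power2_eq_square)

lemma amax_eq: "10 * (amax * amax) = 14 * amax + 7" "1.79 < amax" "amax < 1.791"
  using sqrt119 by (simp_all add: amax_def field_simps)

text \<open>The sum at the centre \<open>A\<close> of a block \<open>BAB\<close> whose tails are
  \<open>BCA\<close> followed by \<open>p\<close>, and \<open>BCBAC\<close> followed by
  \<open>1 / (2 * q)\<close>: inversion turns \<open>BCA\<close> before \<open>q\<close> into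
  \<open>BAC\<close> before \<open>1 / (2 * q)\<close>. Exchanging \<open>p\<close> and
  \<open>q\<close> gives the value at the neighbouring centre \<open>C\<close>.\<close>

definition mixed :: "real \<Rightarrow> real \<Rightarrow> real" where
  "mixed p q = 1 + dB (dC (1 + p)) + dB (dC (1 / (2 * dB (dC (1 + q)))))"

lemma dB_dC_1: "x > -1 \<Longrightarrow> dB (dC (1 + x)) = (5 + 4*x) / (8 + 6*x)"
proof -
  assume "x > -1"
  have "dC (1 + x) = (1 + x) / (3 + 2*x)" by (simp add: dC_def algebra_simps)
  then have "dB (dC (1 + x)) = dB ((1 + x) / (3 + 2*x))" by simp
  also have "\<dots> = (5 + 4*x) / (8 + 6*x)"
    using \<open>x > -1\<close> by (simp add: dB_def divide_simps)
  finally show ?thesis .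
qed

lemma mixed_eq:
  assumes "p > -1" "q > -1"
  shows "mixed p q = 1 + (5 + 4*p) / (8 + 6*p) + (21 + 16*q) / (34 + 26*q)"
proof -
  have "1 / (2 * dB (dC (1 + q))) = (4 + 3*q) / (5 + 4*q)"
    unfolding dB_dC_1[OF assms(2)] using assms by (simp add: divide_simps) (simp add: algebra_simps)
  moreover have "dC ((4 + 3*q) / (5 + 4*q)) = (4 + 3*q) / (13 + 10*q)"
    using assms by (simp add: dC_def divide_simps)
  moreover have "dB ((4 + 3*q) / (13 + 10*q)) = (21 + 16*q) / (34 + 26*q)"
    using assms by (simp add: dB_def divide_simps)
  ultimately have "dB (dC (1 / (2 * dB (dC (1 + q))))) = (21 + 16*q) / (34 + 26*q)"
    by (simp only:)
  then show ?thesis using dB_dC_1[OF assms(1)] by (simp add: mixed_def)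
qed

definition gap_end :: real where "gap_end = (2124 + 48 * sqrt 119) / 1177"

text \<open>By \<open>after_CA_ge\<close>, \<open>1 / (2 * amax)\<close> is the least remainder
  behind \<open>CA\<close>. Giving it to both parameters produces the closed form of the upper
  end.\<close>

lemma mixed_amax: "mixed (1 / (2 * amax)) (1 / (2 * amax)) = gap_end"
proof -
  have p: "1 / (2 * amax) = (sqrt 119 - 7) / 14"
    using sqrt119 by (simp add: amax_def divide_simps) (simp add: algebra_simps)
  let ?p = "(sqrt 119 - 7) / 14"
  have "mixed ?p ?p = 1 + (5 + 4 * ?p) / (8 + 6 * ?p) + (21 + 16 * ?p) / (34 + 26 * ?p)"
    using sqrt119 by (intro mixed_eq) auto
  also have "(5 + 4 * ?p) / (8 + 6 * ?p) = ((21 + 2 * sqrt 119) / 7) / ((35 + 3 * sqrt 119) / 7)"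
    by (rule arg_cong2[where f = "(/)"]) (simp_all add: field_simps)
  also have "(21 + 16 * ?p) / (34 + 26 * ?p) = ((91 + 8 * sqrt 119) / 7) / ((147 + 13 * sqrt 119) / 7)"
    by (rule arg_cong2[where f = "(/)"]) (simp_all add: field_simps)
  also have "1 + (21 + 2 * sqrt 119) / 7 / ((35 + 3 * sqrt 119) / 7) +
      (91 + 8 * sqrt 119) / 7 / ((147 + 13 * sqrt 119) / 7) =
      1 + (21 + 2 * sqrt 119) / (35 + 3 * sqrt 119) + (91 + 8 * sqrt 119) / (147 + 13 * sqrt 119)"
    by (simp only: divide_divide_eq_left divide_divide_eq_right times_divide_eq_left nonzero_mult_div_cancel_right
      zero_neq_numeral not_False_eq_True)
  also have "\<dots> = gap_end"
    using sqrt119 by (simp add: gap_end_def divide_simps) (simp add: algebra_simps)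
  finally show ?thesis unfolding p .
qed

text \<open>The gain of the first fraction in \<open>p\<close> outweighs the loss of the second one.\<close>

lemma mixed_sum_ge:
  assumes "p \<ge> p0" "q \<ge> p0" "p0 > 0"
  shows "mixed p q + mixed q p \<ge> 2 * mixed p0 p0"
proof -
  have k: "(5 + 4*x) / (8 + 6*x) + (21 + 16*x) / (34 + 26*x) \<ge>
      (5 + 4*p0) / (8 + 6*p0) + (21 + 16*p0) / (34 + 26*p0)" if x: "x \<ge> p0" for x
  proof -
    \<comment> \<open>Both fractions are linear fractional in \<open>x\<close>, with determinants
      \<open>2\<close> and \<open>- 2\<close>, so only the denominators remain to be
      compared.\<close>
    have 1: "(5 + 4*x) / (8 + 6*x) - (5 + 4*p0) / (8 + 6*p0) =
        (x - p0) * (2 / ((8 + 6*x) * (8 + 6*p0)))"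
      using x assms by (simp add: divide_simps) (simp add: algebra_simps)
    have 2: "(21 + 16*p0) / (34 + 26*p0) - (21 + 16*x) / (34 + 26*x) =
        (x - p0) * (2 / ((34 + 26*x) * (34 + 26*p0)))"
      using x assms by (simp add: divide_simps) (simp add: algebra_simps)
    have "(8 + 6*x) * (8 + 6*p0) \<le> (34 + 26*x) * (34 + 26*p0)"
      using x assms by (intro mult_mono) auto
    then have "2 / ((34 + 26*x) * (34 + 26*p0)) \<le> 2 / ((8 + 6*x) * (8 + 6*p0))"
      using x assms by (intro divide_left_mono mult_pos_pos) auto
    then have "(x - p0) * (2 / ((34 + 26*x) * (34 + 26*p0))) \<le> (x - p0) * (2 / ((8 + 6*x) * (8 + 6*p0)))"
      using x by (intro mult_left_mono) auto
    then show ?thesis using 1 2 by linarith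
  qed
  have "(5 + 4*p) / (8 + 6*p) + (21 + 16*p) / (34 + 26*p) + ((5 + 4*q) / (8 + 6*q) + (21 + 16*q) / (34 + 26*q))
      \<ge> 2 * ((5 + 4*p0) / (8 + 6*p0) + (21 + 16*p0) / (34 + 26*p0))"
    using add_mono[OF k[OF assms(1)] k[OF assms(2)]] by simp
  moreover have e: "mixed p q = 1 + (5 + 4*p) / (8 + 6*p) + (21 + 16*q) / (34 + 26*q)"
      "mixed q p = 1 + (5 + 4*q) / (8 + 6*q) + (21 + 16*p) / (34 + 26*p)"
      "mixed p0 p0 = 1 + (5 + 4*p0) / (8 + 6*p0) + (21 + 16*p0) / (34 + 26*p0)"
    using assms by (auto intro!: mixed_eq)
  ultimately show ?thesis unfolding e by argo
qed

lemma mixed_antimono: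
  assumes "-1 < q" "q \<le> q'" "-1 < p" shows "mixed p q' \<le> mixed p q"
proof -
  have "(21 + 16*q') / (34 + 26*q') \<le> (21 + 16*q) / (34 + 26*q)"
    using assms by (simp add: divide_simps) (simp add: algebra_simps)
  then show ?thesis using assms by (simp add: mixed_eq)
qed

lemma mixed_mono:
  assumes "-1 < p" "p \<le> p'" "-1 < q" shows "mixed p q \<le> mixed p' q"
proof -
  have "(5 + 4*p) / (8 + 6*p) \<le> (5 + 4*p') / (8 + 6*p')"
    using assms by (simp add: divide_simps) (simp add: algebra_simps)
  then show ?thesis using assms by (simp add: mixed_eq)
qed

lemma sqrt5: "sqrt 5 * sqrt 5 = 5" "2 < sqrt 5" "sqrt 5 < 3"
  by (simp, rule real_less_rsqrt, simp, rule real_less_lsqrt) simp_all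

section \<open>Patterns excluded by a bound slightly above \<open>gap_end\<close>\<close>

context
  fixes t :: real
  assumes t: "t \<le> 9/4"
begin

text \<open>The value at the cusp \<open>0\<close> gives \<open>1 / (2 * w) < 9/4\<close>, and
  \<open>2/9\<close> is \<open>1 / (2 * (9/4))\<close>.\<close>

lemma adm_gt_2_9: "adm t w v \<Longrightarrow> w > 2/9"
proof -
  assume a: "adm t w v"
  have "1/(2*w) + 1/(2 * v) \<le> 9/4" using adm_sum[OF adm_inv[OF a]] t by simp
  moreover have "1/(2 * v) > 0" using adm_pos[OF a] by simp
  ultimately have "1/(2*w) < 9/4" by linarith
  then show ?thesis using adm_pos[OF a] by (simp add: field_simps)
qed

text \<open>A tail of at least \<open>2\<close> begins with \<open>AA\<close>. After two shifts the
  remainder \<open>w - 2\<close> exceeds \<open>2/9\<close>, and so does \<open>v\<close>; but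
  \<open>2 + 4/9\<close> is larger than \<open>9/4\<close>.\<close>

lemma adm_less_2: "adm t w v \<Longrightarrow> w < 2"
proof (rule ccontr)
  assume a: "adm t w v" and "\<not> w < 2"
  then have w: "w \<ge> 2" by simp
  have 1: "adm t (w - 1) (1 + v)" using adm_A[of t "w - 1" v] a w by simp
  have "w - 1 > 1" using adm_ne(1)[OF 1] w by simp
  then have "adm t (w - 2) (1 + (1 + v))" using adm_A[of t "w - 2" "1 + v"] 1 by simp
  from adm_gt_2_9[OF this] adm_gt_2_9[OF adm_swap[OF a]] adm_sum[OF a] t show False by simp
qed

text \<open>Inversion turns the exclusion of \<open>AA\<close> into that of
  \<open>CC\<close>.\<close>

lemma adm_gt_1_4: "adm t w v \<Longrightarrow> w > 1/4"
  using adm_less_2[OF adm_inv, of w v] adm_pos[of t w v] by (simp add: field_simps)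

text \<open>The two tails next to a letter \<open>A\<close>; inversion brings a letter \<open>C\<close> into the same form.\<close>

definition centre :: "real \<Rightarrow> real \<Rightarrow> bool" where
  "centre X Y \<longleftrightarrow> 0 < X \<and> adm t (1 + X) Y"

lemma centreD:
  assumes "centre X Y"
  shows "0 < X" "0 < Y" "X < 1" "Y < 1" "X \<noteq> 1/2" "Y \<noteq> 1/2" "1 + X + Y \<le> t"
    "adm t X (1 + Y)" "centre Y X"
proof -
  show X: "0 < X" and a: "adm t X (1 + Y)" using assms adm_A by (auto simp: centre_def)
  show Y: "0 < Y" using assms adm_pos by (auto simp: centre_def)
  show c: "centre Y X" using adm_swap[OF a] Y by (simp add: centre_def)
  show "X < 1" "Y < 1" using adm_less_2 assms c unfolding centre_def by fastforce+
  show "1 + X + Y \<le> t" using assms adm_sum by (auto simp: centre_def)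
  have "adm t Y (1 + X)" using adm_A c by (auto simp: centre_def)
  then show "X \<noteq> 1/2" "Y \<noteq> 1/2" using a adm_ne(2) by auto
qed

text \<open>A digit other than \<open>C\<close> behind the \<open>B\<close> of \<open>X\<close>
  would give \<open>X \<ge> dB (1/2) = 2/3\<close>, while always
  \<open>Y \<ge> dB (2/9) = 13/22\<close>; then \<open>1 + X + Y\<close> exceeds \<open>9/4\<close>.
  A second \<open>C\<close> is impossible because \<open>dC (1/2) = 1/4\<close>.\<close>

lemma BAB_step:
  assumes "centre X Y" "X > 1/2" "Y > 1/2"
  obtains X2 where "X = dB (dC X2)" "1/2 < X2" "X2 \<noteq> 1"
    "adm t (dC X2) (dB (1 + Y))" "adm t X2 (dC (dB (1 + Y)))"
proof -
  note c = centreD[OF assms(1)]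
  obtain X1 where X1: "X1 > 0" "X = dB X1" using assms c by (metis dB_ex)
  obtain Y1 where Y1: "Y1 > 0" "Y = dB Y1" using assms c by (metis dB_ex)
  have aX: "adm t X1 (dB (1 + Y))" using adm_B c(8) X1 by blast
  have aY: "adm t Y1 (dB (1 + X))" using adm_B centreD(8)[OF c(9)] Y1 by blast
  have "X1 < 1/2"
  proof (rule ccontr)
    assume "\<not> X1 < 1/2"
    then have "X \<ge> dB (1/2)" using dB_le X1 by simp
    moreover have "Y \<ge> dB (2/9)" using dB_le[of "2/9" Y1] adm_gt_2_9[OF aY] Y1 by simp
    ultimately show False using c(7) t by (simp add: dB_def)
  qed
  then obtain X2 where X2: "X2 > 0" "X1 = dC X2" using X1 by (metis dC_ex)
  have a2: "adm t X2 (dC (dB (1 + Y)))" using adm_C aX X2 by blast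
  have "X2 > 1/2" using adm_gt_1_4[OF aX] X2 by (simp add: dC_def field_simps)
  with that X1 X2 aX a2 adm_ne[OF a2] show thesis by blast
qed

text \<open>If both neighbours of the \<open>A\<close> were \<open>B\<close>, then
  \<open>BAB_step\<close> would make the digit behind the second one a \<open>C\<close>, which
  \<open>Z \<ge> 1/2\<close> forbids.\<close>

lemma not_ABAB:
  assumes "centre X (dB Z)" "Z \<ge> 1/2" shows "X < 1/2"
proof (rule ccontr)
  assume "\<not> X < 1/2"
  then have "X > 1/2" using centreD(5)[OF assms(1)] by simp
  then obtain W where W: "dB Z = dB (dC W)" "1/2 < W"
    using BAB_step[OF centreD(9)[OF assms(1)]] dB_bounds[of Z] assms(2) by auto
  have "dC W < 1/2" "dC W > 0" using dC_bounds[of W] W by auto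
  then show False using W(1) dB_less_iff[of "dC W" Z] assms(2) by auto
qed

text \<open>The condition \<open>v < 1/2\<close> records that the preceding letter is
  \<open>C\<close>. A tail that begins with \<open>ABAC\<close> and then \<open>A\<close> reproduces
  the hypotheses; any other one is at most \<open>25/14\<close>, the image of \<open>1\<close> under
  \<open>ABAC\<close>.\<close>

lemma tail_step:
  assumes "adm t w v" "v < 1/2" "w > 1"
  shows "w \<le> 25/14 \<or> (\<exists>w' v'. adm t w' v' \<and> v' < 1/2 \<and> w' > 1 \<and> w = (7 + 18*w') / (4 + 10*w'))"
proof -
  define X where "X = w - 1"
  have cX: "centre X v" using assms by (simp add: centre_def X_def)
  note c = centreD[OF cX]
  show ?thesis
  proof (cases "X < 1/2")
    case False
    then obtain X1 where X1: "X1 > 0" "X = dB X1" using c by (metis dB_ex linorder_neqE)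
    have a1: "adm t X1 (dB (1 + v))" using adm_B c(8) X1 by blast
    show ?thesis
    proof (cases "X1 > 1")
      case True
      define X2 where "X2 = X1 - 1"
      have c2: "centre X2 (dB (1 + v))" using a1 True by (simp add: centre_def X2_def)
      have "X2 < 1/2" using not_ABAB[OF c2] c by simp
      then obtain X3 where X3: "X3 > 0" "X2 = dC X3" using centreD(1)[OF c2] by (metis dC_ex)
      have a3: "adm t X3 (dC (1 + dB (1 + v)))" using adm_C centreD(8)[OF c2] X3 by blast
      have e: "w = (7 + 18*X3) / (4 + 10*X3)"
      proof -
        have "1 + dC X3 = (1 + 3*X3) / (1 + 2*X3)" using X3 by (simp add: dC_def field_simps)
        then have "w = 1 + dB ((1 + 3*X3) / (1 + 2*X3))"
          using X1(2) X3(2) unfolding X_def X2_def by (smt (verit))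
        also have "\<dots> = (7 + 18*X3) / (4 + 10*X3)"
          using X3 by (simp add: dB_def divide_simps)
        finally show ?thesis .
      qed
      show ?thesis
      proof (cases "X3 > 1")
        case True
        have "dC (1 + dB (1 + v)) < 1/2" using dC_bounds(2) dB_bounds(1)[of "1 + v"] c(2) by simp
        then show ?thesis using a3 e True by blast
      next
        case False
        then have "w \<le> 25/14" unfolding e using X3 by (simp add: field_simps)
        then show ?thesis ..
      qed
    next
      case False
      then have "X \<le> dB 1" using dB_le X1 by simp
      then show ?thesis by (simp add: X_def dB_def)
    qed
  qed (simp add: X_def)
qed

text \<open>Instead of unrolling the recursion, one takes the supremum \<open>\<alpha>\<close> of
  all such tails. It satisfies \<open>\<alpha> \<le> (7 + 18 \<alpha>) / (4 + 10 \<alpha>)\<close>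
  because this map is increasing, and that fails beyond its fixed point \<open>amax\<close>.\<close>

lemma tail_le:
  assumes "adm t w v" "v < 1/2"
  shows "w \<le> amax"
proof (rule ccontr)
  assume w: "\<not> w \<le> amax"
  define S where "S = {w. w > 1 \<and> (\<exists>v<1/2. adm t w v)}"
  have wS: "w \<in> S" using assms w amax_eq by (auto simp: S_def)
  have bdd: "bdd_above S" using adm_less_2 by (intro bdd_aboveI[of _ 2]) (force simp: S_def)
  define \<alpha> where "\<alpha> = Sup S"
  have up: "x \<le> \<alpha>" if "x \<in> S" for x unfolding \<alpha>_def using cSup_upper that bdd by blast
  have \<alpha>: "\<alpha> > amax" using up[OF wS] w by simp
  have "x \<le> (7 + 18*\<alpha>) / (4 + 10*\<alpha>)" if x: "x \<in> S" for x
  proof -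
    have b: "(7 + 18*y) / (4 + 10*y) \<le> (7 + 18*\<alpha>) / (4 + 10*\<alpha>)" if "1 \<le> y" "y \<le> \<alpha>" for y
      using that \<alpha> amax_eq by (simp add: divide_simps) (simp add: algebra_simps)
    from x tail_step consider "x \<le> 25/14" | y where "y \<in> S" "x = (7 + 18*y) / (4 + 10*y)"
      unfolding S_def by blast
    then show ?thesis
    proof cases
      case 1
      then have "x \<le> (7 + 18*1) / (4 + 10*1)" by simp
      also have "\<dots> \<le> (7 + 18*\<alpha>) / (4 + 10*\<alpha>)" by (rule b) (use \<alpha> amax_eq in auto)
      finally show ?thesis .
    next
      case 2
      then show ?thesis using b[of y] up[of y] by (simp add: S_def)
    qed
  qed
  then have "\<alpha> \<le> (7 + 18*\<alpha>) / (4 + 10*\<alpha>)" unfolding \<alpha>_def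
    using wS by (intro cSup_least) auto
  then have "10 * (\<alpha> * \<alpha>) \<le> 14 * \<alpha> + 7" using \<alpha> amax_eq by (simp add: field_simps)
  moreover have "(\<alpha> - amax) * (10 * (\<alpha> + amax) - 14) > 0"
    using \<alpha> amax_eq by (intro mult_pos_pos) auto
  ultimately show False using amax_eq(1) by (simp add: algebra_simps)
qed

text \<open>Two extreme tails meet at the centre: \<open>Y\<close> is \<open>C\<close> followed by
  at most \<open>amax\<close>, and \<open>X\<close> is at most \<open>BAC\<close> followed by
  \<open>amax\<close>. The sum of these bounds is the value of the periodic word
  \<open>ABAC\<close>.\<close>

lemma centre_C_le:
  assumes "centre X Y" "Y < 1/2"
  shows "1 + X + Y \<le> sqrt 119 / 5"
proof (cases "X < 1/2")
  case True
  then show ?thesis using assms sqrt119 by simp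
next
  case False
  note c = centreD[OF assms(1)]
  obtain Y1 where Y1: "Y1 > 0" "Y = dC Y1" using assms c by (metis dC_ex)
  have "adm t Y1 (dC (1 + X))" using adm_C centreD(8)[OF c(9)] Y1 by blast
  then have "Y1 \<le> amax" using tail_le dC_bounds c by auto
  then have Y: "Y \<le> dC amax" using dC_le Y1 by simp
  obtain X1 where X1: "X1 > 0" "X = dB X1" using c False by (metis dB_ex linorder_neqE)
  have a1: "adm t X1 (dB (1 + Y))" using adm_B c(8) X1 by blast
  have "X1 \<le> 1 + dC amax"
  proof (cases "X1 > 1")
    case True
    define X2 where "X2 = X1 - 1"
    have c2: "centre X2 (dB (1 + Y))" using a1 True by (simp add: centre_def X2_def)
    have "X2 < 1/2" using not_ABAB[OF c2] c by simp
    then obtain X3 where X3: "X3 > 0" "X2 = dC X3" using centreD(1)[OF c2] by (metis dC_ex)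
    have a3: "adm t X3 (dC (1 + dB (1 + Y)))" using adm_C centreD(8)[OF c2] X3 by blast
    moreover have "dC (1 + dB (1 + Y)) < 1/2" using dC_bounds(2) dB_bounds(1)[of "1 + Y"] c(2) by simp
    ultimately have "X2 \<le> dC amax" using dC_le X3 tail_le by simp
    then show ?thesis by (simp add: X2_def)
  next
    case False
    moreover have "0 < dC amax" using dC_bounds(1) amax_eq by simp
    ultimately show ?thesis by linarith
  qed
  then have "X \<le> dB (1 + dC amax)" using dB_le X1 by simp
  moreover have "1 + dB (1 + dC amax) + dC amax = sqrt 119 / 5"
  proof -
    have "dC amax = (sqrt 119 - 7) / 10"
      using sqrt119 by (simp add: dC_def amax_def divide_simps) (simp add: algebra_simps)
    moreover from this have "dB (1 + dC amax) = dB (1 + (sqrt 119 - 7) / 10)" by (simp only:)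
    moreover have "dB (1 + (sqrt 119 - 7) / 10) = (sqrt 119 - 3) / 10"
      using sqrt119 by (simp add: dB_def divide_simps) (simp add: algebra_simps)
    ultimately show ?thesis by argo
  qed
  ultimately show ?thesis using Y by simp
qed

section \<open>Blocks around \<open>BAB\<close> and their forced continuation\<close>

lemma inv_centre:
  assumes "adm t (dC Z) V" "Z > 0"
  shows "centre (1 / (2 * Z)) (1 / (2 * V))"
  using adm_inv[OF assms(1)] inv_dC[OF assms(2)] assms by (simp add: centre_def)

text \<open>Passing from the centre of a block \<open>BAB\<close> to the neighbouring centre of \<open>BCB\<close>,
  which inversion turns into a block \<open>BAB\<close> again.\<close>

lemma next_centre:
  assumes "centre X Y" "X > 1/2" "Y > 1/2" "X = dB (dC X2)" "1/2 < X2" "X2 < 1"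
    "adm t (dC X2) (dB (1 + Y))"
  obtains Z where "1/2 < Z" "Z \<noteq> 1" "X2 = 1 / (2 * dB (dC Z))"
    "centre (dB (dC Z)) (dB (dC (1 / (2 * Y))))" "adm t (dC Z) (dB (1 + dB (dC (1 / (2 * Y)))))"
    "adm t Z (dC (dB (1 + dB (dC (1 / (2 * Y))))))"
proof -
  have Y: "1 / (2 * dB (1 + Y)) = dB (dC (1 / (2 * Y)))"
    using assms(3) inv_dB[of "1 + Y"] inv_1[of Y] by simp
  have c: "centre (1 / (2 * X2)) (dB (dC (1 / (2 * Y))))"
    using inv_centre[OF assms(7)] assms(5) Y by simp
  have "1 / (2 * X2) > 1/2" using assms(5,6) by simp
  moreover have "dB (dC (1 / (2 * Y))) > 1/2" using assms(3) dB_bounds dC_bounds by simp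
  ultimately obtain Z where Z: "1 / (2 * X2) = dB (dC Z)" "1/2 < Z" "Z \<noteq> 1"
    "adm t (dC Z) (dB (1 + dB (dC (1 / (2 * Y)))))"
    "adm t Z (dC (dB (1 + dB (dC (1 / (2 * Y))))))"
    using BAB_step[OF c] by blast
  have "X2 = 1 / (2 * dB (dC Z))" unfolding Z(1)[symmetric] using assms(5) by simp
  with that Z c show thesis by simp
qed

text \<open>Inversion makes a lower bound out of \<open>tail_le\<close>: the letter \<open>A\<close>
  in front of \<open>X2 - 1\<close> becomes a \<open>C\<close>, so \<open>1 / (2 * (X2 - 1))\<close>
  is at most \<open>amax\<close>.\<close>

lemma after_CA_ge:
  assumes "adm t X2 (dC V)" "X2 > 1" "V > 0"
  shows "X2 - 1 \<ge> 1 / (2 * amax)"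
proof -
  have a: "adm t (X2 - 1) (1 + dC V)" using adm_A[of t "X2 - 1"] assms by simp
  have "1 / (2 * (1 + dC V)) < 1/2" using dC_bounds(1)[OF assms(3)] by simp
  then have "1 / (2 * (X2 - 1)) \<le> amax" using tail_le[OF adm_inv[OF a]] by blast
  then show ?thesis using assms(2) amax_eq by (simp add: field_simps)
qed

text \<open>If \<open>A\<close> followed \<open>BC\<close> on one side, this centre and the next one
  on the other side would have the values \<open>mixed p q\<close> and \<open>mixed q p\<close>.
  Both are at most \<open>t\<close>, yet their sum is at least \<open>2 * gap_end\<close>.\<close>

lemma BAB_tail_less_1:
  assumes "centre X Y" "X > 1/2" "Y > 1/2" "t < gap_end"
    "X = dB (dC X2)" "X2 > 1/2" "X2 \<noteq> 1" "adm t X2 (dC (dB (1 + Y)))"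
  shows "X2 < 1"
proof (rule ccontr)
  assume "\<not> X2 < 1"
  then have X2: "X2 > 1" using assms(7) by simp
  note c = centreD[OF assms(1)]
  let ?p0 = "1 / (2 * amax)"
  have p0: "?p0 > 0" using amax_eq by simp
  define p where "p = X2 - 1"
  have p: "p \<ge> ?p0" unfolding p_def
    using after_CA_ge[OF assms(8) X2] dB_bounds(1)[of "1 + Y"] c by simp
  obtain Y2 where Y2: "Y = dB (dC Y2)" "1/2 < Y2" "Y2 \<noteq> 1" "adm t (dC Y2) (dB (1 + X))"
    using BAB_step[OF c(9) assms(3,2)] by blast
  \<comment> \<open>With \<open>A\<close> behind \<open>BC\<close> on both sides the value would be
    at least \<open>1 + 2 * dB (dC 1) = 1 + 2 * (5/8) = 9/4\<close>.\<close>
  have "Y2 < 1"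
  proof (rule ccontr)
    assume "\<not> Y2 < 1"
    then have "X \<ge> dB (dC 1)" "Y \<ge> dB (dC 1)"
      using assms(5) Y2(1) X2 by (auto intro!: dB_le dC_le dC_bounds)
    then show False using c(7) t assms(4) p0 mixed_amax sqrt119
      by (simp add: dB_def dC_def gap_end_def)
  qed
  then obtain Z where Z: "1/2 < Z" "Z \<noteq> 1" "Y2 = 1 / (2 * dB (dC Z))"
    "centre (dB (dC Z)) (dB (dC (1 / (2 * X))))"
    "adm t Z (dC (dB (1 + dB (dC (1 / (2 * X))))))"
    using next_centre[OF c(9) assms(3,2) Y2(1,2) _ Y2(4)] by blast
  define q where "q = Z - 1"
  have F1: "mixed p q \<le> t" using c(7) unfolding mixed_def p_def q_def assms(5) Y2(1) Z(3) by simp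
  have F2: "mixed q p \<le> t"
    using centreD(7)[OF Z(4)] unfolding mixed_def p_def q_def assms(5) by simp
  show False
  proof (cases "Z > 1")
    case True
    have "dB (dC (1 / (2 * X))) > 1/2" using c(1) dB_bounds(1) dC_bounds(1) by simp
    then have pos: "dB (1 + dB (dC (1 / (2 * X)))) > 1/2" by (intro dB_bounds(1)) simp
    have "q \<ge> ?p0" unfolding q_def
      by (rule after_CA_ge[OF Z(5) True]) (use pos in simp)
    then show False
      using mixed_sum_ge[OF p _ p0, of q] F1 F2 mixed_amax assms(4) by simp
  next
    \<comment> \<open>Now \<open>q \<le> 0\<close>, so \<open>mixed p q\<close> alone is too large:
      it increases in \<open>p\<close>, which is at least \<open>?p0\<close>, and decreases in
      \<open>q\<close>, which is below \<open>?p0\<close>.\<close>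
    case False
    then have "mixed ?p0 ?p0 \<le> mixed p q"
      using mixed_antimono[of q ?p0 p] mixed_mono[OF _ p, of ?p0] p p0 Z(1) by (simp add: q_def)
    then show False using F1 mixed_amax assms(4) by simp
  qed
qed

text \<open>Applied to this centre and to the inverted next one, \<open>BAB_tail_less_1\<close>
  leaves only the continuation \<open>BCBA\<close> to another centre \<open>A\<close> of a block
  \<open>BAB\<close>; the fraction is the map \<open>BCBA\<close>.\<close>

lemma BAB_next:
  assumes "centre X Y" "X > 1/2" "Y > 1/2" "t < gap_end"
  obtains x y where "centre x y" "x > 1/2" "y > 1/2" "X = (8 + 5*x) / (13 + 8*x)"
proof -
  note c = centreD[OF assms(1)]
  obtain X2 where X2: "X = dB (dC X2)" "1/2 < X2" "X2 \<noteq> 1" "adm t (dC X2) (dB (1 + Y))"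
      "adm t X2 (dC (dB (1 + Y)))"
    using BAB_step[OF assms(1-3)] by blast
  have "X2 < 1" using BAB_tail_less_1[OF assms X2(1-3,5)] .
  then obtain Z where Z: "1/2 < Z" "Z \<noteq> 1" "X2 = 1 / (2 * dB (dC Z))"
    "centre (dB (dC Z)) (dB (dC (1 / (2 * Y))))" "adm t (dC Z) (dB (1 + dB (dC (1 / (2 * Y)))))"
    "adm t Z (dC (dB (1 + dB (dC (1 / (2 * Y))))))"
    using next_centre[OF assms(1-3) X2(1,2) _ X2(4)] by blast
  have b: "dB (dC Z) > 1/2" "dB (dC (1 / (2 * Y))) > 1/2"
    using dB_bounds(1)[OF dC_bounds(1)] Z(1) assms(3) by auto
  have Z1: "Z < 1" using BAB_tail_less_1[OF Z(4) b assms(4) refl Z(1,2,6)] .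
  define x where "x = 1 / (2 * Z)"
  let ?V = "dB (1 + dB (dC (1 / (2 * Y))))"
  have cx: "centre x (1 / (2 * ?V))" unfolding x_def using inv_centre[OF Z(5)] Z(1) by simp
  have "?V > 0" "?V < 1" using b(2) dB_bounds[of "1 + dB (dC (1 / (2 * Y)))"] by auto
  then have "1 / (2 * ?V) > 1/2" by (simp add: field_simps)
  moreover have x: "x > 1/2" using Z1 Z(1) by (simp add: x_def)
  moreover have "X = (8 + 5*x) / (13 + 8*x)"
  proof -
    have "X2 = dB (1 + x)" unfolding Z(3) x_def
      using inv_dB[of "dC Z"] inv_dC[of Z] dC_bounds(1)[of Z] Z(1) by simp
    then have "X = dB (dC (dB (1 + x)))" using X2(1) by simp
    also have "dB (1 + x) = (3 + 2*x) / (4 + 2*x)" by (simp add: dB_def algebra_simps)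
    also have "dC ((3 + 2*x) / (4 + 2*x)) = (3 + 2*x) / (10 + 6*x)"
      using x by (simp add: dC_def divide_simps)
    finally show ?thesis using x by (simp add: dB_def divide_simps) (simp add: algebra_simps)
  qed
  ultimately show thesis using that cx by blast
qed

text \<open>By \<open>BAB_next\<close>, \<open>X\<close> is an image under arbitrarily many copies
  of the map \<open>x \<mapsto> (8 + 5 x) / (13 + 8 x)\<close>. Its determinant is \<open>1\<close>
  and its denominators are at least \<open>13\<close>, so it contracts towards its fixed point, the
  positive root of \<open>g^2 = 1 - g\<close>.\<close>

lemma BAB_periodic:
  assumes "centre X Y" "X > 1/2" "Y > 1/2" "t < gap_end"
  shows "X = (sqrt 5 - 1) / 2"
proof -
  define g where "g = (sqrt 5 - 1) / 2"
  have g: "g * g = 1 - g" "g > 0" "g < 1" using sqrt5 by (simp_all add: g_def field_simps)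
  have "\<bar>X - g\<bar> \<le> (1/2) ^ n" for n
    using assms(1-3)
  proof (induction n arbitrary: X Y)
    case 0
    then show ?case using centreD[OF 0(1)] g by (simp add: abs_le_iff)
  next
    case (Suc n)
    obtain x y where x: "centre x y" "x > 1/2" "y > 1/2" "X = (8 + 5*x) / (13 + 8*x)"
      using BAB_next[OF Suc.prems assms(4)] by blast
    have "g = (8 + 5*g) / (13 + 8*g)" using g by (simp add: field_simps)
    then have "X - g = (8 + 5*x) / (13 + 8*x) - (8 + 5*g) / (13 + 8*g)" using x(4) by simp
    also have "\<dots> = (x - g) * (1 / ((13 + 8*x) * (13 + 8*g)))"
      using x(2) g by (simp add: divide_simps) (simp add: algebra_simps)
    finally have "X - g = (x - g) * (1 / ((13 + 8*x) * (13 + 8*g)))" .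
    then have "\<bar>X - g\<bar> = \<bar>x - g\<bar> * (1 / ((13 + 8*x) * (13 + 8*g)))"
      using x(2) g by (simp add: abs_mult)
    also have "\<dots> \<le> (1/2) ^ n * (1/2)"
    proof (rule mult_mono)
      have "13 * 13 \<le> (13 + 8*x) * (13 + 8*g)" using x(2) g by (intro mult_mono) auto
      then show "1 / ((13 + 8*x) * (13 + 8*g)) \<le> 1/2" by (simp add: field_simps)
    qed (use Suc.IH[OF x(1-3)] x(2) g in auto)
    finally show ?case by simp
  qed
  then have "\<bar>X - g\<bar> \<le> 0"
    by (intro LIMSEQ_le_const[OF LIMSEQ_realpow_zero[of "1/2"]]) auto
  then show ?thesis by (simp add: g_def)
qed

text \<open>A cut without a tail above \<open>1\<close> has sum at most \<open>2\<close>. At a cut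
  next to an \<open>A\<close>, either some neighbour of the \<open>A\<close> is \<open>C\<close>, or
  both are \<open>B\<close>, since \<open>AA\<close> is excluded.\<close>

lemma adm_sum_cases:
  assumes "adm t w v" "t < gap_end"
  shows "w + v \<le> sqrt 119 / 5 \<or> w + v = sqrt 5"
proof -
  have c: "1 + X + Y \<le> sqrt 119 / 5 \<or> 1 + X + Y = sqrt 5" if "centre X Y" for X Y
  proof -
    note c = centreD[OF that]
    consider "Y < 1/2" | "X < 1/2" | "X > 1/2" "Y > 1/2" using c by linarith
    then show ?thesis
    proof cases
      case 1
      then show ?thesis using centre_C_le that by blast
    next
      case 2
      then show ?thesis using centre_C_le[OF c(9)] by simp
    next
      case 3
      then show ?thesis using BAB_periodic[OF that 3 assms(2)] BAB_periodic[OF c(9) 3(2,1) assms(2)]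
        by (simp add: field_simps)
    qed
  qed
  note p = adm_pos[OF assms(1)]
  consider "w > 1" | "v > 1" | "w \<le> 1" "v \<le> 1" by linarith
  then show ?thesis
  proof cases
    case 1
    then show ?thesis using c[of "w - 1" v] assms(1) by (simp add: centre_def)
  next
    case 2
    then show ?thesis using c[of "v - 1" w] adm_swap[OF assms(1)] by (simp add: centre_def add.commute)
  next
    case 3
    then show ?thesis using sqrt119 by simp
  qed
qed

end

section \<open>No spectral values inside the gaps\<close>

text \<open>The condition \<open>adm\<close> without the normalisation that puts \<open>0\<close>
  between the ends, and in the original coordinate.\<close>

definition pair_adm :: "real \<Rightarrow> real \<Rightarrow> real \<Rightarrow> bool" where
  "pair_adm t u v \<longleftrightarrow> (\<forall>(r, s)\<in>bottom_rows. \<bar>u - v\<bar> \<le> t * (\<bar>r * u + s\<bar> * \<bar>r * v + s\<bar>))"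

lemma pair_admD: "pair_adm t u v \<Longrightarrow> (r, s) \<in> bottom_rows \<Longrightarrow>
    \<bar>u - v\<bar> \<le> t * (\<bar>r * u + s\<bar> * \<bar>r * v + s\<bar>)"
  by (auto simp: pair_adm_def)

lemma sqrt_scaling: "sqrt 2 * (sqrt 119 / 5) = sqrt 238 / 5" "sqrt 2 * sqrt 5 = sqrt 10"
  "sqrt 2 * gap_end = (2124 * sqrt 2 + 48 * sqrt 238) / 1177"
proof -
  show 1: "sqrt 2 * (sqrt 119 / 5) = sqrt 238 / 5" "sqrt 2 * sqrt 5 = sqrt 10"
    by (simp_all add: real_sqrt_mult[symmetric])
  then show "sqrt 2 * gap_end = (2124 * sqrt 2 + 48 * sqrt 238) / 1177"
    by (simp add: gap_end_def field_simps)
qed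

lemma gap_end_bounds: "sqrt 5 < gap_end" "gap_end < 9/4" "sqrt 119 / 5 < sqrt 5"
proof -
  have "sqrt 5 < 2.24" by (rule real_less_lsqrt) (simp_all add: power2_eq_square)
  then show "sqrt 5 < gap_end" using sqrt119 by (simp add: gap_end_def)
  have "2.23 < sqrt 5" by (rule real_less_rsqrt) (simp_all add: power2_eq_square)
  then show "sqrt 119 / 5 < sqrt 5" using sqrt119 by simp
  have "sqrt 119 < 10.9088" by (rule real_less_lsqrt) (simp_all add: power2_eq_square)
  then show "gap_end < 9/4" by (simp add: gap_end_def)
qed

text \<open>Points more than \<open>sqrt 2\<close> apart have a multiple of \<open>sqrt 2\<close>
  strictly between them, which a translation moves to \<open>0\<close>. Closer points lie below the
  first gap anyway.\<close>

lemma pair_adm_cases: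
  assumes "pair_adm t u v" "t < sqrt 2 * gap_end"
  shows "\<bar>u - v\<bar> \<le> sqrt 238 / 5 \<or> \<bar>u - v\<bar> = sqrt 10"
proof -
  have main: "u - v \<le> sqrt 238 / 5 \<or> u - v = sqrt 10"
    if a: "pair_adm t u v" and uv: "u - v > sqrt 2" for u v
  proof -
    \<comment> \<open>Adding \<open>1\<close> to the floor keeps the multiple strictly above
      \<open>v\<close> even if \<open>v\<close> is itself a multiple of
      \<open>sqrt 2\<close>.\<close>
    define k where "k = \<lfloor>v / sqrt 2\<rfloor> + 1"
    have k: "v < of_int k * sqrt 2" "of_int k * sqrt 2 \<le> v + sqrt 2"
    proof -
      have "v / sqrt 2 < of_int k" "of_int k \<le> v / sqrt 2 + 1" unfolding k_def by linarith+
      then show "v < of_int k * sqrt 2" "of_int k * sqrt 2 \<le> v + sqrt 2"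
        by (simp_all add: field_simps)
    qed
    define w y where "w = (u - of_int k * sqrt 2) / sqrt 2" and "y = (of_int k * sqrt 2 - v) / sqrt 2"
    have wy: "sqrt 2 * w = u - of_int k * sqrt 2" "sqrt 2 * y = of_int k * sqrt 2 - v"
      by (simp_all add: w_def y_def)
    have pos: "w > 0" "y > 0" using k uv by (simp_all add: w_def y_def)
    have "w + y \<le> t / sqrt 2 * (\<bar>sqrt 2 * r * w + s\<bar> * \<bar>s - sqrt 2 * r * y\<bar>)"
      if rs: "(r, s) \<in> bottom_rows" for r s
    proof -
      have e: "r * u + (s + of_int (- k) * (sqrt 2 * r)) = sqrt 2 * r * w + s"
           "r * v + (s + of_int (- k) * (sqrt 2 * r)) = s - sqrt 2 * r * y"
        using arg_cong[OF wy(1), of "\<lambda>x. r * x"] arg_cong[OF wy(2), of "\<lambda>x. r * x"]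
        by (simp_all add: algebra_simps)
      have "u - v > 0" using uv real_sqrt_gt_zero[of 2] by linarith
      then have "sqrt 2 * (w + y) = \<bar>u - v\<bar>" using wy by (simp add: algebra_simps)
      also have "\<dots> \<le> t * (\<bar>sqrt 2 * r * w + s\<bar> * \<bar>s - sqrt 2 * r * y\<bar>)"
        using pair_admD[OF a rows_T_int[OF rs, of "- k"]] unfolding e .
      finally show ?thesis by (simp add: field_simps)
    qed
    then have adm: "adm (t / sqrt 2) w y" using pos by (auto simp: adm_def)
    have t: "t / sqrt 2 < gap_end" using assms(2) by (simp add: field_simps)
    then have "t / sqrt 2 \<le> 9/4" using gap_end_bounds(2) by linarith
    from adm_sum_cases[OF this adm t] have "w + y \<le> sqrt 119 / 5 \<or> w + y = sqrt 5" .
    then have "sqrt 2 * (w + y) \<le> sqrt 2 * (sqrt 119 / 5) \<or> sqrt 2 * (w + y) = sqrt 2 * sqrt 5"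
      by auto
    moreover have "sqrt 2 * (w + y) = u - v" using wy by (simp add: algebra_simps)
    ultimately show ?thesis using sqrt_scaling by metis
  qed
  have sym: "pair_adm t v u"
    using assms(1) by (auto simp: pair_adm_def abs_minus_commute mult.commute)
  have "sqrt 2 \<le> sqrt 238 / 5"
    by (simp add: real_le_rsqrt power2_eq_square flip: sqrt_scaling)
  then show ?thesis using main[OF assms(1)] main[OF sym] by linarith
qed

lemma mobius_mult:
  assumes "det B = 1"
  shows "mobius (A ** B) z = mobius A (mobius B z)"
proof (cases z)
  case (Fin x)
  let ?n = "B$1$1 * x + B$1$2" and ?d = "B$2$1 * x + B$2$2"
  have e: "(A ** B)$i$1 * x + (A ** B)$i$2 = A$i$1 * ?n + A$i$2 * ?d" for i
    by (simp add: mat2_mult_nth algebra_simps)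
  show ?thesis
  proof (cases "?d = 0")
    case True
    have "?n \<noteq> 0"
    proof
      assume "?n = 0"
      have "B$1$1 * ?d - B$2$1 * ?n = det B" by (simp add: det_2 algebra_simps)
      then show False using True \<open>?n = 0\<close> assms by simp
    qed
    then show ?thesis unfolding Fin mobius.simps e using True by simp
  next
    case False
    then have "A$i$1 * (?n / ?d) + A$i$2 = (A$i$1 * ?n + A$i$2 * ?d) / ?d" for i
      by (simp add: field_simps)
    then show ?thesis unfolding Fin mobius.simps e using False by simp
  qed
next
  case Infty
  have "B$1$1 \<noteq> 0" if "B$2$1 = 0" using assms that by (auto simp: det_2)
  moreover have "A$i$1 * (B$1$1 / B$2$1) + A$i$2 = (A$i$1 * B$1$1 + A$i$2 * B$2$1) / B$2$1"
    if "B$2$1 \<noteq> 0" for i using that by (simp add: field_simps)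
  ultimately show ?thesis by (auto simp: Infty mat2_mult_nth)
qed

lemma mobius_diff:
  assumes "det A = 1" "A$2$1 * u + A$2$2 \<noteq> 0" "A$2$1 * v + A$2$2 \<noteq> 0"
  shows "proj_dist (mobius A (Fin u)) (mobius A (Fin v)) =
    ereal (\<bar>u - v\<bar> / (\<bar>A$2$1 * u + A$2$2\<bar> * \<bar>A$2$1 * v + A$2$2\<bar>))"
proof -
  have "(A$1$1 * u + A$1$2) * (A$2$1 * v + A$2$2) - (A$1$1 * v + A$1$2) * (A$2$1 * u + A$2$2) =
      det A * (u - v)"
    by (simp add: det_2 algebra_simps)
  then have "(A$1$1 * u + A$1$2) / (A$2$1 * u + A$2$2) - (A$1$1 * v + A$1$2) / (A$2$1 * v + A$2$2) =
      (u - v) / ((A$2$1 * u + A$2$2) * (A$2$1 * v + A$2$2))"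
    using assms by (simp add: diff_frac_eq)
  then show ?thesis using assms(2,3) by (simp add: abs_mult)
qed

lemma mobius_dist_le:
  assumes "det A = 1" "u \<noteq> v" "proj_dist (mobius A (Fin u)) (mobius A (Fin v)) \<le> ereal m"
  shows "\<bar>u - v\<bar> \<le> m * (\<bar>A$2$1 * u + A$2$2\<bar> * \<bar>A$2$1 * v + A$2$2\<bar>)"
proof -
  let ?p = "\<lambda>x. A$2$1 * x + A$2$2"
  have "\<not> (?p u = 0 \<and> ?p v = 0)"
  proof
    assume z: "?p u = 0 \<and> ?p v = 0"
    then have "A$2$1 * (u - v) = 0" unfolding right_diff_distrib by linarith
    then show False using z assms(1,2) by (simp add: det_2)
  qed
  then have nz: "?p u \<noteq> 0" "?p v \<noteq> 0" using assms(3) by auto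
  then have "\<bar>?p u\<bar> * \<bar>?p v\<bar> > 0" by simp
  then show ?thesis using assms(3) mobius_diff[OF assms(1) nz] by (simp add: pos_divide_le_eq)
qed

lemma det_adj: "det (adj A) = det A" and adj_adj: "adj (adj A) = A"
  by (simp_all add: adj_def det_2 mat2_eq_iff)

lemma markoff_value_eq:
  "markoff_value \<xi> \<eta> = (SUP N\<in>H4_mats. proj_dist (mobius N \<xi>) (mobius N \<eta>))"
proof -
  have "H4_mats = adj ` H4_mats" using H4_mats_adj by (force simp: adj_adj intro: rev_image_eqI)
  moreover have "matrix_inv (adj N) = N" if "N \<in> H4_mats" for N
    using matrix_inv_adj[of "adj N"] that by (simp add: det_adj adj_adj H4_mats_det)
  ultimately show ?thesis unfolding markoff_value_def by (metis (no_types, lifting) SUP_cong image_image)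
qed

text \<open>The supremum need not be attained, so the pair is only moved to a distance above a
  prescribed \<open>l\<close>. There \<open>m\<close> excludes one infinite endpoint and
  \<open>l \<ge> 0\<close> excludes two.\<close>

lemma markoff_pair:
  assumes "m \<in> markoff_spectrum" "0 \<le> l" "l < m"
  obtains u v where "pair_adm m u v" "l < \<bar>u - v\<bar>" "\<bar>u - v\<bar> \<le> m"
proof -
  obtain \<xi> \<eta> where x: "markoff_value \<xi> \<eta> = ereal m" using assms(1) by (auto simp: markoff_spectrum_def)
  have le: "proj_dist (mobius N \<xi>) (mobius N \<eta>) \<le> ereal m" if "N \<in> H4_mats" for N
    unfolding x[symmetric] markoff_value_eq by (rule SUP_upper[OF that])
  have "ereal l < markoff_value \<xi> \<eta>" using x assms(3) by simp
  then obtain N where N: "N \<in> H4_mats" "ereal l < proj_dist (mobius N \<xi>) (mobius N \<eta>)"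
    unfolding markoff_value_eq less_SUP_iff by blast
  obtain u v where uv: "mobius N \<xi> = Fin u" "mobius N \<eta> = Fin v"
    using le[OF N(1)] N(2) assms(2) by (cases "mobius N \<xi>"; cases "mobius N \<eta>") auto
  have d: "l < \<bar>u - v\<bar>" "\<bar>u - v\<bar> \<le> m" using le[OF N(1)] N(2) uv by auto
  have "\<bar>u - v\<bar> \<le> m * (\<bar>r * u + s\<bar> * \<bar>r * v + s\<bar>)" if rs: "(r, s) \<in> bottom_rows" for r s
  proof -
    obtain A where A: "A \<in> H4_mats" "A$2$1 = r" "A$2$2 = s" using rs by (rule rowsE)
    have "proj_dist (mobius A (Fin u)) (mobius A (Fin v)) \<le> ereal m"
      using le[OF H4_mats_mult[OF A(1) N(1)]] mobius_mult[OF H4_mats_det[OF N(1)]] uv by simp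
    from mobius_dist_le[OF H4_mats_det[OF A(1)] _ this] show ?thesis using A d assms(2) by auto
  qed
  then have "pair_adm m u v" by (auto simp: pair_adm_def)
  with that d show thesis by blast
qed

lemma markoff_gap:
  assumes "m \<in> markoff_spectrum" "sqrt 238 / 5 < m" "m < sqrt 2 * gap_end"
  shows "m = sqrt 10"
proof (rule ccontr)
  assume ne: "m \<noteq> sqrt 10"
  \<comment> \<open>The lower end of the gap that contains \<open>m\<close>: no distance in the
    interval from \<open>l\<close> to \<open>m\<close> is compatible with
    \<open>pair_adm_cases\<close>.\<close>
  define l where "l = (if m < sqrt 10 then sqrt 238 / 5 else sqrt 10)"
  have "0 \<le> l" "l < m" using ne assms by (auto simp: l_def)
  from markoff_pair[OF assms(1) this] obtain u v where
    uv: "pair_adm m u v" "l < \<bar>u - v\<bar>" "\<bar>u - v\<bar> \<le> m" .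
  have "sqrt 238 / 5 < sqrt 10"
    unfolding sqrt_scaling(1,2)[symmetric] using gap_end_bounds(3) by simp
  then show False using pair_adm_cases[OF uv(1) assms(3)] uv by (auto simp: l_def split: if_splits)
qed

section \<open>Good approximations and a limit geodesic for the Lagrange value\<close>

lemma good_approximants_iff:
  "q \<in> good_approximants \<xi> L \<longleftrightarrow>
    (\<exists>r s. (r, s) \<in> bottom_rows \<and> r \<noteq> 0 \<and> q = - s / r \<and> \<bar>\<xi> - q\<bar> < 1 / (L * r\<^sup>2))"
proof
  assume "q \<in> good_approximants \<xi> L"
  then obtain a c where ac: "q = a / c" "\<exists>M\<in>H4_mats. a = M$1$1 \<and> c = M$2$1" "c \<noteq> 0"
    "\<bar>\<xi> - a / c\<bar> < 1 / (L * c\<^sup>2)" unfolding good_approximants_def by blast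
  then have "(- c, a) \<in> bottom_rows" using column_iff_row by blast
  then show "\<exists>r s. (r, s) \<in> bottom_rows \<and> r \<noteq> 0 \<and> q = - s / r \<and> \<bar>\<xi> - q\<bar> < 1 / (L * r\<^sup>2)"
    using ac by (intro exI[of _ "- c"] exI[of _ a]) simp
next
  assume "\<exists>r s. (r, s) \<in> bottom_rows \<and> r \<noteq> 0 \<and> q = - s / r \<and> \<bar>\<xi> - q\<bar> < 1 / (L * r\<^sup>2)"
  then obtain r s where rs: "(r, s) \<in> bottom_rows" "r \<noteq> 0" "q = - s / r" "\<bar>\<xi> - q\<bar> < 1 / (L * r\<^sup>2)"
    by blast
  then have "\<exists>M\<in>H4_mats. - s = M$1$1 \<and> r = M$2$1"
    unfolding column_iff_row using rows_uminus by blast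
  then show "q \<in> good_approximants \<xi> L" unfolding good_approximants_def using rs by blast
qed

text \<open>The entries of a row lie in \<open>\<int>\<close> or in \<open>sqrt 2\<close> times
  \<open>\<int>\<close>, and bounds for \<open>r\<close> and the quotient bound \<open>s\<close>.
  Hence infinitely many approximations near \<open>\<xi>\<close> have unbounded
  denominators.\<close>

lemma finite_bounded_cusps:
  "finite {- s / r | r s. (r, s) \<in> bottom_rows \<and> r \<noteq> 0 \<and> \<bar>r\<bar> \<le> K \<and> \<bar>\<xi> - (- s / r)\<bar> \<le> K}" (is "finite ?Q")
proof -
  define N where "N = \<lceil>max K (K * (K + \<bar>\<xi>\<bar>))\<rceil>"
  define F where "F = real_of_int ` {-N..N} \<union> (\<lambda>i. sqrt 2 * real_of_int i) ` {-N..N}"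
  have inF: "x \<in> F" if "\<bar>x\<bar> \<le> max K (K * (K + \<bar>\<xi>\<bar>))" "(\<exists>i. x = of_int i) \<or> (\<exists>i. x = sqrt 2 * of_int i)" for x
  proof -
    have N: "\<bar>x\<bar> \<le> of_int N" using that(1) unfolding N_def by linarith
    from that(2) show ?thesis
    proof
      assume "\<exists>i. x = of_int i"
      then obtain i where i: "x = of_int i" ..
      then have "i \<in> {-N..N}" using N by auto
      then show ?thesis using i by (auto simp: F_def)
    next
      assume "\<exists>i. x = sqrt 2 * of_int i"
      then obtain i where i: "x = sqrt 2 * of_int i" ..
      have "1 * \<bar>real_of_int i\<bar> \<le> sqrt 2 * \<bar>real_of_int i\<bar>" by (intro mult_right_mono) auto
      then have "\<bar>real_of_int i\<bar> \<le> of_int N" using N i by (simp add: abs_mult)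
      then have "i \<in> {-N..N}" by auto
      then show ?thesis using i by (auto simp: F_def)
    qed
  qed
  have "?Q \<subseteq> (\<lambda>(r, s). - s / r) ` (F \<times> F)"
  proof
    fix q assume "q \<in> ?Q"
    then obtain r s where rs: "q = - s / r" "(r, s) \<in> bottom_rows" "r \<noteq> 0" "\<bar>r\<bar> \<le> K" "\<bar>\<xi> - (- s / r)\<bar> \<le> K"
      by blast
    have "\<bar>s\<bar> = \<bar>r\<bar> * \<bar>q\<bar>" using rs by (simp add: abs_mult)
    also have "\<dots> \<le> K * (K + \<bar>\<xi>\<bar>)" using rs by (intro mult_mono) auto
    finally have "\<bar>s\<bar> \<le> K * (K + \<bar>\<xi>\<bar>)" .
    then have "r \<in> F" "s \<in> F" using rs(4) rows_shape[OF rs(2)] by (auto intro!: inF)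
    then show "q \<in> (\<lambda>(r, s). - s / r) ` (F \<times> F)" using rs(1) by (intro image_eqI[of _ _ "(r, s)"]) auto
  qed
  then show ?thesis by (rule finite_subset) (simp add: F_def)
qed

lemma row_nonzero:
  assumes "\<xi> \<notin> (*) (sqrt 2) ` \<rat>" "(r, s) \<in> bottom_rows"
  shows "r * \<xi> + s \<noteq> 0"
proof
  assume e: "r * \<xi> + s = 0"
  have "r \<noteq> 0" using row_zero[of s] assms(2) e by auto
  then have x: "\<xi> = - s / r" using e by (simp add: field_simps)
  from rows_shape[OF assms(2)] consider i j where "r = sqrt 2 * of_int i" "s = of_int j"
    | i j where "r = of_int i" "s = sqrt 2 * of_int j" by blast
  then show False
  proof cases
    case 1
    have "\<xi> = sqrt 2 * (- of_int j / (2 * of_int i))"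
      unfolding x 1 using \<open>r \<noteq> 0\<close> 1 by (simp add: field_simps sqrt2_mult)
    moreover have "- real_of_int j / (2 * real_of_int i) \<in> \<rat>" by simp
    ultimately show False using assms(1) by blast
  next
    case 2
    have "\<xi> = sqrt 2 * (- of_int j / of_int i)" unfolding x 2 by simp
    moreover have "- real_of_int j / real_of_int i \<in> \<rat>" by simp
    ultimately show False using assms(1) by blast
  qed
qed

context
  fixes \<xi> l :: real
  assumes irr: "\<xi> \<notin> (*) (sqrt 2) ` \<rat>" and val: "lagrange_value \<xi> = ereal l" and l: "l > 0"
begin

lemma finite_good: "L > l \<Longrightarrow> finite (good_approximants \<xi> L)"
proof (rule ccontr)
  assume L: "L > l" "infinite (good_approximants \<xi> L)"
  then have "ereal L \<le> lagrange_value \<xi>" unfolding lagrange_value_def using l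
    by (intro Sup_upper) auto
  then show False using val L by simp
qed

lemma infinite_good: "0 < L \<Longrightarrow> L < l \<Longrightarrow> infinite (good_approximants \<xi> L)"
proof -
  assume L: "0 < L" "L < l"
  then have "ereal L < lagrange_value \<xi>" using val by simp
  then obtain L' where L': "L < L'" "infinite (good_approximants \<xi> L')"
    unfolding lagrange_value_def less_Sup_iff by auto
  have "good_approximants \<xi> L' \<subseteq> good_approximants \<xi> L"
  proof
    fix q assume "q \<in> good_approximants \<xi> L'"
    then obtain r s where rs: "(r, s) \<in> bottom_rows" "r \<noteq> 0" "q = - s / r" "\<bar>\<xi> - q\<bar> < 1 / (L' * r\<^sup>2)"
      unfolding good_approximants_iff by blast
    have "1 / (L' * r\<^sup>2) \<le> 1 / (L * r\<^sup>2)" using L L' rs(2) by (intro divide_left_mono) auto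
    then show "q \<in> good_approximants \<xi> L" unfolding good_approximants_iff using rs by force
  qed
  then show ?thesis using L'(2) finite_subset by blast
qed

lemma approximating_row:
  assumes "0 < L" "L < l"
  obtains r s where "(r, s) \<in> bottom_rows" "\<bar>r\<bar> > K" "r \<noteq> 0" "\<bar>r\<bar> * \<bar>r * \<xi> + s\<bar> < 1 / L"
proof -
  \<comment> \<open>Since \<open>r^2 \<ge> 1\<close>, every good approximation lies within
    \<open>1 / L\<close> of \<open>\<xi>\<close>. Outside the finite set, therefore, only the
    denominator can exceed its bound.\<close>
  let ?K = "max K (1 / L)"
  have "infinite (good_approximants \<xi> L - {- s / r | r s. (r, s) \<in> bottom_rows \<and> r \<noteq> 0 \<and>
      \<bar>r\<bar> \<le> ?K \<and> \<bar>\<xi> - (- s / r)\<bar> \<le> ?K})"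
    using infinite_good[OF assms] finite_bounded_cusps by (rule Diff_infinite_finite[rotated])
  then obtain q where q: "q \<in> good_approximants \<xi> L" "q \<notin> {- s / r | r s. (r, s) \<in> bottom_rows \<and> r \<noteq> 0 \<and>
      \<bar>r\<bar> \<le> ?K \<and> \<bar>\<xi> - (- s / r)\<bar> \<le> ?K}"
    by (metis (lifting) Diff_iff all_not_in_conv finite.emptyI)
  then obtain r s where rs: "(r, s) \<in> bottom_rows" "r \<noteq> 0" "q = - s / r" "\<bar>\<xi> - q\<bar> < 1 / (L * r\<^sup>2)"
    unfolding good_approximants_iff by blast
  have "r\<^sup>2 \<ge> 1" using rows_abs_ge_1[OF rs(1,2)] using abs_le_square_iff[of 1 r] by simp
  then have "1 / (L * r\<^sup>2) \<le> 1 / L" using assms rs(2) by (intro divide_left_mono) auto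
  then have "\<bar>\<xi> - q\<bar> \<le> ?K" using rs(4) by linarith
  then have "\<bar>r\<bar> > K" using q(2) rs by force
  moreover have "\<bar>r\<bar> * \<bar>r * \<xi> + s\<bar> = r\<^sup>2 * \<bar>\<xi> - q\<bar>"
  proof -
    have "r * \<xi> + s = r * (\<xi> - q)" using rs by (simp add: field_simps)
    then show ?thesis by (simp add: abs_mult power2_eq_square)
  qed
  moreover have "r\<^sup>2 * \<bar>\<xi> - q\<bar> < 1 / L" using rs(2,4) assms by (simp add: field_simps)
  ultimately show thesis using that rs by simp
qed

text \<open>The pairs \<open>(p \<xi> + q) / (r \<xi> + s)\<close>, \<open>p / r\<close> are the images of \<open>\<xi>\<close>
  and \<open>\<infinity>\<close> under an element of \<open>H4\<close> with bottom row \<open>(r, s)\<close>, translated so that the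
  first one lies in a fundamental interval.\<close>

lemma complete_row:
  assumes "(r, s) \<in> bottom_rows"
  obtains p q where "p * s - q * r = 1" "0 \<le> (p * \<xi> + q) / (r * \<xi> + s)"
    "(p * \<xi> + q) / (r * \<xi> + s) \<le> sqrt 2"
    "\<And>r' s'. (r', s') \<in> bottom_rows \<Longrightarrow> (r' * p + s' * r, r' * q + s' * s) \<in> bottom_rows"
proof -
  obtain A where A: "A \<in> H4_mats" "A$2$1 = r" "A$2$2 = s" "A$1$1 * s - A$1$2 * r = 1"
    using assms by (rule rowsE)
  define x where "x = (A$1$1 * \<xi> + A$1$2) / (r * \<xi> + s)"
  define j where "j = \<lfloor>x / sqrt 2\<rfloor>"
  define p q where "p = A$1$1 - of_int j * sqrt 2 * r" and "q = A$1$2 - of_int j * sqrt 2 * s"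
  have nz: "r * \<xi> + s \<noteq> 0" by (rule row_nonzero[OF irr assms])
  have "p * \<xi> + q = (A$1$1 * \<xi> + A$1$2) - of_int j * sqrt 2 * (r * \<xi> + s)"
    by (simp add: p_def q_def algebra_simps)
  then have e: "(p * \<xi> + q) / (r * \<xi> + s) = x - of_int j * sqrt 2"
    using nz by (simp add: x_def diff_divide_distrib)
  have "of_int j \<le> x / sqrt 2" "x / sqrt 2 \<le> of_int j + 1" unfolding j_def by linarith+
  then have b: "of_int j * sqrt 2 \<le> x" "x \<le> of_int j * sqrt 2 + sqrt 2" by (simp_all add: field_simps)
  show thesis
  proof (rule that[of p q])
    show "p * s - q * r = 1" using A(4) by (simp add: p_def q_def algebra_simps)
    show "0 \<le> (p * \<xi> + q) / (r * \<xi> + s)" "(p * \<xi> + q) / (r * \<xi> + s) \<le> sqrt 2"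
      using b unfolding e by simp_all
    fix r' s' assume "(r', s') \<in> bottom_rows"
    from rows_mult[OF rows_T_int[OF this, of "- j"] A(1)] A(2,3)
    show "(r' * p + s' * r, r' * q + s' * s) \<in> bottom_rows"
      by (simp add: p_def q_def algebra_simps)
  qed
qed

text \<open>The images \<open>x k\<close> of \<open>\<xi>\<close> and \<open>z k\<close> of
  \<open>\<infinity>\<close> eventually stay in a compact set, and their distance exceeds
  \<open>L k\<close>, which tends to \<open>l\<close>. A limit pair inherits every inequality,
  because by \<open>key\<close> a fixed row violates the one with \<open>l + e\<close> only finitely
  often.\<close>

lemma lagrange_limit_pair:
  obtains u v where "\<bar>u - v\<bar> = l" "pair_adm l u v"
proof -
  \<comment> \<open>These constants increase to \<open>l\<close>, and the lower bound
    \<open>l / 2\<close> keeps \<open>1 / L k\<close> bounded.\<close>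
  define L where "L = (\<lambda>k::nat. l - l / (real k + 2))"
  have L: "0 < L k" "L k < l" "l / 2 \<le> L k" for k
  proof -
    have "l / (real k + 2) \<le> l / 2" using l by (intro divide_left_mono) auto
    moreover have "l / (real k + 2) > 0" using l by simp
    ultimately show "0 < L k" "L k < l" "l / 2 \<le> L k" using l unfolding L_def by linarith+
  qed
  have "\<exists>r s. (r, s) \<in> bottom_rows \<and> \<bar>r\<bar> > real k + 1 \<and> r \<noteq> 0 \<and> \<bar>r\<bar> * \<bar>r * \<xi> + s\<bar> < 1 / L k" for k
    using approximating_row[OF L(1,2), of "real k + 1" k] by metis
  then obtain r s where rs: "\<And>k. (r k, s k) \<in> bottom_rows" "\<And>k. \<bar>r k\<bar> > real k + 1" "\<And>k. r k \<noteq> 0"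
    "\<And>k. \<bar>r k\<bar> * \<bar>r k * \<xi> + s k\<bar> < 1 / L k" by metis
  have "\<exists>p q. p * s k - q * r k = 1 \<and> 0 \<le> (p * \<xi> + q) / (r k * \<xi> + s k) \<and>
      (p * \<xi> + q) / (r k * \<xi> + s k) \<le> sqrt 2 \<and>
      (\<forall>r' s'. (r', s') \<in> bottom_rows \<longrightarrow> (r' * p + s' * r k, r' * q + s' * s k) \<in> bottom_rows)" for k
    using complete_row[OF rs(1)] by metis
  then obtain p q where pq: "\<And>k. p k * s k - q k * r k = 1"
    "\<And>k. 0 \<le> (p k * \<xi> + q k) / (r k * \<xi> + s k)" "\<And>k. (p k * \<xi> + q k) / (r k * \<xi> + s k) \<le> sqrt 2"
    "\<And>k r' s'. (r', s') \<in> bottom_rows \<Longrightarrow> (r' * p k + s' * r k, r' * q k + s' * s k) \<in> bottom_rows"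
    by metis
  have nz: "r k * \<xi> + s k \<noteq> 0" for k by (rule row_nonzero[OF irr rs(1)])
  define x z where "x = (\<lambda>k. (p k * \<xi> + q k) / (r k * \<xi> + s k))" and "z = (\<lambda>k. p k / r k)"
  have d: "\<bar>x k - z k\<bar> = 1 / (\<bar>r k\<bar> * \<bar>r k * \<xi> + s k\<bar>)" for k
  proof -
    have "x k - z k = ((p k * \<xi> + q k) * r k - p k * (r k * \<xi> + s k)) / ((r k * \<xi> + s k) * r k)"
      unfolding x_def z_def using nz rs(3) by (subst diff_frac_eq) auto
    also have "(p k * \<xi> + q k) * r k - p k * (r k * \<xi> + s k) = - 1" using pq(1)[of k] by (simp add: algebra_simps)
    finally show ?thesis by (simp add: abs_mult mult.commute)
  qed
  have dL: "\<bar>x k - z k\<bar> > L k" for k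
  proof -
    have "\<bar>r k\<bar> * \<bar>r k * \<xi> + s k\<bar> > 0" using nz rs(3) by simp
    then show ?thesis unfolding d using rs(4)[of k] L(1)[of k] by (simp add: field_simps)
  qed
  have key: "\<forall>\<^sub>F k in sequentially. \<bar>x k - z k\<bar> \<le> (l + e) * (\<bar>r' * x k + s'\<bar> * \<bar>r' * z k + s'\<bar>)"
    if e: "e > 0" and row: "(r', s') \<in> bottom_rows" for e r' s'
  proof -
    let ?F = "good_approximants \<xi> (l + e)"
    have "finite ?F" using finite_good e by simp
    then obtain \<delta> where \<delta>: "\<delta> > 0" "\<And>q. q \<in> ?F \<Longrightarrow> q \<noteq> \<xi> \<Longrightarrow> \<delta> \<le> dist \<xi> q"
      using finite_set_avoid by metis
    \<comment> \<open>A large \<open>\<bar>r k\<bar>\<close> serves twice: beyond the first bound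
      \<open>R\<close> cannot vanish, and beyond the second the cusp \<open>- S / R\<close> would be
      closer to \<open>\<xi>\<close> than any member of \<open>?F\<close>.\<close>
    define K where "K = max \<bar>r'\<bar> ((2 / l + \<bar>r'\<bar>) / \<delta>)"
    have "\<bar>x k - z k\<bar> \<le> (l + e) * (\<bar>r' * x k + s'\<bar> * \<bar>r' * z k + s'\<bar>)" if k: "real k \<ge> K" for k
    proof -
      \<comment> \<open>The row \<open>(r', s')\<close> pulled back along the \<open>k\<close>-th
        group element; a violated inequality would make its zero a good approximation of
        \<open>\<xi>\<close>.\<close>
      define R S where "R = r' * p k + s' * r k" and "S = r' * q k + s' * s k"
      have RS: "(R, S) \<in> bottom_rows" unfolding R_def S_def by (rule pq(4)[OF row])
      have det: "R * s k - S * r k = r'"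
      proof -
        have "R * s k - S * r k = r' * (p k * s k - q k * r k)" by (simp add: R_def S_def algebra_simps)
        then show ?thesis using pq(1) by simp
      qed
      have rk: "\<bar>r k\<bar> > K + 1" "\<bar>r k\<bar> > 1" using rs(2)[of k] k by linarith+
      have "R \<noteq> 0"
      proof
        assume "R = 0"
        then have "\<bar>S\<bar> = 1" "\<bar>S * r k\<bar> = \<bar>r'\<bar>" using row_zero RS det by auto
        then show False using rk by (simp add: abs_mult K_def)
      qed
      have e1: "R * \<xi> + S = (r' * x k + s') * (r k * \<xi> + s k)"
        using nz[of k] by (simp add: R_def S_def x_def field_simps)
      have e2: "R = (r' * z k + s') * r k" using rs(3)[of k] by (simp add: R_def z_def field_simps)
      have e3: "\<bar>R\<bar> * \<bar>R * \<xi> + S\<bar> = (\<bar>r' * x k + s'\<bar> * \<bar>r' * z k + s'\<bar>) * (\<bar>r k\<bar> * \<bar>r k * \<xi> + s k\<bar>)"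
        unfolding e1 by (subst e2) (simp add: abs_mult)
      have "\<bar>R\<bar> * \<bar>R * \<xi> + S\<bar> \<ge> 1 / (l + e)"
      proof (rule ccontr)
        assume "\<not> \<bar>R\<bar> * \<bar>R * \<xi> + S\<bar> \<ge> 1 / (l + e)"
        then have lt: "\<bar>R\<bar> * \<bar>R * \<xi> + S\<bar> < 1 / (l + e)" by simp
        have "\<bar>R\<bar> * \<bar>R * \<xi> + S\<bar> = R\<^sup>2 * \<bar>\<xi> - (- S / R)\<bar>"
        proof -
          have "R * \<xi> + S = R * (\<xi> - (- S / R))" using \<open>R \<noteq> 0\<close> by (simp add: field_simps)
          then show ?thesis by (simp add: abs_mult power2_eq_square)
        qed
        then have "\<bar>\<xi> - (- S / R)\<bar> * R\<^sup>2 < 1 / (l + e)" using lt by (simp only: mult.commute)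
        then have "\<bar>\<xi> - (- S / R)\<bar> < 1 / (l + e) / R\<^sup>2"
          using \<open>R \<noteq> 0\<close> by (simp only: pos_less_divide_eq zero_less_power2 not_False_eq_True)
        then have "\<bar>\<xi> - (- S / R)\<bar> < 1 / ((l + e) * R\<^sup>2)"
          by (simp only: divide_divide_eq_left)
        then have "- S / R \<in> ?F" unfolding good_approximants_iff using RS \<open>R \<noteq> 0\<close> by blast
        moreover have "- S / R \<noteq> \<xi>" using row_nonzero[OF irr RS] \<open>R \<noteq> 0\<close> by (auto simp: field_simps)
        ultimately have "\<delta> \<le> \<bar>\<xi> - (- S / R)\<bar>" using \<delta>(2) by (metis dist_real_def)
        also have "\<dots> \<le> \<bar>\<xi> - (- s k / r k)\<bar> + \<bar>(- s k / r k) - (- S / R)\<bar>" by simp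
        also have "\<bar>(- s k / r k) - (- S / R)\<bar> \<le> \<bar>r'\<bar> / \<bar>r k\<bar>"
        proof -
          have "(- s k / r k) - (- S / R) = - r' / (R * r k)"
            unfolding det[symmetric] using \<open>R \<noteq> 0\<close> rs(3)[of k] by (simp add: field_simps)
          then have "\<bar>(- s k / r k) - (- S / R)\<bar> = \<bar>r'\<bar> / (\<bar>R\<bar> * \<bar>r k\<bar>)" by (simp add: abs_mult)
          also have "\<dots> \<le> \<bar>r'\<bar> / (1 * \<bar>r k\<bar>)"
            using rows_abs_ge_1[OF RS \<open>R \<noteq> 0\<close>] rk by (intro divide_left_mono mult_right_mono) auto
          finally show ?thesis by simp
        qed
        also have "\<bar>\<xi> - (- s k / r k)\<bar> \<le> (2 / l) / \<bar>r k\<bar>"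
        proof -
          have "r k * \<xi> + s k = r k * (\<xi> - (- s k / r k))" using rs(3)[of k] by (simp add: field_simps)
          then have "\<bar>r k * \<xi> + s k\<bar> = \<bar>r k\<bar> * \<bar>\<xi> - (- s k / r k)\<bar>" by (metis abs_mult)
          moreover have "1 * \<bar>r k * \<xi> + s k\<bar> \<le> \<bar>r k\<bar> * \<bar>r k * \<xi> + s k\<bar>"
            using rk by (intro mult_right_mono) auto
          moreover have "1 / L k \<le> 1 / (l / 2)" using L[of k] l by (intro divide_left_mono) auto
          ultimately have "\<bar>r k\<bar> * \<bar>\<xi> - (- s k / r k)\<bar> \<le> 2 / l" using rs(4)[of k] by simp
          then show ?thesis using rk by (simp add: field_simps)
        qed
        finally have "\<delta> \<le> (2 / l + \<bar>r'\<bar>) / \<bar>r k\<bar>" by (simp add: add_divide_distrib)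
        then have "\<delta> * \<bar>r k\<bar> \<le> 2 / l + \<bar>r'\<bar>" using rk by (simp add: field_simps)
        moreover have "(2 / l + \<bar>r'\<bar>) / \<delta> < \<bar>r k\<bar>" using rk(1) unfolding K_def by linarith
        then have "2 / l + \<bar>r'\<bar> < \<delta> * \<bar>r k\<bar>" using \<delta>(1) by (simp add: field_simps)
        ultimately show False by simp
      qed
      then have "1 \<le> (l + e) * (\<bar>R\<bar> * \<bar>R * \<xi> + S\<bar>)" using l e by (simp add: field_simps)
      then have "1 \<le> ((l + e) * (\<bar>r' * x k + s'\<bar> * \<bar>r' * z k + s'\<bar>)) * (\<bar>r k\<bar> * \<bar>r k * \<xi> + s k\<bar>)"
        unfolding e3 by (simp only: mult.assoc)
      moreover have "\<bar>r k\<bar> * \<bar>r k * \<xi> + s k\<bar> > 0" using nz rs(3) by simp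
      ultimately show ?thesis unfolding d by (simp only: pos_divide_le_eq)
    qed
    moreover have "\<forall>\<^sub>F k in sequentially. real k \<ge> K"
      using filterlim_real_sequentially unfolding filterlim_at_top by blast
    ultimately show ?thesis by (rule eventually_mono[rotated])
  qed
  have "\<forall>\<^sub>F k in sequentially. \<bar>x k - z k\<bar> \<le> l + 1" using key[of 1, OF _ rows_0_1] by simp
  then obtain k0 where k0: "\<And>k. k \<ge> k0 \<Longrightarrow> \<bar>x k - z k\<bar> \<le> l + 1"
    unfolding eventually_sequentially by blast
  have xb: "0 \<le> x k" "x k \<le> sqrt 2" for k using pq(2,3) by (simp_all add: x_def)
  have "bounded (range (\<lambda>k. (x (k + k0), z (k + k0))))"
  proof (rule bounded_subset)
    show "bounded ({0..sqrt 2} \<times> {-(l+1)..sqrt 2 + (l+1)})" by (intro bounded_Times) auto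
    have "z (k + k0) \<in> {-(l+1)..sqrt 2 + (l+1)}" for k
      using k0[of "k + k0"] xb[of "k + k0"] by (auto simp: abs_le_iff)
    then show "range (\<lambda>k. (x (k + k0), z (k + k0))) \<subseteq> {0..sqrt 2} \<times> {-(l+1)..sqrt 2 + (l+1)}"
      using xb by auto
  qed
  then obtain w and f :: "nat \<Rightarrow> nat" where f: "strict_mono f" "((\<lambda>k. (x (k + k0), z (k + k0))) \<circ> f) \<longlonglongrightarrow> w"
    using bounded_imp_convergent_subsequence by blast
  define g where "g = (\<lambda>k. f k + k0)"
  have g: "filterlim g at_top sequentially" unfolding g_def
    using filterlim_subseq[OF f(1)] by (rule filterlim_at_top_mono) simp
  obtain u v where w: "w = (u, v)" by (cases w)
  have lim: "(\<lambda>k. x (g k)) \<longlonglongrightarrow> u" "(\<lambda>k. z (g k)) \<longlonglongrightarrow> v"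
    using tendsto_fst[OF f(2)] tendsto_snd[OF f(2)] by (simp_all add: w o_def g_def)
  have lim_le: "\<bar>u - v\<bar> \<le> (l + e) * (\<bar>r' * u + s'\<bar> * \<bar>r' * v + s'\<bar>)"
    if "e > 0" "(r', s') \<in> bottom_rows" for e r' s'
  proof (rule tendsto_le[OF sequentially_bot])
    show "(\<lambda>k. \<bar>x (g k) - z (g k)\<bar>) \<longlonglongrightarrow> \<bar>u - v\<bar>" by (intro tendsto_intros lim)
    show "(\<lambda>k. (l + e) * (\<bar>r' * x (g k) + s'\<bar> * \<bar>r' * z (g k) + s'\<bar>)) \<longlonglongrightarrow>
        (l + e) * (\<bar>r' * u + s'\<bar> * \<bar>r' * v + s'\<bar>)" by (intro tendsto_intros lim)
    show "\<forall>\<^sub>F k in sequentially. \<bar>x (g k) - z (g k)\<bar> \<le> (l + e) * (\<bar>r' * x (g k) + s'\<bar> * \<bar>r' * z (g k) + s'\<bar>)"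
      using key[OF that] g by (rule eventually_compose_filterlim)
  qed
  have lim_e: "\<bar>u - v\<bar> \<le> l * (\<bar>r' * u + s'\<bar> * \<bar>r' * v + s'\<bar>)" if "(r', s') \<in> bottom_rows" for r' s'
  proof -
    have "((\<lambda>e. (l + e) * (\<bar>r' * u + s'\<bar> * \<bar>r' * v + s'\<bar>)) \<longlongrightarrow> (l + 0) * (\<bar>r' * u + s'\<bar> * \<bar>r' * v + s'\<bar>)) (at_right 0)"
      by (intro tendsto_intros)
    moreover have "\<forall>\<^sub>F e in at_right 0. \<bar>u - v\<bar> \<le> (l + e) * (\<bar>r' * u + s'\<bar> * \<bar>r' * v + s'\<bar>)"
      using lim_le[OF _ that] by (auto simp: eventually_at_filter)
    ultimately show ?thesis using tendsto_lowerbound[of _ _ "at_right (0::real)"] by force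
  qed
  then have "pair_adm l u v" by (auto simp: pair_adm_def)
  moreover have "\<bar>u - v\<bar> = l"
  proof (rule antisym)
    show "\<bar>u - v\<bar> \<le> l" using lim_e[OF rows_0_1] by simp
    have "(\<lambda>k. l / (real k + 2)) \<longlonglongrightarrow> 0"
      using LIMSEQ_ignore_initial_segment[OF lim_const_over_n, of l 2] by (simp add: add.commute)
    then have "L \<longlonglongrightarrow> l - 0" unfolding L_def by (intro tendsto_intros)
    from filterlim_compose[OF this g] have "(\<lambda>k. L (g k)) \<longlonglongrightarrow> l" by simp
    moreover have "(\<lambda>k. \<bar>x (g k) - z (g k)\<bar>) \<longlonglongrightarrow> \<bar>u - v\<bar>" by (intro tendsto_intros lim)
    ultimately show "l \<le> \<bar>u - v\<bar>"
      using dL by (intro tendsto_le[OF sequentially_bot]) (auto intro!: always_eventually less_imp_le)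
  qed
  ultimately show thesis using that by blast
qed

end

lemma lagrange_gap:
  assumes "m \<in> lagrange_spectrum" "sqrt 238 / 5 < m" "m < sqrt 2 * gap_end"
  shows "m = sqrt 10"
proof -
  obtain \<xi> where x: "\<xi> \<notin> (*) (sqrt 2) ` \<rat>" "lagrange_value \<xi> = ereal m"
    using assms(1) by (auto simp: lagrange_spectrum_def)
  have "0 \<le> sqrt 238 / (5::real)" by simp
  then have "m > 0" using assms(2) by linarith
  from lagrange_limit_pair[OF x this] obtain u v where "\<bar>u - v\<bar> = m" "pair_adm m u v" .
  then show ?thesis using pair_adm_cases[of m u v] assms by auto
qed

section \<open>From attained values to the spectra\<close>

definition row_val :: "real \<Rightarrow> real \<Rightarrow> real \<Rightarrow> real \<Rightarrow> real" where
  "row_val x y r s = \<bar>sqrt 2 * r * x + s\<bar> * \<bar>s - sqrt 2 * r * y\<bar>"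

text \<open>The signs place the cusp \<open>\<sigma> / \<rho>\<close> on the side of the end
  \<open>sqrt 2 * x\<close>, so that attaining rows with large \<open>\<rho>\<close> yield
  approximations of that end.\<close>

definition attained :: "real \<Rightarrow> real \<Rightarrow> real \<Rightarrow> real \<Rightarrow> real \<Rightarrow> bool" where
  "attained m x y \<rho> \<sigma> \<longleftrightarrow>
     (\<rho>, - \<sigma>) \<in> bottom_rows \<and> 0 \<le> \<rho> \<and> 0 \<le> \<sigma> \<and> x + y = m * row_val x y \<rho> (- \<sigma>)"

context
  fixes m x y :: real
  assumes adm: "adm m x y"
    and att: "\<And>K. \<exists>\<rho> \<sigma>. \<rho> > K \<and> attained m x y \<rho> \<sigma>"
begin

lemma xy_pos: "0 < x" "0 < y" "0 < m"
proof -
  show p: "0 < x" "0 < y" using adm_pos[OF adm] .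
  show "0 < m" using adm_sum[OF adm] p by linarith
qed

text \<open>The rows attaining the value give approximations \<open>\<sigma> / \<rho>\<close> that are too good for a
  rational multiple of \<open>\<surd>2\<close>.\<close>

lemma row_small:
  assumes "attained m x y \<rho> \<sigma>" "\<rho> > 0"
  shows "\<bar>\<rho> * (sqrt 2 * x) - \<sigma>\<bar> \<le> (x + y) / (m * y) / \<rho>" "\<rho> * (sqrt 2 * x) - \<sigma> \<noteq> 0"
proof -
  have e: "x + y = m * (\<bar>\<rho> * (sqrt 2 * x) - \<sigma>\<bar> * (\<sigma> + sqrt 2 * \<rho> * y))"
  proof -
    have "0 \<le> sqrt 2 * \<rho> * y" using assms xy_pos by simp
    then have "\<bar>- \<sigma> - sqrt 2 * \<rho> * y\<bar> = \<sigma> + sqrt 2 * \<rho> * y"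
      using assms(1) by (simp add: attained_def)
    moreover have "\<bar>sqrt 2 * \<rho> * x + - \<sigma>\<bar> = \<bar>\<rho> * (sqrt 2 * x) - \<sigma>\<bar>" by (simp add: mult_ac)
    ultimately show ?thesis using assms(1) unfolding attained_def row_val_def by simp
  qed
  show "\<rho> * (sqrt 2 * x) - \<sigma> \<noteq> 0" using e xy_pos by auto
  have "\<rho> * y \<le> \<sigma> + sqrt 2 * \<rho> * y"
  proof -
    have "1 * (\<rho> * y) \<le> sqrt 2 * (\<rho> * y)" by (rule mult_right_mono) (use assms xy_pos in auto)
    then have "\<rho> * y \<le> sqrt 2 * \<rho> * y" by linarith
    moreover have "\<sigma> \<ge> 0" using assms by (simp add: attained_def)
    ultimately show ?thesis by linarith
  qed
  then have "m * (\<bar>\<rho> * (sqrt 2 * x) - \<sigma>\<bar> * (\<rho> * y)) \<le> x + y"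
    unfolding e using xy_pos by (intro mult_left_mono) auto
  then show "\<bar>\<rho> * (sqrt 2 * x) - \<sigma>\<bar> \<le> (x + y) / (m * y) / \<rho>"
    using xy_pos assms(2) by (simp add: field_simps)
qed

text \<open>For \<open>x = a / b\<close> the number
  \<open>b * (\<rho> * (sqrt 2 * x) - \<sigma>)\<close> is a nonzero integer or
  \<open>sqrt 2\<close> times one, so its modulus is at least \<open>1\<close>, whereas
  \<open>row_small\<close> makes it arbitrarily small.\<close>

lemma irrational_end: "sqrt 2 * x \<notin> (*) (sqrt 2) ` \<rat>"
proof
  assume "sqrt 2 * x \<in> (*) (sqrt 2) ` \<rat>"
  then have "x \<in> \<rat>" by auto
  then obtain a b :: int where ab: "b > 0" "x = of_int a / of_int b" by (rule Rats_cases') auto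
  define D where "D = (x + y) / (m * y)"
  obtain \<rho> \<sigma> where rs: "\<rho> > max 1 (D * of_int b)" "attained m x y \<rho> \<sigma>" using att by blast
  have small: "\<bar>\<rho> * (sqrt 2 * x) - \<sigma>\<bar> \<le> D / \<rho>" and nz: "\<rho> * (sqrt 2 * x) - \<sigma> \<noteq> 0"
    using row_small[OF rs(2)] rs(1) by (auto simp: D_def)
  have "\<bar>of_int b * (\<rho> * (sqrt 2 * x) - \<sigma>)\<bar> \<ge> 1"
  proof -
    have "(\<rho>, - \<sigma>) \<in> bottom_rows" using rs by (simp add: attained_def)
    from rows_shape[OF this] consider i j where "\<rho> = sqrt 2 * of_int i" "\<sigma> = of_int j"
      | i j where "\<rho> = of_int i" "\<sigma> = sqrt 2 * of_int j"
      by (metis minus_equation_iff mult_minus_right of_int_minus)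
    then show ?thesis
    proof cases
      case 1
      have e: "of_int b * (\<rho> * (sqrt 2 * x) - \<sigma>) = of_int (2 * i * a - b * j)"
        unfolding 1 ab(2) using ab(1) by (simp add: field_simps sqrt2_mult)
      have "2 * i * a - b * j \<noteq> 0" using e nz ab(1) by force
      then have "\<bar>2 * i * a - b * j\<bar> \<ge> 1" by linarith
      then show ?thesis unfolding e by linarith
    next
      case 2
      have e: "of_int b * (\<rho> * (sqrt 2 * x) - \<sigma>) = sqrt 2 * of_int (i * a - b * j)"
        unfolding 2 ab(2) using ab(1) by (simp add: field_simps)
      have "i * a - b * j \<noteq> 0" using e nz ab(1) by force
      then have "\<bar>i * a - b * j\<bar> \<ge> 1" by linarith
      then have "1 \<le> real_of_int \<bar>i * a - b * j\<bar>" by (simp only: of_int_1_le_iff)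
      then have "1 * 1 \<le> sqrt 2 * real_of_int \<bar>i * a - b * j\<bar>" by (intro mult_mono) simp_all
      then show ?thesis unfolding e abs_mult by simp
    qed
  qed
  also have "\<bar>of_int b * (\<rho> * (sqrt 2 * x) - \<sigma>)\<bar> \<le> of_int b * (D / \<rho>)"
    unfolding abs_mult using small ab(1) by (intro mult_mono) auto
  also have "\<dots> < 1" using rs(1) by (simp add: field_simps)
  finally show False by simp
qed

lemma adm_real:
  assumes "(r, s) \<in> bottom_rows"
  shows "sqrt 2 * x + sqrt 2 * y \<le> sqrt 2 * m * (\<bar>r * (sqrt 2 * x) + s\<bar> * \<bar>r * (- sqrt 2 * y) + s\<bar>)"
    "r * (sqrt 2 * x) + s \<noteq> 0" "r * (- sqrt 2 * y) + s \<noteq> 0"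
proof -
  have e: "r * (sqrt 2 * x) + s = sqrt 2 * r * x + s" "r * (- sqrt 2 * y) + s = s - sqrt 2 * r * y" by simp_all
  have *: "x + y \<le> m * (\<bar>sqrt 2 * r * x + s\<bar> * \<bar>s - sqrt 2 * r * y\<bar>)" by (rule admD[OF adm assms])
  from mult_left_mono[OF this, of "sqrt 2"]
  show "sqrt 2 * x + sqrt 2 * y \<le> sqrt 2 * m * (\<bar>r * (sqrt 2 * x) + s\<bar> * \<bar>r * (- sqrt 2 * y) + s\<bar>)"
    unfolding e by (simp add: algebra_simps)
  show "r * (sqrt 2 * x) + s \<noteq> 0" "r * (- sqrt 2 * y) + s \<noteq> 0" unfolding e using * xy_pos by auto
qed

lemma value_in_markoff: "sqrt 2 * m \<in> markoff_spectrum"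
proof -
  let ?\<xi> = "Fin (sqrt 2 * x)" and ?\<eta> = "Fin (- sqrt 2 * y)"
  have pd: "proj_dist (mobius N ?\<xi>) (mobius N ?\<eta>) =
      ereal ((sqrt 2 * x + sqrt 2 * y) / (\<bar>N$2$1 * (sqrt 2 * x) + N$2$2\<bar> * \<bar>N$2$1 * (- sqrt 2 * y) + N$2$2\<bar>))"
    if "N \<in> H4_mats" for N
  proof -
    have "\<bar>sqrt 2 * x - (- sqrt 2 * y)\<bar> = sqrt 2 * x + sqrt 2 * y" using xy_pos by simp
    then show ?thesis using mobius_diff[OF H4_mats_det[OF that] adm_real(2,3)[OF rowsI[OF that]]] by metis
  qed
  have "markoff_value ?\<xi> ?\<eta> = ereal (sqrt 2 * m)" unfolding markoff_value_eq
  proof (rule antisym)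
    show "(SUP N\<in>H4_mats. proj_dist (mobius N ?\<xi>) (mobius N ?\<eta>)) \<le> ereal (sqrt 2 * m)"
    proof (rule SUP_least)
      fix N assume N: "N \<in> H4_mats"
      have "0 < \<bar>N$2$1 * (sqrt 2 * x) + N$2$2\<bar> * \<bar>N$2$1 * (- sqrt 2 * y) + N$2$2\<bar>"
        using adm_real(2,3)[OF rowsI[OF N]] by (intro mult_pos_pos) (simp_all only: zero_less_abs_iff not_False_eq_True)
      then show "proj_dist (mobius N ?\<xi>) (mobius N ?\<eta>) \<le> ereal (sqrt 2 * m)"
        unfolding pd[OF N] using adm_real(1)[OF rowsI[OF N]] by (simp only: ereal_less_eq pos_divide_le_eq)
    qed
    obtain \<rho> \<sigma> where rs: "attained m x y \<rho> \<sigma>" using att by blast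
    then have "(\<rho>, - \<sigma>) \<in> bottom_rows" by (simp add: attained_def)
    then obtain N where N: "N \<in> H4_mats" "N$2$1 = \<rho>" "N$2$2 = - \<sigma>" by (rule rowsE)
    have nz: "0 < \<bar>\<rho> * (sqrt 2 * x) + - \<sigma>\<bar> * \<bar>\<rho> * (- sqrt 2 * y) + - \<sigma>\<bar>"
      using adm_real(2,3)[OF \<open>(\<rho>, - \<sigma>) \<in> bottom_rows\<close>]
      by (intro mult_pos_pos) (simp_all only: zero_less_abs_iff not_False_eq_True)
    have e: "\<rho> * (sqrt 2 * x) + - \<sigma> = sqrt 2 * \<rho> * x + - \<sigma>"
        "\<rho> * (- sqrt 2 * y) + - \<sigma> = - \<sigma> - sqrt 2 * \<rho> * y" by simp_all
    have "x + y = m * (\<bar>\<rho> * (sqrt 2 * x) + - \<sigma>\<bar> * \<bar>\<rho> * (- sqrt 2 * y) + - \<sigma>\<bar>)"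
      using rs unfolding e by (simp only: attained_def row_val_def)
    then have "sqrt 2 * x + sqrt 2 * y = sqrt 2 * m * (\<bar>\<rho> * (sqrt 2 * x) + - \<sigma>\<bar> * \<bar>\<rho> * (- sqrt 2 * y) + - \<sigma>\<bar>)"
      by (metis distrib_left mult.assoc)
    then have "proj_dist (mobius N ?\<xi>) (mobius N ?\<eta>) = ereal (sqrt 2 * m)"
      unfolding pd[OF N(1)] N(2,3) using nz by (simp only: nonzero_mult_div_cancel_right)
    then show "ereal (sqrt 2 * m) \<le> (SUP N\<in>H4_mats. proj_dist (mobius N ?\<xi>) (mobius N ?\<eta>))"
      using SUP_upper[OF N(1), of "\<lambda>N. proj_dist (mobius N ?\<xi>) (mobius N ?\<eta>)"] by simp
  qed
  moreover have "?\<xi> \<noteq> ?\<eta>"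
  proof -
    have "sqrt 2 * x > 0" "- sqrt 2 * y < 0" using xy_pos by simp_all
    then show ?thesis by (metis proj_real.inject less_asym)
  qed
  ultimately show ?thesis unfolding markoff_spectrum_def by blast
qed

text \<open>With \<open>q = - s / r\<close> the inequality of a row reads \<open>D \<le> T * r^2 *
  \<bar>\<xi> - q\<bar> * \<bar>\<eta> - q\<bar>\<close>, and the last factor tends to
  \<open>D\<close> as \<open>q\<close> tends to \<open>\<xi>\<close>. So \<open>T\<close> is the
  best constant near \<open>\<xi>\<close>, and the attaining rows reach it asymptotically.\<close>

lemma value_in_lagrange: "sqrt 2 * m \<in> lagrange_spectrum"
proof -
  define \<xi> \<eta> D T where "\<xi> = sqrt 2 * x" and "\<eta> = - sqrt 2 * y" and "D = sqrt 2 * x + sqrt 2 * y"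
    and "T = sqrt 2 * m"
  have pos: "D > 0" "T > 0" "\<eta> < 0" "D = \<xi> - \<eta>"
    using xy_pos by (simp_all add: D_def T_def \<eta>_def \<xi>_def add_pos_pos)
  have fact: "\<bar>r * u + s\<bar> = \<bar>r\<bar> * \<bar>u - (- s / r)\<bar>" if "r \<noteq> 0" for r s u :: real
  proof -
    have "r * u + s = r * (u - (- s / r))" using that by (simp add: field_simps)
    then show ?thesis by (metis abs_mult)
  qed
  have fin: "finite (good_approximants \<xi> L)" if L: "L > T" for L
  proof -
    \<comment> \<open>An approximation with a constant \<open>L > T\<close> must be at least
      \<open>D * (L / T)\<close> away from \<open>\<eta>\<close>, hence \<open>\<delta>\<close> away
      from \<open>\<xi>\<close>; this bounds its denominator.\<close>
    define \<delta> where "\<delta> = D * (L / T) - D"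
    have \<delta>: "\<delta> > 0"
    proof -
      have "1 < L / T" using L pos by simp
      then have "D * 1 < D * (L / T)" using pos by (intro mult_strict_left_mono)
      then show ?thesis by (simp add: \<delta>_def)
    qed
    define K where "K = max (1 / L) (1 + 1 / (L * \<delta>))"
    have "good_approximants \<xi> L \<subseteq> {- s / r | r s. (r, s) \<in> bottom_rows \<and> r \<noteq> 0 \<and> \<bar>r\<bar> \<le> K \<and> \<bar>\<xi> - (- s / r)\<bar> \<le> K}"
    proof
      fix q assume "q \<in> good_approximants \<xi> L"
      then obtain r s where rs: "(r, s) \<in> bottom_rows" "r \<noteq> 0" "q = - s / r" "\<bar>\<xi> - q\<bar> < 1 / (L * r\<^sup>2)"
        unfolding good_approximants_iff by blast
      have r1: "\<bar>r\<bar> \<ge> 1" "r\<^sup>2 \<ge> 1" using rows_abs_ge_1[OF rs(1,2)] abs_le_square_iff[of 1 r] by simp_all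
      have L0: "L > 0" using L pos by simp
      have lt: "L * (r\<^sup>2 * \<bar>\<xi> - q\<bar>) < 1" using rs(2,4) L0 by (simp add: field_simps)
      have "D \<le> T * (\<bar>r * \<xi> + s\<bar> * \<bar>r * \<eta> + s\<bar>)"
        using adm_real(1)[OF rs(1)] by (simp add: D_def T_def \<xi>_def \<eta>_def)
      also have "\<bar>r * \<xi> + s\<bar> * \<bar>r * \<eta> + s\<bar> = (r\<^sup>2 * \<bar>\<xi> - q\<bar>) * \<bar>\<eta> - q\<bar>"
        unfolding fact[OF rs(2)] rs(3) by (simp add: power2_eq_square)
      finally have "L * D \<le> T * ((L * (r\<^sup>2 * \<bar>\<xi> - q\<bar>)) * \<bar>\<eta> - q\<bar>)"
        using L0 mult_left_mono[of D _ L] by (simp add: mult_ac)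
      also have "\<dots> \<le> T * (1 * \<bar>\<eta> - q\<bar>)"
        using lt pos by (intro mult_left_mono mult_right_mono) auto
      finally have "D * (L / T) \<le> \<bar>\<eta> - q\<bar>" using pos(2) by (simp add: pos_divide_le_eq mult.commute)
      then have far: "\<delta> \<le> \<bar>\<xi> - q\<bar>" unfolding \<delta>_def using pos by linarith
      have "L * (r\<^sup>2 * \<delta>) \<le> L * (r\<^sup>2 * \<bar>\<xi> - q\<bar>)" using far L0 by (intro mult_left_mono) auto
      then have "L * (r\<^sup>2 * \<delta>) \<le> 1" using lt by linarith
      then have "r\<^sup>2 \<le> 1 / (L * \<delta>)" using L0 \<delta> by (simp add: field_simps)
      moreover have "\<bar>r\<bar> * 1 \<le> \<bar>r\<bar> * \<bar>r\<bar>" using r1 by (intro mult_left_mono) auto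
      ultimately have "\<bar>r\<bar> \<le> K" by (simp add: K_def power2_eq_square)
      moreover have "\<bar>\<xi> - q\<bar> \<le> K"
      proof -
        have "L * (1 * \<bar>\<xi> - q\<bar>) \<le> L * (r\<^sup>2 * \<bar>\<xi> - q\<bar>)"
          using r1 L0 by (intro mult_left_mono mult_right_mono) auto
        then have "L * \<bar>\<xi> - q\<bar> \<le> 1" using lt by linarith
        then have "\<bar>\<xi> - q\<bar> \<le> 1 / L" using L0 by (simp add: field_simps)
        then show ?thesis by (simp add: K_def)
      qed
      ultimately show "q \<in> {- s / r | r s. (r, s) \<in> bottom_rows \<and> r \<noteq> 0 \<and> \<bar>r\<bar> \<le> K \<and> \<bar>\<xi> - (- s / r)\<bar> \<le> K}"
        using rs by blast
    qed
    then show ?thesis using finite_bounded_cusps by (rule finite_subset)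
  qed
  have inf: "infinite (good_approximants \<xi> L)" if L: "0 < L" "L < T" for L
  proof
    assume "finite (good_approximants \<xi> L)"
    then obtain d where d: "d > 0" "\<And>q. q \<in> good_approximants \<xi> L \<Longrightarrow> q \<noteq> \<xi> \<Longrightarrow> d \<le> dist \<xi> q"
      using finite_set_avoid by metis
    \<comment> \<open>The second bound keeps \<open>\<bar>\<eta> - q\<bar>\<close> above
      \<open>D * (L / T)\<close>, which is what turns equality with \<open>T\<close> into a strict
      inequality with \<open>L\<close>.\<close>
    define d' where "d' = min d (D - D * (L / T))"
    have d': "d' > 0"
    proof -
      have "L / T < 1" using L pos by simp
      then have "D * (L / T) < D * 1" using pos by (intro mult_strict_left_mono)
      then show ?thesis using d by (simp add: d'_def)
    qed
    define E where "E = (x + y) / (m * y)"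
    have E: "E > 0" using xy_pos by (simp add: E_def)
    obtain \<rho> \<sigma> where rs: "\<rho> > max 1 (E / d')" "attained m x y \<rho> \<sigma>" using att by blast
    then have row: "(\<rho>, - \<sigma>) \<in> bottom_rows" and \<rho>: "\<rho> > 1" and \<sigma>: "\<sigma> \<ge> 0" by (auto simp: attained_def)
    define q where "q = - (- \<sigma>) / \<rho>"
    have nz: "\<rho> \<noteq> 0" using \<rho> by simp
    have "\<rho> * \<bar>\<xi> - q\<bar> \<le> E / \<rho>" "\<rho> * \<bar>\<xi> - q\<bar> \<noteq> 0"
      using row_small[OF rs(2)] \<rho> fact[OF nz, of \<xi> "- \<sigma>"] by (auto simp: E_def \<xi>_def q_def)
    then have close: "\<bar>\<xi> - q\<bar> < d'" and ne: "q \<noteq> \<xi>"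
    proof -
      have "1 * \<bar>\<xi> - q\<bar> \<le> \<rho> * \<bar>\<xi> - q\<bar>" using \<rho> by (intro mult_right_mono) auto
      also have "\<dots> \<le> E / \<rho>" by fact
      also have "\<dots> < d'" using rs(1) d' by (simp add: field_simps)
      finally show "\<bar>\<xi> - q\<bar> < d'" by simp
      show "q \<noteq> \<xi>" using \<open>\<rho> * \<bar>\<xi> - q\<bar> \<noteq> 0\<close> by auto
    qed
    have e: "\<rho> * \<xi> + - \<sigma> = sqrt 2 * \<rho> * x + - \<sigma>"
        "\<rho> * \<eta> + - \<sigma> = - \<sigma> - sqrt 2 * \<rho> * y" by (simp_all add: \<xi>_def \<eta>_def)
    have "x + y = m * (\<bar>\<rho> * \<xi> + - \<sigma>\<bar> * \<bar>\<rho> * \<eta> + - \<sigma>\<bar>)"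
      using rs(2) unfolding e by (simp only: attained_def row_val_def)
    then have "D = T * (\<bar>\<rho> * \<xi> + - \<sigma>\<bar> * \<bar>\<rho> * \<eta> + - \<sigma>\<bar>)"
      unfolding D_def T_def by (metis distrib_left mult.assoc)
    also have "\<bar>\<rho> * \<xi> + - \<sigma>\<bar> * \<bar>\<rho> * \<eta> + - \<sigma>\<bar> = (\<rho>\<^sup>2 * \<bar>\<xi> - q\<bar>) * \<bar>\<eta> - q\<bar>"
      unfolding fact[OF nz] q_def using \<rho> by (simp add: power2_eq_square)
    finally have eq: "D = T * ((\<rho>\<^sup>2 * \<bar>\<xi> - q\<bar>) * \<bar>\<eta> - q\<bar>)" .
    have "D * (L / T) < \<bar>\<eta> - q\<bar>" using close pos unfolding d'_def by linarith
    then have "L * D < T * \<bar>\<eta> - q\<bar>" using pos(2) by (simp add: pos_divide_less_eq mult.commute)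
    then have "T * (L * (\<rho>\<^sup>2 * \<bar>\<xi> - q\<bar>) * \<bar>\<eta> - q\<bar>) < T * (1 * \<bar>\<eta> - q\<bar>)" using eq by (simp add: mult_ac)
    then have "L * (\<rho>\<^sup>2 * \<bar>\<xi> - q\<bar>) < 1"
      using pos(2) by (simp only: mult_less_cancel_left_pos) (rule mult_right_less_imp_less, auto)
    then have "\<bar>\<xi> - q\<bar> < 1 / (L * \<rho>\<^sup>2)" using L \<rho> by (simp add: field_simps)
    then have "q \<in> good_approximants \<xi> L" unfolding good_approximants_iff q_def using row nz by blast
    then show False using d(2)[OF _ ne] close by (simp add: dist_real_def d'_def)
  qed
  have "lagrange_value \<xi> = ereal T" unfolding lagrange_value_def
  proof (rule antisym)
    show "Sup {ereal L |L. L > 0 \<and> infinite (good_approximants \<xi> L)} \<le> ereal T"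
      using fin by (intro Sup_least) (force simp: not_less[symmetric])
    show "ereal T \<le> Sup {ereal L |L. L > 0 \<and> infinite (good_approximants \<xi> L)}" (is "_ \<le> ?S")
    proof (rule ccontr)
      assume "\<not> ereal T \<le> ?S"
      then have "?S < ereal T" by (simp only: not_le)
      from ereal_dense2[OF this] obtain L where L: "?S < ereal L" "L < T" by auto
      define L' where "L' = max L (T / 2)"
      have "0 < L'" "L' < T" using L(2) pos(2) by (auto simp: L'_def)
      then have "ereal L' \<le> ?S" using inf by (intro Sup_upper) blast
      moreover have "ereal L \<le> ereal L'" by (simp add: L'_def)
      ultimately show False using L(1) by (meson leD order_trans)
    qed
  qed
  then show ?thesis using irrational_end by (auto simp: lagrange_spectrum_def \<xi>_def T_def)
qed

end

section \<open>Orbits under digit shifts\<close>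

datatype digit = A | B | C

fun app :: "digit \<Rightarrow> real \<Rightarrow> real" where
  "app A z = 1 + z"
| "app B z = dB z"
| "app C z = dC z"

lemma app_pos: "z > 0 \<Longrightarrow> app d z > 0"
  by (cases d) (auto simp: dB_def dC_def)

text \<open>The row times the matrix of the digit in the coordinate \<open>z\<close>.\<close>

fun shift :: "digit \<Rightarrow> real \<times> real \<Rightarrow> real \<times> real" where
  "shift A (r, s) = (r, s + sqrt 2 * r)"
| "shift B (r, s) = (sqrt 2 * r + s, r + sqrt 2 * s)"
| "shift C (r, s) = (r + sqrt 2 * s, s)"

lemma row_val_swap: "row_val y x r (- s) = row_val x y r s"
proof -
  have "\<bar>sqrt 2 * r * y + - s\<bar> = \<bar>s - sqrt 2 * r * y\<bar>" "\<bar>- s - sqrt 2 * r * x\<bar> = \<bar>sqrt 2 * r * x + s\<bar>"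
    by linarith+
  then show ?thesis by (simp add: row_val_def mult.commute)
qed

lemma row_val_uminus: "row_val x y (- r) (- s) = row_val x y r s"
proof -
  have "\<bar>sqrt 2 * (- r) * x + - s\<bar> = \<bar>sqrt 2 * r * x + s\<bar>" "\<bar>- s - sqrt 2 * (- r) * y\<bar> = \<bar>s - sqrt 2 * r * y\<bar>"
    by (simp_all add: abs_minus_commute)
  then show ?thesis by (simp add: row_val_def)
qed

lemma row_val_nonneg: "row_val x y r s \<ge> 0" by (simp add: row_val_def)

text \<open>The sum of the tails and the value of the row acquire the same factor, the ratio of the
  denominators of the digit map at the two ends. So inequalities and equalities both survive a
  shift.\<close>

lemma row_val_shift:
  assumes "x > 0" "y > 0" "shift d (r, s) = (r', s')"
  shows "\<exists>c>0. row_val x (app d y) r' s' = c * row_val (app d x) y r s \<and> x + app d y = c * (app d x + y)"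
proof (cases d)
  case A
  have "sqrt 2 * r' * x + s' = sqrt 2 * r * (1 + x) + s" "s' - sqrt 2 * r' * (1 + y) = s - sqrt 2 * r * y"
    using assms(3) A by (auto simp: algebra_simps)
  then show ?thesis using A by (intro exI[of _ 1]) (simp add: row_val_def)
next
  case B
  have r': "r' = sqrt 2 * r + s" "s' = r + sqrt 2 * s" using assms(3) B by auto
  define c where "c = (x + 1) / (y + 1)"
  have "sqrt 2 * r' * x + s' = sqrt 2 * (x + 1) * (sqrt 2 * r * dB x + s)"
    using assms(1) by (simp add: r' dB_def field_simps sqrt2_mult)
  moreover have "s - sqrt 2 * r * y = sqrt 2 * (y + 1) * (s' - sqrt 2 * r' * dB y)"
    using assms(2) by (simp add: r' dB_def field_simps sqrt2_mult)
  then have "s' - sqrt 2 * r' * dB y = (s - sqrt 2 * r * y) / (sqrt 2 * (y + 1))"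
    using assms(2) by simp
  ultimately have "row_val x (dB y) r' s' = c * row_val (dB x) y r s"
    using assms(1,2) by (simp add: row_val_def abs_mult c_def)
  moreover have "x + dB y = c * (dB x + y)"
    using assms(1,2) by (simp add: c_def dB_def divide_simps) (simp add: algebra_simps)
  moreover have "c > 0" using assms(1,2) by (simp add: c_def)
  ultimately show ?thesis using B by auto
next
  case C
  have r': "r' = r + sqrt 2 * s" "s' = s" using assms(3) C by auto
  define c where "c = (1 + 2*x) / (1 + 2*y)"
  have "sqrt 2 * r' * x + s' = (1 + 2*x) * (sqrt 2 * r * dC x + s)"
    using assms(1) by (simp add: r' dC_def field_simps sqrt2_mult)
  moreover have "s' - sqrt 2 * r' * dC y = (s - sqrt 2 * r * y) / (1 + 2*y)"
    using assms(2) by (simp add: r' dC_def field_simps sqrt2_mult)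
  ultimately have "row_val x (dC y) r' s' = c * row_val (dC x) y r s"
    using assms(1,2) by (simp add: row_val_def abs_mult c_def)
  moreover have "x + dC y = c * (dC x + y)"
    using assms(1,2) by (simp add: c_def dC_def divide_simps) (simp add: algebra_simps)
  moreover have "c > 0" using assms(1,2) by (simp add: c_def)
  ultimately show ?thesis using C by auto
qed

text \<open>The congruences of bottom rows as a condition in its own right: it is stable under
  shifts and sign changes, and it makes \<open>r^2 + s^2\<close> a natural number, on which the
  descent runs.\<close>

definition int_row :: "real \<Rightarrow> real \<Rightarrow> bool" where
  "int_row r s \<longleftrightarrow> (\<exists>i j. r = sqrt 2 * of_int i \<and> s = of_int j \<and> odd j) \<or>
     (\<exists>i j. r = of_int i \<and> s = sqrt 2 * of_int j \<and> odd i)"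

lemma int_rowI1: "odd j \<Longrightarrow> r = sqrt 2 * of_int i \<Longrightarrow> s = of_int j \<Longrightarrow> int_row r s"
  and int_rowI2: "odd i \<Longrightarrow> r = of_int i \<Longrightarrow> s = sqrt 2 * of_int j \<Longrightarrow> int_row r s"
  unfolding int_row_def by blast+

lemma int_rowE:
  assumes "int_row r s"
  obtains i j where "r = sqrt 2 * of_int i" "s = of_int j" "odd j"
    | i j where "r = of_int i" "s = sqrt 2 * of_int j" "odd i"
  using assms unfolding int_row_def by blast

lemma int_row_uminus: "int_row r s \<Longrightarrow> int_row (- r) s" "int_row r s \<Longrightarrow> int_row r (- s)"
  by (erule int_rowE; rule int_rowI1[of _ _ "- i" for i] int_rowI2[of "- i" _ _ for i]; simp)
     (erule int_rowE; rule int_rowI1[of "- i" for i] int_rowI2[of _ _ _ "- i" for i]; simp)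

lemma int_row_shift: assumes "int_row r s" shows "int_row (fst (shift d (r, s))) (snd (shift d (r, s)))"
  using assms
proof (cases rule: int_rowE)
  case (1 i j)
  show ?thesis
  proof (cases d)
    case A then show ?thesis using 1 by (intro int_rowI1[of "j + 2*i" _ i]) (auto simp: sqrt2_mult)
  next
    case B then show ?thesis using 1
      by (intro int_rowI2[of "2*i + j" _ _ "i + j"]) (auto simp: sqrt2_mult algebra_simps)
  next
    case C then show ?thesis using 1 by (intro int_rowI1[of "j" _ "i + j"]) (auto simp: algebra_simps)
  qed
next
  case (2 i j)
  show ?thesis
  proof (cases d)
    case A then show ?thesis using 2 by (intro int_rowI2[of "i" _ _ "i + j"]) (auto simp: algebra_simps)
  next
    case B then show ?thesis using 2
      by (intro int_rowI1[of "i + 2*j" _ "i + j"]) (auto simp: sqrt2_mult algebra_simps)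
  next
    case C then show ?thesis using 2 by (intro int_rowI2[of "i + 2*j" _ _ "j"]) (auto simp: sqrt2_mult)
  qed
qed

lemma int_row_norm: assumes "int_row r s" obtains n :: nat where "r\<^sup>2 + s\<^sup>2 = real n"
  using assms
proof (cases rule: int_rowE)
  case (1 i j)
  have "r\<^sup>2 + s\<^sup>2 = of_int (2 * i\<^sup>2 + j\<^sup>2)" using 1 by (simp add: power_mult_distrib)
  also have "\<dots> = real (nat (2 * i\<^sup>2 + j\<^sup>2))" by simp
  finally show thesis by (rule that)
next
  case (2 i j)
  have "r\<^sup>2 + s\<^sup>2 = of_int (i\<^sup>2 + 2 * j\<^sup>2)" using 2 by (simp add: power_mult_distrib)
  also have "\<dots> = real (nat (i\<^sup>2 + 2 * j\<^sup>2))" by simp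
  finally show thesis by (rule that)
qed

lemma int_row_ge_1:
  assumes "int_row r s" shows "r \<noteq> 0 \<Longrightarrow> r\<^sup>2 \<ge> 1" "s \<noteq> 0 \<Longrightarrow> s\<^sup>2 \<ge> 1"
proof -
  have *: "(of_int i)\<^sup>2 \<ge> (1::real)" if "i \<noteq> 0" for i
  proof -
    have "i\<^sup>2 > 0" using that by simp
    then have "1 \<le> i\<^sup>2" by linarith
    then show ?thesis by (metis of_int_1_le_iff of_int_power)
  qed
  show "r \<noteq> 0 \<Longrightarrow> r\<^sup>2 \<ge> 1" using assms
    by (cases rule: int_rowE) (use * in \<open>force simp: power_mult_distrib\<close>)+
  show "s \<noteq> 0 \<Longrightarrow> s\<^sup>2 \<ge> 1" using assms
    by (cases rule: int_rowE) (use * in \<open>force simp: power_mult_distrib\<close>)+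
qed

lemma pos_int_ge_1: "real_of_int n > 0 \<Longrightarrow> real_of_int n \<ge> 1"
  by simp

text \<open>Integrality of the distance between a cusp and the endpoints of an edge of the
  tessellation.\<close>

lemma int_row_gaps:
  assumes "int_row r (- \<sigma>)" "r > 0" "\<sigma> > 0"
  shows "sqrt 2 * r - \<sigma> > 0 \<Longrightarrow> \<sigma> * (sqrt 2 * r - \<sigma>) \<ge> 1"
    "sqrt 2 * \<sigma> - r > 0 \<Longrightarrow> r * (sqrt 2 * \<sigma> - r) \<ge> 1"
    "\<sigma> - sqrt 2 * r > 0 \<Longrightarrow> sqrt 2 * r * (\<sigma> - sqrt 2 * r) \<ge> 2"
    "r - sqrt 2 * \<sigma> > 0 \<Longrightarrow> sqrt 2 * \<sigma> * (r - sqrt 2 * \<sigma>) \<ge> 2"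
proof -
  obtain i j where "r = sqrt 2 * of_int i \<and> \<sigma> = of_int j \<or> r = of_int i \<and> \<sigma> = sqrt 2 * of_int j"
    using assms(1) by (cases rule: int_rowE) (metis minus_equation_iff of_int_minus mult_minus_right)+
  then consider (1) "r = sqrt 2 * of_int i" "\<sigma> = of_int j" | (2) "r = of_int i" "\<sigma> = sqrt 2 * of_int j"
    by blast
  then have "(sqrt 2 * r - \<sigma> > 0 \<longrightarrow> \<sigma> * (sqrt 2 * r - \<sigma>) \<ge> 1) \<and>
    (sqrt 2 * \<sigma> - r > 0 \<longrightarrow> r * (sqrt 2 * \<sigma> - r) \<ge> 1) \<and>
    (\<sigma> - sqrt 2 * r > 0 \<longrightarrow> sqrt 2 * r * (\<sigma> - sqrt 2 * r) \<ge> 2) \<and>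
    (r - sqrt 2 * \<sigma> > 0 \<longrightarrow> sqrt 2 * \<sigma> * (r - sqrt 2 * \<sigma>) \<ge> 2)"
  proof cases
    case 1
    have e: "\<sigma> * (sqrt 2 * r - \<sigma>) = of_int (j * (2 * i - j))"
      "r * (sqrt 2 * \<sigma> - r) = 2 * of_int (i * (j - i))"
      "sqrt 2 * r * (\<sigma> - sqrt 2 * r) = 2 * of_int (i * (j - 2 * i))"
      "sqrt 2 * \<sigma> * (r - sqrt 2 * \<sigma>) = 2 * of_int (j * (i - j))"
      using 1 by (simp_all add: algebra_simps sqrt2_mult)
    show ?thesis
    proof (intro conjI impI)
      assume "sqrt 2 * r - \<sigma> > 0"
      then have "\<sigma> * (sqrt 2 * r - \<sigma>) > 0" using assms(3) by simp
      then show "\<sigma> * (sqrt 2 * r - \<sigma>) \<ge> 1" unfolding e by (rule pos_int_ge_1)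
    next
      assume "sqrt 2 * \<sigma> - r > 0"
      then have "r * (sqrt 2 * \<sigma> - r) > 0" using assms(2) by simp
      then have "real_of_int (i * (j - i)) > 0" unfolding e by linarith
      then show "r * (sqrt 2 * \<sigma> - r) \<ge> 1" unfolding e using pos_int_ge_1 by fastforce
    next
      assume "\<sigma> - sqrt 2 * r > 0"
      then have "sqrt 2 * r * (\<sigma> - sqrt 2 * r) > 0" using assms(2) by simp
      then have "real_of_int (i * (j - 2 * i)) > 0" unfolding e by linarith
      then show "sqrt 2 * r * (\<sigma> - sqrt 2 * r) \<ge> 2" unfolding e using pos_int_ge_1 by fastforce
    next
      assume "r - sqrt 2 * \<sigma> > 0"
      then have "sqrt 2 * \<sigma> * (r - sqrt 2 * \<sigma>) > 0" using assms(3) by simp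
      then have "real_of_int (j * (i - j)) > 0" unfolding e by linarith
      then show "sqrt 2 * \<sigma> * (r - sqrt 2 * \<sigma>) \<ge> 2" unfolding e using pos_int_ge_1 by fastforce
    qed
  next
    case 2
    have e: "\<sigma> * (sqrt 2 * r - \<sigma>) = 2 * of_int (j * (i - j))"
      "r * (sqrt 2 * \<sigma> - r) = of_int (i * (2 * j - i))"
      "sqrt 2 * r * (\<sigma> - sqrt 2 * r) = 2 * of_int (i * (j - i))"
      "sqrt 2 * \<sigma> * (r - sqrt 2 * \<sigma>) = 2 * of_int (j * (i - 2 * j))"
      using 2 by (simp_all add: algebra_simps sqrt2_mult)
    show ?thesis
    proof (intro conjI impI)
      assume "sqrt 2 * r - \<sigma> > 0"
      then have "\<sigma> * (sqrt 2 * r - \<sigma>) > 0" using assms(3) by simp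
      then have "real_of_int (j * (i - j)) > 0" unfolding e by linarith
      then show "\<sigma> * (sqrt 2 * r - \<sigma>) \<ge> 1" unfolding e using pos_int_ge_1 by fastforce
    next
      assume "sqrt 2 * \<sigma> - r > 0"
      then have "r * (sqrt 2 * \<sigma> - r) > 0" using assms(2) by simp
      then show "r * (sqrt 2 * \<sigma> - r) \<ge> 1" unfolding e by (rule pos_int_ge_1)
    next
      assume "\<sigma> - sqrt 2 * r > 0"
      then have "sqrt 2 * r * (\<sigma> - sqrt 2 * r) > 0" using assms(2) by simp
      then have "real_of_int (i * (j - i)) > 0" unfolding e by linarith
      then show "sqrt 2 * r * (\<sigma> - sqrt 2 * r) \<ge> 2" unfolding e using pos_int_ge_1 by fastforce
    next
      assume "r - sqrt 2 * \<sigma> > 0"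
      then have "sqrt 2 * \<sigma> * (r - sqrt 2 * \<sigma>) > 0" using assms(3) by simp
      then have "real_of_int (j * (i - 2 * j)) > 0" unfolding e by linarith
      then show "sqrt 2 * \<sigma> * (r - sqrt 2 * \<sigma>) \<ge> 2" unfolding e using pos_int_ge_1 by fastforce
    qed
  qed
  then show "sqrt 2 * r - \<sigma> > 0 \<Longrightarrow> \<sigma> * (sqrt 2 * r - \<sigma>) \<ge> 1"
    "sqrt 2 * \<sigma> - r > 0 \<Longrightarrow> r * (sqrt 2 * \<sigma> - r) \<ge> 1"
    "\<sigma> - sqrt 2 * r > 0 \<Longrightarrow> sqrt 2 * r * (\<sigma> - sqrt 2 * r) \<ge> 2"
    "r - sqrt 2 * \<sigma> > 0 \<Longrightarrow> sqrt 2 * \<sigma> * (r - sqrt 2 * \<sigma>) \<ge> 2" by blast+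
qed

text \<open>A cusp either lies in the same digit interval as \<open>x\<close>, and then a shift makes its row
  shorter, or it is separated from \<open>x\<close> by an edge of the tessellation, and then its value is small.\<close>

lemma row_step:
  assumes "x > 0" "y > 0" "int_row r (- \<sigma>)" "r > 0" "\<sigma> > 0"
  shows "app d x + y \<le> row_val (app d x) y r (- \<sigma>) \<or>
    (fst (shift d (r, - \<sigma>)))\<^sup>2 + (snd (shift d (r, - \<sigma>)))\<^sup>2 < r\<^sup>2 + \<sigma>\<^sup>2"
proof -
  note g = int_row_gaps[OF assms(3-5)]
  have rv: "row_val X y r (- \<sigma>) = \<bar>sqrt 2 * r * X - \<sigma>\<bar> * (\<sigma> + sqrt 2 * r * y)" for X
  proof -
    have "0 \<le> sqrt 2 * r * y" using assms by simp
    then have "\<bar>- \<sigma> - sqrt 2 * r * y\<bar> = \<sigma> + sqrt 2 * r * y" using assms(5) by linarith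
    then show ?thesis by (simp add: row_val_def)
  qed
  show ?thesis
  proof (cases d)
    case A
    show ?thesis
    proof (cases "sqrt 2 * r \<le> \<sigma>")
      case True
      have "(sqrt 2 * r - \<sigma>)\<^sup>2 < \<sigma>\<^sup>2"
        using True assms by (intro power2_strict_mono) (auto simp: abs_if)
      then show ?thesis using A by (simp add: power2_commute)
    next
      case False
      define P where "P = sqrt 2 * r - \<sigma>"
      have P: "P > 0" "\<sigma> * P \<ge> 1" "sqrt 2 * r = P + \<sigma>" using g(1) False by (auto simp: P_def)
      have "row_val (1 + x) y r (- \<sigma>) = ((P + \<sigma>) * x + P) * (\<sigma> + (P + \<sigma>) * y)"
      proof -
        have "sqrt 2 * r * (1 + x) - \<sigma> = (P + \<sigma>) * x + P" unfolding P(3) by (simp add: algebra_simps)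
        moreover have "(P + \<sigma>) * x + P > 0" using P assms by (simp add: add_pos_pos)
        ultimately show ?thesis unfolding rv P(3) by simp
      qed
      \<comment> \<open>The three products with \<open>\<sigma> * P \<ge> 1\<close> already give
        \<open>1 + x + y\<close>; the remaining terms are nonnegative.\<close>
      also have "\<dots> = \<sigma> * P + \<sigma> * P * x + \<sigma> * P * y + (\<sigma>\<^sup>2 * x + P\<^sup>2 * y + (P + \<sigma>) * x * (P + \<sigma>) * y)"
        by (simp add: algebra_simps power2_eq_square)
      also have "\<dots> \<ge> 1 + 1 * x + 1 * y + 0"
        using P assms by (intro add_mono mult_right_mono add_nonneg_nonneg mult_nonneg_nonneg) auto
      finally show ?thesis using A by simp
    qed
  next
    case C
    show ?thesis
    proof (cases "sqrt 2 * \<sigma> \<le> r")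
      case True
      have "(r - sqrt 2 * \<sigma>)\<^sup>2 < r\<^sup>2"
        using True assms by (intro power2_strict_mono) (auto simp: abs_if)
      then show ?thesis using C by simp
    next
      case False
      define Q where "Q = sqrt 2 * \<sigma> - r"
      have Q: "Q > 0" "r * Q \<ge> 1" "sqrt 2 * \<sigma> = Q + r" using g(2) False by (auto simp: Q_def)
      define z where "z = 1 - 2 * dC x"
      have z: "0 < z" "z < 1" "dC x = (1 - z) / 2" using dC_bounds[OF assms(1)] by (auto simp: z_def)
      have "2 * row_val (dC x) y r (- \<sigma>) = (Q + r * z) * (Q + r + 2 * (r * y))"
      proof -
        have e: "sqrt 2 * (\<sigma> - sqrt 2 * r * dC x) = Q + r * z" "sqrt 2 * (\<sigma> + sqrt 2 * r * y) = Q + r + 2 * (r * y)"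
        proof -
          have "sqrt 2 * (sqrt 2 * r * dC x) = 2 * (r * dC x)" by (simp only: mult.assoc sqrt2_mult)
          also have "\<dots> = r * (1 - z)" by (simp add: z(3))
          finally have "sqrt 2 * (\<sigma> - sqrt 2 * r * dC x) = Q + r - r * (1 - z)"
            using Q(3) by (simp only: right_diff_distrib)
          then show "sqrt 2 * (\<sigma> - sqrt 2 * r * dC x) = Q + r * z" by (simp add: algebra_simps)
          show "sqrt 2 * (\<sigma> + sqrt 2 * r * y) = Q + r + 2 * (r * y)"
            using Q(3) by (simp add: distrib_left mult.assoc sqrt2_mult)
        qed
        have "Q + r * z > 0" using Q z assms by (simp add: add_pos_pos)
        then have "\<sigma> - sqrt 2 * r * dC x > 0" unfolding e(1)[symmetric] by (simp add: zero_less_mult_iff)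
        then have "row_val (dC x) y r (- \<sigma>) = (\<sigma> - sqrt 2 * r * dC x) * (\<sigma> + sqrt 2 * r * y)"
          unfolding rv by simp
        then show ?thesis unfolding e[symmetric] by (simp add: sqrt2_mult)
      qed
      also have "\<dots> = r * Q * (1 + z + 2 * y) + (Q\<^sup>2 + r\<^sup>2 * z + 2 * (r\<^sup>2 * z * y))"
        by (simp add: algebra_simps power2_eq_square)
      also have "\<dots> \<ge> 1 * (1 + z + 2 * y) + 0"
        using Q z assms by (intro add_mono mult_right_mono add_nonneg_nonneg mult_nonneg_nonneg) auto
      finally have "1 + z + 2 * y \<le> 2 * row_val (dC x) y r (- \<sigma>)" by simp
      moreover have "2 * dC x = 1 - z" by (simp add: z_def)
      ultimately have "dC x + y \<le> row_val (dC x) y r (- \<sigma>)" using z(1) by argo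
      then show ?thesis using C by simp
    qed
  next
    case B
    note b = dB_bounds[OF assms(1)]
    consider (1) "sqrt 2 * r < \<sigma>" | (2) "sqrt 2 * \<sigma> < r" | (3) "\<sigma> \<le> sqrt 2 * r" "r \<le> sqrt 2 * \<sigma>" by linarith
    then show ?thesis
    proof cases
      case 1
      define Q where "Q = \<sigma> - sqrt 2 * r"
      have Q: "Q > 0" "sqrt 2 * r * Q \<ge> 2" "\<sigma> = Q + sqrt 2 * r" using g(3) 1 by (auto simp: Q_def)
      have "0 < sqrt 2 * r * (1 - dB x)" using b assms by simp
      moreover have "sqrt 2 * r * dB x - \<sigma> = - (Q + sqrt 2 * r * (1 - dB x))"
        "\<sigma> + sqrt 2 * r * y = Q + sqrt 2 * r * (1 + y)"
        unfolding Q(3) by (simp_all add: algebra_simps)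
      ultimately have "row_val (dB x) y r (- \<sigma>) = (Q + sqrt 2 * r * (1 - dB x)) * (Q + sqrt 2 * r * (1 + y))"
        unfolding rv using Q(1) by simp
      also have "\<dots> = (sqrt 2 * r * Q) * (1 + y) + (Q * Q + sqrt 2 * r * (1 - dB x) * (Q + sqrt 2 * r * (1 + y)))"
        by (simp add: algebra_simps)
      also have "\<dots> \<ge> 2 * (1 + y) + 0"
        using Q b assms by (intro add_mono mult_right_mono add_nonneg_nonneg mult_nonneg_nonneg) auto
      finally show ?thesis using B b assms by simp
    next
      case 2
      define P where "P = r - sqrt 2 * \<sigma>"
      have P: "P > 0" "sqrt 2 * \<sigma> * P \<ge> 2" "r = P + sqrt 2 * \<sigma>" using g(4) 2 by (auto simp: P_def)
      define z where "z = 2 * dB x - 1"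
      have z: "0 < z" "z < 1" "dB x = (1 + z) / 2" using b by (auto simp: z_def)
      have s1: "\<sigma> * \<sigma> \<ge> 1" using int_row_ge_1(2)[OF assms(3)] assms(5) by (simp add: power2_eq_square)
      have "2 * row_val (dB x) y r (- \<sigma>) = (P + r * z) * (sqrt 2 * \<sigma> + 2 * (r * y))"
      proof -
        have e: "sqrt 2 * (sqrt 2 * r * dB x - \<sigma>) = P + r * z" "sqrt 2 * (\<sigma> + sqrt 2 * r * y) = sqrt 2 * \<sigma> + 2 * (r * y)"
          unfolding z(3) by (simp_all add: P_def algebra_simps sqrt2_mult)
        have "P + r * z > 0" using P z assms by (simp add: add_pos_pos)
        then have "sqrt 2 * r * dB x - \<sigma> > 0" unfolding e(1)[symmetric] by (simp add: zero_less_mult_iff)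
        then have "row_val (dB x) y r (- \<sigma>) = (sqrt 2 * r * dB x - \<sigma>) * (\<sigma> + sqrt 2 * r * y)"
          unfolding rv by simp
        then show ?thesis unfolding e[symmetric] by (simp add: sqrt2_mult)
      qed
      also have "\<dots> = sqrt 2 * \<sigma> * P * (1 + z + 2 * y) + 2 * (\<sigma> * \<sigma>) * z + (2 * (P * P * y) + 2 * (r * z * r * y))"
        by (simp add: P(3) algebra_simps sqrt2_mult)
      also have "\<dots> \<ge> 2 * (1 + z + 2 * y) + 0 + 0"
        using P z assms by (intro add_mono mult_right_mono add_nonneg_nonneg mult_nonneg_nonneg) auto
      finally have "2 * (1 + z + 2 * y) \<le> 2 * row_val (dB x) y r (- \<sigma>)" by simp
      moreover have "2 * dB x = 1 + z" by (simp add: z_def)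
      ultimately have "dB x + y \<le> row_val (dB x) y r (- \<sigma>)" using z(1) assms(2) by argo
      then show ?thesis using B by simp
    next
      case 3
      \<comment> \<open>The cusp lies between \<open>1 / sqrt 2\<close> and \<open>sqrt 2\<close>.
        This yields \<open>2 * (r^2 + \<sigma>^2) \<le> 3 * sqrt 2 * r * \<sigma>\<close>, while the
        norm already drops with \<open>4\<close> in place of \<open>3\<close>.\<close>
      have "0 \<le> (sqrt 2 * r - \<sigma>) * (sqrt 2 * \<sigma> - r)" using 3 by (intro mult_nonneg_nonneg) auto
      also have "\<dots> = 3 * (r * \<sigma>) - sqrt 2 * (r\<^sup>2 + \<sigma>\<^sup>2)"
        by (simp add: algebra_simps power2_eq_square sqrt2_mult)
      finally have "sqrt 2 * (sqrt 2 * (r\<^sup>2 + \<sigma>\<^sup>2)) \<le> sqrt 2 * (3 * (r * \<sigma>))" by simp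
      then have "2 * (r\<^sup>2 + \<sigma>\<^sup>2) \<le> sqrt 2 * (3 * (r * \<sigma>))" by (simp only: sqrt2_mult)
      moreover have "sqrt 2 * (r * \<sigma>) > 0" using assms by simp
      ultimately have "2 * (r\<^sup>2 + \<sigma>\<^sup>2) < 4 * (sqrt 2 * (r * \<sigma>))" by linarith
      moreover have "(sqrt 2 * r - \<sigma>)\<^sup>2 + (r - sqrt 2 * \<sigma>)\<^sup>2 = 3 * (r\<^sup>2 + \<sigma>\<^sup>2) - 4 * (sqrt 2 * (r * \<sigma>))"
        by (simp add: algebra_simps power2_eq_square sqrt2_mult)
      ultimately show ?thesis using B by simp
    qed
  qed
qed

text \<open>Bounds at the cusps \<open>\<infinity>\<close> and \<open>0\<close>, imposed at all
  states of a shift-invariant set, imply those for all rows. The row of a positive cusp is shortened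
  by forward shifts and that of a negative one by backward shifts, until \<open>row_step\<close>
  bounds it or the cusp is \<open>0\<close> or \<open>\<infinity>\<close>.\<close>

lemma adm_of_orbit:
  assumes pos: "\<And>x y. (x, y) \<in> S \<Longrightarrow> x > 0 \<and> y > 0 \<and> x + y \<le> m \<and> 1/(2*x) + 1/(2*y) \<le> m"
    and fwd: "\<And>x y. (x, y) \<in> S \<Longrightarrow> \<exists>d x'. x = app d x' \<and> (x', app d y) \<in> S"
    and bwd: "\<And>x y. (x, y) \<in> S \<Longrightarrow> \<exists>d y'. y = app d y' \<and> (app d x, y') \<in> S"
    and xy: "(x, y) \<in> S"
  shows "adm m x y"
proof -
  \<comment> \<open>For a separated cusp \<open>row_step\<close> gives the bound without the factor
    \<open>m\<close>; \<open>m \<ge> 1\<close> restores it.\<close>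
  have m1: "m \<ge> 1"
  proof -
    have "z + 1 / (2*z) \<ge> 1" if "z > 0" for z :: real
    proof -
      have "0 \<le> (z - 1)\<^sup>2 + z\<^sup>2" by simp
      then have "2 * z \<le> 2 * z * z + 1" by (simp add: power2_eq_square algebra_simps)
      then show ?thesis using that by (simp add: field_simps)
    qed
    from this[of x] this[of y] pos[OF xy] show ?thesis by linarith
  qed
  have "x + y \<le> m * row_val x y r s" if "(x, y) \<in> S" "int_row r s" "r\<^sup>2 + s\<^sup>2 = real n" for x y r s n
    using that
  proof (induction n arbitrary: x y r s rule: less_induct)
    case (less n)
    note p = pos[OF less.prems(1)]
    have step: "x + y \<le> m * row_val x y r (- \<sigma>)"
      if r: "r > 0" "\<sigma> > 0" "int_row r (- \<sigma>)" "r\<^sup>2 + \<sigma>\<^sup>2 = real n"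
        and x: "x = app d x'" "x' > 0" "y > 0"
        and IH: "\<And>r' s' n'. int_row r' s' \<Longrightarrow> r'\<^sup>2 + s'\<^sup>2 = real n' \<Longrightarrow> n' < n \<Longrightarrow>
          x' + app d y \<le> m * row_val x' (app d y) r' s'" for r \<sigma> d x' x y
    proof -
      obtain r' s' where s: "shift d (r, - \<sigma>) = (r', s')" by force
      have "int_row r' s'" using int_row_shift[OF r(3), of d] s by simp
      from row_step[OF x(2,3) r(3,1,2), of d] s
      consider "x + y \<le> row_val x y r (- \<sigma>)" | "r'\<^sup>2 + s'\<^sup>2 < r\<^sup>2 + \<sigma>\<^sup>2" unfolding x(1) by auto
      then show ?thesis
      proof cases
        case 1
        moreover have "1 * row_val x y r (- \<sigma>) \<le> m * row_val x y r (- \<sigma>)"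
          using m1 row_val_nonneg by (intro mult_right_mono)
        ultimately show ?thesis by simp
      next
        case 2
        obtain n' where n': "r'\<^sup>2 + s'\<^sup>2 = real n'" using int_row_norm[OF \<open>int_row r' s'\<close>] .
        then have "n' < n" using 2 r(4) by simp
        from IH[OF \<open>int_row r' s'\<close> n' this] have i: "x' + app d y \<le> m * row_val x' (app d y) r' s'" .
        obtain c where c: "c > 0" "row_val x' (app d y) r' s' = c * row_val x y r (- \<sigma>)"
          "x' + app d y = c * (x + y)"
          using row_val_shift[OF x(2,3) s] unfolding x(1) by blast
        have "c * (x + y) \<le> c * (m * row_val x y r (- \<sigma>))" using i c by (simp add: mult_ac)
        then show ?thesis using c(1) by simp
      qed
    qed
    have half: "x + y \<le> m * row_val x y r s"
      if r: "r > 0" "int_row r s" "r\<^sup>2 + s\<^sup>2 = real n" for r s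
    proof -
      consider "s = 0" | "s < 0" | "s > 0" by linarith
      then show ?thesis
      proof cases
        case 1
        have "r\<^sup>2 \<ge> 1" using int_row_ge_1(1)[OF r(2)] r(1) by simp
        moreover have "row_val x y r s = r\<^sup>2 * (2 * x * y)"
          using 1 p r(1) by (simp add: row_val_def abs_mult power2_eq_square sqrt2_mult algebra_simps)
        moreover have "x + y \<le> m * (1 * (2 * x * y))"
        proof -
          have "1/(2*x) + 1/(2*y) = (x + y) / (2 * x * y)" using p by (simp add: field_simps)
          then have "(x + y) / (2 * x * y) \<le> m" using p by simp
          moreover have "2 * x * y > 0" using p by simp
          ultimately show ?thesis by (simp add: pos_divide_le_eq)
        qed
        moreover have "m * (1 * (2 * x * y)) \<le> m * (r\<^sup>2 * (2 * x * y))"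
          using \<open>r\<^sup>2 \<ge> 1\<close> p m1 by (intro mult_left_mono mult_right_mono) auto
        ultimately show ?thesis by (metis order_trans)
      next
        case 2
        obtain d x' where d: "x = app d x'" "(x', app d y) \<in> S" using fwd[OF less.prems(1)] by blast
        show ?thesis using step[of r "- s" x d x' y] r 2 d pos[OF d(2)] p less.IH by simp
      next
        case 3
        obtain d y' where d: "y = app d y'" "(app d x, y') \<in> S" using bwd[OF less.prems(1)] by blast
        have "y + x \<le> m * row_val y x r (- s)"
        proof (rule step[of r s y d y' x])
          show "int_row r (- s)" using int_row_uminus r by blast
          show "y' + app d x \<le> m * row_val y' (app d x) r' s'"
            if "int_row r' s'" "r'\<^sup>2 + s'\<^sup>2 = real n'" "n' < n" for r' s' n'
            using less.IH[OF that(3) d(2) int_row_uminus(2)[OF that(1)]] that(2)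
              row_val_swap[of y' "app d x" r' s'] by (simp add: add.commute row_val_swap)
        qed (use r 3 d pos[OF d(2)] p in auto)
        then show ?thesis by (simp add: row_val_swap add.commute)
      qed
    qed
    consider "r = 0" | "r > 0" | "r < 0" by linarith
    then show ?case
    proof cases
      case 1
      have "s \<noteq> 0" by (rule int_rowE[OF less.prems(2)]) (use 1 in auto)
      then have "s\<^sup>2 \<ge> 1" using int_row_ge_1(2)[OF less.prems(2)] by simp
      then have "m * 1 \<le> m * s\<^sup>2" using m1 by (intro mult_left_mono) auto
      then have "x + y \<le> m * s\<^sup>2" using p by linarith
      then show ?thesis using 1 by (simp add: row_val_def power2_eq_square)
    next
      case 2
      then show ?thesis using half less.prems by blast
    next
      case 3
      have "int_row (- r) (- s)" using less.prems(2) int_row_uminus by blast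
      then show ?thesis using half[of "- r" "- s"] less.prems(3) 3 by (simp add: row_val_uminus)
    qed
  qed
  moreover have "int_row r s" if "(r, s) \<in> bottom_rows" for r s
    using rows_shape[OF that] by (auto simp: int_row_def)
  ultimately have "x + y \<le> m * row_val x y r s" if "(r, s) \<in> bottom_rows" for r s
    using xy that int_row_norm by metis
  then show ?thesis using pos[OF xy] by (auto simp: adm_def row_val_def)
qed

section \<open>Periodic words\<close>

definition apps :: "digit list \<Rightarrow> real \<Rightarrow> real" where
  "apps w z = foldr app w z"

lemma apps_simps [simp]: "apps [] z = z" "apps (d # w) z = app d (apps w z)"
  "apps (v @ w) z = apps v (apps w z)"
  by (simp_all add: apps_def)

lemma apps_pos: "z > 0 \<Longrightarrow> apps w z > 0"
  by (induction w) (auto intro: app_pos)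

text \<open>The states met by a geodesic while it reads the word \<open>w\<close>, when its ends are \<open>x\<close>
  after \<open>w\<close> and \<open>y\<close> before \<open>w\<close>.\<close>

definition positions :: "digit list \<Rightarrow> real \<Rightarrow> real \<Rightarrow> (real \<times> real) set" where
  "positions w x y = {(apps s x, apps (rev p) y) | p s. w = p @ s}"

definition height :: "real \<Rightarrow> real \<Rightarrow> real" where
  "height x y = max (x + y) (1 / (2*x) + 1 / (2*y))"

text \<open>The pair \<open>(\<rho>', - \<sigma>')\<close> is the row that \<open>shift d\<close>
  sends to \<open>(\<rho>, - \<sigma>)\<close>. In terms of \<open>\<rho>\<close> and
  \<open>\<sigma>\<close> the inverse shift has nonnegative coefficients, so both entries can only
  grow.\<close>

lemma attained_shift:
  assumes "attained m x (app d y) \<rho> \<sigma>" "x > 0" "y > 0"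
  shows "\<exists>\<rho>' \<sigma>'. attained m (app d x) y \<rho>' \<sigma>' \<and> \<rho> \<le> \<rho>' \<and> \<sigma> \<le> \<sigma>' \<and>
    (d = B \<longrightarrow> sqrt 2 * \<rho> + \<sigma> \<le> \<rho>')"
proof -
  note a = assms(1)[unfolded attained_def]
  define \<rho>' \<sigma>' where "\<rho>' = (case d of A \<Rightarrow> \<rho> | B \<Rightarrow> sqrt 2 * \<rho> + \<sigma> | C \<Rightarrow> \<rho> + sqrt 2 * \<sigma>)"
    and "\<sigma>' = (case d of A \<Rightarrow> \<sigma> + sqrt 2 * \<rho> | B \<Rightarrow> \<rho> + sqrt 2 * \<sigma> | C \<Rightarrow> \<sigma>)"
  have sh: "shift d (\<rho>', - \<sigma>') = (\<rho>, - \<sigma>)"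
    by (cases d) (auto simp: \<rho>'_def \<sigma>'_def algebra_simps sqrt2_mult)
  have le: "z \<le> sqrt 2 * z" if "z \<ge> 0" for z
    using mult_right_mono[of 1 "sqrt 2" z] that by simp
  have row: "(\<rho>', - \<sigma>') \<in> bottom_rows"
  proof -
    have e: "- (\<sigma> + sqrt 2 * \<rho>) = - \<sigma> - sqrt 2 * \<rho>" "\<rho> + sqrt 2 * \<sigma> = \<rho> - sqrt 2 * (- \<sigma>)"
      "sqrt 2 * \<rho> + \<sigma> = sqrt 2 * \<rho> - (- \<sigma>)" "- (\<rho> - sqrt 2 * (- \<sigma>)) = sqrt 2 * (- \<sigma>) - \<rho>" by simp_all
    have r: "(\<rho>, - \<sigma>) \<in> bottom_rows" using a by blast
    show ?thesis
      by (cases d; simp only: \<rho>'_def \<sigma>'_def digit.case e rows_T'[OF r] rows_B'[OF r] rows_C'[OF r])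
  qed
  have mono: "\<rho> \<le> \<rho>'" "\<sigma> \<le> \<sigma>'" "d = B \<longrightarrow> sqrt 2 * \<rho> + \<sigma> \<le> \<rho>'"
    using a le[of \<rho>] le[of \<sigma>] by (cases d; simp add: \<rho>'_def \<sigma>'_def)+
  obtain c where c: "c > 0" "row_val x (app d y) \<rho> (- \<sigma>) = c * row_val (app d x) y \<rho>' (- \<sigma>')"
      "x + app d y = c * (app d x + y)"
    using row_val_shift[OF assms(2,3) sh] by blast
  have "c * (app d x + y) = c * (m * row_val (app d x) y \<rho>' (- \<sigma>'))"
    using a c(2,3) by (simp add: mult_ac)
  then have "app d x + y = m * row_val (app d x) y \<rho>' (- \<sigma>')" using c(1) by simp
  then have "attained m (app d x) y \<rho>' \<sigma>'" using a mono(1,2) row by (simp add: attained_def)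
  then show ?thesis using mono by blast
qed

lemma attained_shifts:
  assumes "attained m x (apps (rev p) y) \<rho> \<sigma>" "x > 0" "y > 0"
  shows "\<exists>\<rho>' \<sigma>'. attained m (apps p x) y \<rho>' \<sigma>' \<and> \<rho> \<le> \<rho>' \<and> \<sigma> \<le> \<sigma>' \<and>
    (B \<in> set p \<longrightarrow> sqrt 2 * \<rho> + \<sigma> \<le> \<rho>')"
  using assms
proof (induction p arbitrary: y)
  case (Cons d p)
  obtain \<rho>1 \<sigma>1 where 1: "attained m (apps p x) (app d y) \<rho>1 \<sigma>1" "\<rho> \<le> \<rho>1" "\<sigma> \<le> \<sigma>1"
      "B \<in> set p \<longrightarrow> sqrt 2 * \<rho> + \<sigma> \<le> \<rho>1"
    using Cons.IH[of "app d y"] Cons.prems app_pos by auto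
  obtain \<rho>2 \<sigma>2 where 2: "attained m (app d (apps p x)) y \<rho>2 \<sigma>2" "\<rho>1 \<le> \<rho>2" "\<sigma>1 \<le> \<sigma>2"
      "d = B \<longrightarrow> sqrt 2 * \<rho>1 + \<sigma>1 \<le> \<rho>2"
    using attained_shift[OF 1(1) apps_pos] Cons.prems by blast
  have "sqrt 2 * \<rho> + \<sigma> \<le> sqrt 2 * \<rho>1 + \<sigma>1" using 1 by (intro add_mono mult_left_mono) auto
  then have "B \<in> set (d # p) \<longrightarrow> sqrt 2 * \<rho> + \<sigma> \<le> \<rho>2" using 1 2 by auto
  then show ?case using 1 2 by (intro exI[of _ \<rho>2] exI[of _ \<sigma>2]) auto
qed auto

text \<open>Undoing the shifts over a whole period returns to the same ends with a new attaining
  row. The letter \<open>B\<close> forces \<open>\<rho>\<close> to grow, so the value is attained at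
  cusps with unbounded denominators, as both spectra lemmas require.\<close>

theorem periodic_value:
  assumes x: "x > 0" "apps w x = x" and y: "y > 0" "apps (rev w) y = y" and B: "B \<in> set w"
    and le: "\<And>u v. (u, v) \<in> positions w x y \<Longrightarrow> height u v \<le> m"
    and attained: "(u0, v0) \<in> positions w x y" "height u0 v0 = m"
  shows "sqrt 2 * m \<in> markoff_spectrum" "sqrt 2 * m \<in> lagrange_spectrum"
proof -
  have "(apps w x, apps (rev []) y) \<in> positions w x y" unfolding positions_def by blast
  then have xy: "(x, y) \<in> positions w x y" using x by simp
  have adm: "adm m x y"
  proof (rule adm_of_orbit[OF _ _ _ xy])
    fix u v assume "(u, v) \<in> positions w x y"
    then obtain p s where ps: "u = apps s x" "v = apps (rev p) y" "w = p @ s"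
      unfolding positions_def by blast
    show "u > 0 \<and> v > 0 \<and> u + v \<le> m \<and> 1/(2*u) + 1/(2 * v) \<le> m"
      using le[OF \<open>(u, v) \<in> _\<close>] ps x y apps_pos by (simp add: height_def)
    show "\<exists>d u'. u = app d u' \<and> (u', app d v) \<in> positions w x y"
    proof (cases s)
      case Nil
      obtain d w' where w: "w = d # w'" using B by (cases w) auto
      have "w = [d] @ w'" using w by simp
      then have "(apps w' x, apps (rev [d]) y) \<in> positions w x y" unfolding positions_def by blast
      moreover have "v = y" "u = app d (apps w' x)" using ps Nil x y w by auto
      ultimately show ?thesis by auto
    next
      case (Cons d s')
      have "w = (p @ [d]) @ s'" using ps Cons by simp
      then have "(apps s' x, apps (rev (p @ [d])) y) \<in> positions w x y" unfolding positions_def by blast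
      then show ?thesis using ps Cons by auto
    qed
    show "\<exists>d v'. v = app d v' \<and> (app d u, v') \<in> positions w x y"
    proof (cases p rule: rev_cases)
      case Nil
      obtain w' d where w: "w = w' @ [d]" using B by (cases w rule: rev_cases) auto
      then have "(apps [d] x, apps (rev w') y) \<in> positions w x y" unfolding positions_def by blast
      moreover have "u = x" "v = app d (apps (rev w') y)" using ps Nil x y w by auto
      ultimately show ?thesis by auto
    next
      case (snoc p' d)
      have "w = p' @ (d # s)" using ps snoc by simp
      then have "(apps (d # s) x, apps (rev p') y) \<in> positions w x y" unfolding positions_def by blast
      then show ?thesis using ps snoc by auto
    qed
  qed
  obtain p s where ps: "u0 = apps s x" "v0 = apps (rev p) y" "w = p @ s"
    using attained(1) unfolding positions_def by blast
  have pos0: "u0 > 0" "v0 > 0" using ps x y apps_pos by auto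
  \<comment> \<open>The height is reached at the cusp \<open>\<infinity>\<close>, with row
    \<open>(0, -1)\<close>, or at the cusp \<open>0\<close>, with row \<open>(1, 0)\<close>.\<close>
  have "\<exists>\<rho> \<sigma>. attained m u0 v0 \<rho> \<sigma> \<and> (\<rho> \<ge> 1 \<or> \<sigma> \<ge> 1)"
  proof (cases "u0 + v0 = m")
    case True
    then have "attained m u0 v0 0 1"
      using rows_refl[OF rows_0_1] by (simp add: attained_def row_val_def)
    then show ?thesis by force
  next
    case False
    then have "1 / (2 * u0) + 1 / (2 * v0) = m" using attained(2) by (auto simp: height_def max_def split: if_splits)
    then have "u0 + v0 = m * (2 * (u0 * v0))" using pos0 by (auto simp: field_simps)
    then have "attained m u0 v0 1 0"
      using rows_1_0 pos0 by (simp add: attained_def row_val_def abs_mult sqrt2_mult)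
    then show ?thesis by force
  qed
  then obtain \<rho> \<sigma> where "attained m u0 v0 \<rho> \<sigma>" "\<rho> \<ge> 1 \<or> \<sigma> \<ge> 1" by blast
  then obtain \<rho>0 \<sigma>0 where init: "attained m x y \<rho>0 \<sigma>0" "\<rho>0 \<ge> 1 \<or> \<sigma>0 \<ge> 1"
    using attained_shifts[of m u0 p y \<rho> \<sigma>] pos0 y x ps by force
  have grow: "\<exists>\<rho> \<sigma>. attained m x y \<rho> \<sigma> \<and> (\<rho> \<ge> 1 \<or> \<sigma> \<ge> 1) \<and> \<rho> \<ge> 2/5 * real n" for n
  proof (induction n)
    case 0
    have "\<rho>0 \<ge> 0" using init by (simp add: attained_def)
    with init show ?case by (intro exI[of _ \<rho>0] exI[of _ \<sigma>0]) simp
  next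
    case (Suc n)
    then obtain \<rho> \<sigma> where 1: "attained m x y \<rho> \<sigma>" "\<rho> \<ge> 1 \<or> \<sigma> \<ge> 1" "\<rho> \<ge> 2/5 * real n" by blast
    obtain \<rho>' \<sigma>' where 2: "attained m x y \<rho>' \<sigma>'" "\<rho> \<le> \<rho>'" "\<sigma> \<le> \<sigma>'" "sqrt 2 * \<rho> + \<sigma> \<le> \<rho>'"
      using attained_shifts[of m x w y \<rho> \<sigma>] 1(1) x y B by auto
    \<comment> \<open>If \<open>\<rho> \<ge> 1\<close>, the factor \<open>7/5\<close> gains
      \<open>2/5\<close>; if \<open>\<sigma> \<ge> 1\<close>, the summand \<open>\<sigma>\<close>
      gains even more.\<close>
    have "7/5 \<le> sqrt 2" by (rule real_le_rsqrt) (simp add: power2_eq_square)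
    then have "7/5 * \<rho> \<le> sqrt 2 * \<rho>" using 1(1) by (intro mult_right_mono) (auto simp: attained_def)
    moreover have "\<rho> \<ge> 0" "\<sigma> \<ge> 0" using 1(1) by (auto simp: attained_def)
    ultimately have "\<rho> + 2/5 \<le> \<rho>'" using 1(2) 2(4) by linarith
    then have "\<rho>' \<ge> 2/5 * real (Suc n)" using 1(3) by simp
    moreover have "\<rho>' \<ge> 1 \<or> \<sigma>' \<ge> 1" using 1(2) 2 by linarith
    ultimately show ?case using 2(1) by blast
  qed
  have att: "\<exists>\<rho> \<sigma>. \<rho> > K \<and> attained m x y \<rho> \<sigma>" for K
  proof -
    obtain n where n: "real n > 5/2 * K" using reals_Archimedean2 by blast
    obtain \<rho> \<sigma> where "attained m x y \<rho> \<sigma>" "\<rho> \<ge> 2/5 * real n" using grow[of n] by blast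
    then show ?thesis using n by (intro exI[of _ \<rho>] exI[of _ \<sigma>]) auto
  qed
  show "sqrt 2 * m \<in> markoff_spectrum" "sqrt 2 * m \<in> lagrange_spectrum"
    using value_in_markoff[OF adm att] value_in_lagrange[OF adm att] .
qed

lemma positions_append:
  "positions (w1 @ w2) x y = positions w1 (apps w2 x) y \<union> positions w2 x (apps (rev w1) y)"
proof (intro equalityI subsetI)
  fix z assume "z \<in> positions (w1 @ w2) x y"
  then obtain p s where z: "z = (apps s x, apps (rev p) y)" "w1 @ w2 = p @ s" by (auto simp: positions_def)
  from z(2) obtain us where "w1 = p @ us \<and> us @ w2 = s \<or> w1 @ us = p \<and> w2 = us @ s"
    by (auto simp: append_eq_append_conv2)
  then show "z \<in> positions w1 (apps w2 x) y \<union> positions w2 x (apps (rev w1) y)"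
  proof
    assume "w1 = p @ us \<and> us @ w2 = s"
    then have "z = (apps us (apps w2 x), apps (rev p) y)" "w1 = p @ us" using z by auto
    then show ?thesis unfolding positions_def by blast
  next
    assume "w1 @ us = p \<and> w2 = us @ s"
    then have "z = (apps s x, apps (rev us) (apps (rev w1) y))" "w2 = us @ s" using z by auto
    then show ?thesis unfolding positions_def by blast
  qed
next
  fix z assume "z \<in> positions w1 (apps w2 x) y \<union> positions w2 x (apps (rev w1) y)"
  then consider p s where "z = (apps s (apps w2 x), apps (rev p) y)" "w1 = p @ s"
    | p s where "z = (apps s x, apps (rev p) (apps (rev w1) y))" "w2 = p @ s"
    by (auto simp: positions_def)
  then show "z \<in> positions (w1 @ w2) x y"
  proof cases
    case 1
    then have "z = (apps (s @ w2) x, apps (rev p) y)" "w1 @ w2 = p @ (s @ w2)" by auto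
    then show ?thesis unfolding positions_def by blast
  next
    case 2
    then have "z = (apps s x, apps (rev (w1 @ p)) y)" "w1 @ w2 = (w1 @ p) @ s" by auto
    then show ?thesis unfolding positions_def by blast
  qed
qed

lemma positions_Nil: "positions [] x y = {(x, y)}"
  by (auto simp: positions_def)

lemma positions_Cons: "positions (d # w) x y = insert (app d (apps w x), y) (positions w x (app d y))"
proof -
  have "positions [d] z y = {(app d z, y), (z, app d y)}" for z
  proof (intro equalityI subsetI)
    fix q assume "q \<in> positions [d] z y"
    then obtain p s where q: "q = (apps s z, apps (rev p) y)" "[d] = p @ s" by (auto simp: positions_def)
    then have "p = [] \<and> s = [d] \<or> p = [d] \<and> s = []" by (cases p) auto
    then show "q \<in> {(app d z, y), (z, app d y)}" using q(1) by auto
  next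
    fix q assume "q \<in> {(app d z, y), (z, app d y)}"
    moreover have "\<exists>p s. (app d z, y) = (apps s z, apps (rev p) y) \<and> [d] = p @ s"
      by (rule exI[of _ "[]"], rule exI[of _ "[d]"]) simp
    moreover have "\<exists>p s. (z, app d y) = (apps s z, apps (rev p) y) \<and> [d] = p @ s"
      by (rule exI[of _ "[d]"], rule exI[of _ "[]"]) simp
    ultimately show "q \<in> positions [d] z y" unfolding positions_def by blast
  qed
  moreover have "(apps w x, app d y) \<in> positions w x (app d y)"
    unfolding positions_def by (rule CollectI, rule exI[of _ "[]"], rule exI[of _ w]) simp
  ultimately show ?thesis using positions_append[of "[d]" w x y] by auto
qed

section \<open>The endpoints of the gaps\<close>

lemma heightI: "u + v \<le> m \<Longrightarrow> 1 / (2*u) + 1 / (2 * v) \<le> m \<Longrightarrow> height u v \<le> m"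
  by (simp add: height_def)

text \<open>For the word \<open>ABCB\<close> all tails are rational in the root \<open>g\<close> of
  \<open>g^2 = 1 - g\<close>, and all four states have the same height
  \<open>sqrt 5\<close>.\<close>

lemma sqrt10_in_spectra: "sqrt 10 \<in> markoff_spectrum" "sqrt 10 \<in> lagrange_spectrum"
proof -
  define g where "g = (sqrt 5 - 1) / 2"
  have g: "g * g = 1 - g" "g > 0" "1 + 2*g = sqrt 5" using sqrt5 by (simp_all add: g_def field_simps)
  have d: "dB (1 + g) = (1 + g) / 2" "dC ((1 + g) / 2) = g / 2" "dB (g / 2) = g"
    using g by (simp_all add: dB_def dC_def field_simps)
  have i: "1 / (2 * (1 + g)) = g / 2" "1 / (2 * g) = (1 + g) / 2" "1 / (1 + g) = g" "1 / g = 1 + g"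
    using g by (simp_all add: field_simps)
  have j: "1 / (2 * (g / 2)) = 1 + g" "1 / (2 * ((1 + g) / 2)) = g" using i by simp_all
  have h: "height (1 + g) g = sqrt 5" "height g (1 + g) = sqrt 5"
      "height (g / 2) ((1 + g) / 2) = sqrt 5" "height ((1 + g) / 2) (g / 2) = sqrt 5"
    using g(2) unfolding height_def i j by (simp_all add: max_def field_simps flip: g(3))
  let ?w = "[A, B, C, B]"
  have pos: "positions ?w (1 + g) g = {(1 + g, g), (g, 1 + g), (g / 2, (1 + g) / 2), ((1 + g) / 2, g / 2)}"
    by (auto simp: positions_Cons positions_Nil d)
  have fix_x: "0 < 1 + g" "apps ?w (1 + g) = 1 + g" "0 < g" "apps (rev ?w) g = g" "B \<in> set ?w"
    using g(2) by (simp_all add: d)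
  have le: "height u v \<le> sqrt 5" if "(u, v) \<in> positions ?w (1 + g) g" for u v
    using that h unfolding pos by (elim insertE emptyE) (simp_all only: prod.inject order_refl)
  have att: "(1 + g, g) \<in> positions ?w (1 + g) g" unfolding pos by simp
  have "sqrt 2 * sqrt 5 \<in> markoff_spectrum" "sqrt 2 * sqrt 5 \<in> lagrange_spectrum"
    by (rule periodic_value[OF fix_x le att h(1)]; assumption)+
  then show "sqrt 10 \<in> markoff_spectrum" "sqrt 10 \<in> lagrange_spectrum"
    unfolding sqrt_scaling(2) .
qed

lemma sqrt238_in_spectra: "sqrt 238 / 5 \<in> markoff_spectrum" "sqrt 238 / 5 \<in> lagrange_spectrum"
proof -
  define q where "q = sqrt 119"
  have q: "q * q = 119" "10.9 < q" "q < 10.91" using sqrt119 by (simp_all add: q_def)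
  define a b where "a = (7 + q) / 10" and "b = (q - 7) / 10"
  have ab: "a + b = q / 5" by (simp add: a_def b_def add_divide_distrib diff_divide_distrib)
  have pos0: "a > 0" "b > 0" "a - 1 > 0" using q by (simp_all add: a_def b_def)
  have d: "dC a = b" "dB (1 + b) = a - 1"
    using q by (simp_all add: dB_def dC_def a_def b_def field_simps)
  \<comment> \<open>For tails with \<open>2 * u * v \<ge> 1\<close> the cusp
    \<open>\<infinity>\<close> decides the height, so only the sums matter.\<close>
  have inv: "1 / (2*u) + 1 / (2 * v) \<le> u + v" if "u > 0" "v > 0" "2 * (u * v) \<ge> 1" for u v :: real
  proof -
    have "1 / (2*u) + 1 / (2 * v) = (u + v) / (2 * (u * v))" using that by (simp add: field_simps)
    also have "\<dots> \<le> (u + v) / 1" using that by (intro divide_left_mono) auto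
    finally show ?thesis by simp
  qed
  have prod: "2 * (a * b) = 7/5" "2 * ((a - 1) * (1 + b)) = 11/5"
    using q by (simp_all add: a_def b_def field_simps)
  have h: "height a b = q / 5" "height b a = q / 5" "height (a - 1) (1 + b) = q / 5" "height (1 + b) (a - 1) = q / 5"
    using inv[of a b] inv[of b a] inv[of "a - 1" "1 + b"] inv[of "1 + b" "a - 1"] pos0 prod ab
    by (simp_all add: height_def max_def mult.commute)
  let ?w = "[A, B, A, C]"
  have pos: "positions ?w a b = {(a, b), (a - 1, 1 + b), (1 + b, a - 1), (b, a)}"
    by (auto simp: positions_Cons positions_Nil d)
  have fix_x: "0 < a" "apps ?w a = a" "0 < b" "apps (rev ?w) b = b" "B \<in> set ?w"
    using pos0 by (simp_all add: d)
  have le: "height u v \<le> q / 5" if "(u, v) \<in> positions ?w a b" for u v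
    using that h unfolding pos by (elim insertE emptyE) (simp_all only: prod.inject order_refl)
  have att: "(a, b) \<in> positions ?w a b" unfolding pos by simp
  have "sqrt 2 * (q / 5) \<in> markoff_spectrum" "sqrt 2 * (q / 5) \<in> lagrange_spectrum"
    by (rule periodic_value[OF fix_x le att h(1)]; assumption)+
  then show "sqrt 238 / 5 \<in> markoff_spectrum" "sqrt 238 / 5 \<in> lagrange_spectrum"
    unfolding q_def sqrt_scaling(1) .
qed

section \<open>Interval bounds for the tails of the approximating words\<close>

lemma app_A_in: "l \<le> z \<Longrightarrow> z \<le> u \<Longrightarrow> app A z \<in> {1 + l..1 + u}"
  by simp

text \<open>The new bounds are \<open>dB (1/4)\<close> and \<open>dB 2\<close>. Together with
  \<open>dC 2 = 2/5\<close> they explain the constant \<open>67/30 = (1 + 5/6) + 2/5\<close> used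
  from here on.\<close>

lemma app_B_in: "1/4 \<le> z \<Longrightarrow> z \<le> 2 \<Longrightarrow> app B z \<in> {3/5..5/6}"
  by (simp add: dB_def field_simps)

lemma app_C_in: "0 < l \<Longrightarrow> l \<le> z \<Longrightarrow> z \<le> 2 \<Longrightarrow> app C z \<in> {dC l..2/5}"
  using dC_le[of l z] dC_le[of z 2] by (simp add: dC_def)

lemma inverse_sum_le:
  fixes u v l1 l2 :: real
  assumes "l1 \<le> u" "l2 \<le> v" "0 < l1" "0 < l2" "1 / (2 * l1) + 1 / (2 * l2) \<le> m"
  shows "1 / (2*u) + 1 / (2 * v) \<le> m"
proof -
  have "1 / (2*u) \<le> 1 / (2 * l1)" "1 / (2 * v) \<le> 1 / (2 * l2)"
    using assms by (auto intro!: divide_left_mono)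
  then show ?thesis using assms(5) by linarith
qed

text \<open>The largest height away from the centres of the blocks \<open>BAB\<close> and \<open>BCB\<close>, for words without
  \<open>AA\<close> and \<open>CC\<close>.\<close>

lemma height_le_67_30:
  assumes "u \<in> {l1..u1}" "v \<in> {l2..u2}" "0 < l1" "0 < l2"
    "u1 + u2 \<le> 67/30" "1 / (2 * l1) + 1 / (2 * l2) \<le> 67/30"
  shows "height u v \<le> 67/30"
proof (rule heightI)
  show "u + v \<le> 67/30" using assms(1,2,5) by simp
  show "1 / (2*u) + 1 / (2 * v) \<le> 67/30"
    by (rule inverse_sum_le[OF _ _ assms(3,4,6)]) (use assms(1,2) in simp_all)
qed

lemma dC_vals: "dC (3/5) = 3/11" "dC (5/4) = 5/14"
  by (simp_all add: dC_def)

text \<open>Up to rotation \<open>wordU\<close> is \<open>wordV\<close> read backwards and inverted,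
  so that both periodic ends lead to the same parameter \<open>1 / (2 * amax)\<close>.\<close>

definition wordU :: "digit list" where "wordU = [C, A, C, B]"
definition wordV :: "digit list" where "wordV = [A, B, A, C]"

abbreviation rep :: "nat \<Rightarrow> 'a list \<Rightarrow> 'a list" where
  "rep n w \<equiv> concat (replicate n w)"

lemma rev_rep: "rev (rep n w) = rep n (rev w)"
  by (simp add: rev_concat rev_map map_replicate_const flip: map_replicate)

lemma apps_U_in: "1/4 \<le> z \<Longrightarrow> z \<le> 2 \<Longrightarrow> apps wordU z \<in> {5/14..2/5}"
proof -
  assume "1/4 \<le> z" "z \<le> 2"
  then have 1: "app B z \<in> {3/5..5/6}" by (rule app_B_in)
  have 2: "app C (app B z) \<in> {dC (3/5)..2/5}" by (rule app_C_in) (use 1 in auto)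
  have 3: "app A (app C (app B z)) \<in> {1 + 1/4..1 + 2/5}"
    by (rule app_A_in) (use 2 in \<open>auto simp: dC_vals\<close>)
  have "app C (app A (app C (app B z))) \<in> {dC (5/4)..2/5}" by (rule app_C_in) (use 3 in auto)
  then show ?thesis by (simp add: wordU_def dC_vals)
qed

lemma apps_revU_in: "z \<in> {3/5..5/6} \<Longrightarrow> apps (rev wordU) z \<in> {3/5..5/6}"
proof -
  assume z: "z \<in> {3/5..5/6}"
  have 2: "app C z \<in> {dC (3/5)..2/5}" by (rule app_C_in) (use z in auto)
  have 3: "app A (app C z) \<in> {1 + 1/4..1 + 2/5}"
    by (rule app_A_in) (use 2 in \<open>auto simp: dC_vals\<close>)
  have 4: "app C (app A (app C z)) \<in> {dC (5/4)..2/5}" by (rule app_C_in) (use 3 in auto)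
  have "app B (app C (app A (app C z))) \<in> {3/5..5/6}" by (rule app_B_in) (use 4 in \<open>auto simp: dC_vals\<close>)
  then show ?thesis by (simp add: wordU_def)
qed

lemma apps_V_in: "3/5 \<le> z \<Longrightarrow> z \<le> 2 \<Longrightarrow> apps wordV z \<in> {8/5..11/6}"
proof -
  assume "3/5 \<le> z" "z \<le> 2"
  then have 2: "app C z \<in> {dC (3/5)..2/5}" by (intro app_C_in) auto
  have 3: "app A (app C z) \<in> {1 + 1/4..1 + 2/5}"
    by (rule app_A_in) (use 2 in \<open>auto simp: dC_vals\<close>)
  have 4: "app B (app A (app C z)) \<in> {3/5..5/6}" by (rule app_B_in) (use 3 in auto)
  have "app A (app B (app A (app C z))) \<in> {1 + 3/5..1 + 5/6}" by (rule app_A_in) (use 4 in auto)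
  then show ?thesis by (simp add: wordV_def)
qed

lemma apps_revV_in: "z \<in> {5/14..2/5} \<Longrightarrow> apps (rev wordV) z \<in> {5/14..2/5}"
proof -
  assume z: "z \<in> {5/14..2/5}"
  have 1: "app A z \<in> {1 + 5/14..1 + 2/5}" by (rule app_A_in) (use z in auto)
  have 2: "app B (app A z) \<in> {3/5..5/6}" by (rule app_B_in) (use 1 in auto)
  have 3: "app A (app B (app A z)) \<in> {1 + 3/5..1 + 5/6}" by (rule app_A_in) (use 2 in auto)
  have "app C (app A (app B (app A z))) \<in> {dC (5/4)..2/5}" by (rule app_C_in) (use 3 in auto)
  then show ?thesis by (simp add: wordV_def dC_vals)
qed

lemma apps_rep_in:
  assumes "\<And>z. z \<in> S \<Longrightarrow> apps w z \<in> S" "z \<in> S"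
  shows "apps (rep n w) z \<in> S"
  using assms by (induction n) auto

text \<open>Each period keeps the past and the future in their intervals and adds four cuts of
  height at most \<open>67/30\<close>, whatever the number of periods.\<close>

lemma positions_U:
  assumes "apps L x \<in> {1/4..2}" "y \<in> {3/5..5/6}" "(u, v) \<in> positions (rep n wordU @ L) x y"
  shows "height u v \<le> 67/30 \<or> (u, v) \<in> positions L x (apps (rev (rep n wordU)) y)"
  using assms(2,3)
proof (induction n arbitrary: y)
  case (Suc n)
  let ?X = "apps (rep n wordU @ L) x"
  have X: "?X \<in> {1/4..2}"
    using apps_rep_in[of "{1/4..2}" wordU "apps L x" n] apps_U_in assms(1) by fastforce
  have u1: "app B ?X \<in> {3/5..5/6}" by (rule app_B_in) (use X in auto)
  have u2: "app C (app B ?X) \<in> {dC (3/5)..2/5}" by (rule app_C_in) (use u1 in auto)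
  have u3: "app A (app C (app B ?X)) \<in> {1 + 1/4..1 + 2/5}"
    by (rule app_A_in) (use u2 in \<open>auto simp: dC_vals\<close>)
  have u4: "apps wordU ?X \<in> {5/14..2/5}" using apps_U_in X by auto
  have v1: "app C y \<in> {dC (3/5)..2/5}" by (rule app_C_in) (use Suc.prems in auto)
  have v2: "app A (app C y) \<in> {1 + 1/4..1 + 2/5}" by (rule app_A_in) (use v1 in \<open>auto simp: dC_vals\<close>)
  have v3: "app C (app A (app C y)) \<in> {dC (5/4)..2/5}" by (rule app_C_in) (use v2 in auto)
  from Suc.prems(2) consider
      "(u, v) = (apps wordU ?X, y)" | "(u, v) = (app A (app C (app B ?X)), app C y)"
    | "(u, v) = (app C (app B ?X), app A (app C y))" | "(u, v) = (app B ?X, app C (app A (app C y)))"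
    | "(u, v) \<in> positions (rep n wordU @ L) x (apps (rev wordU) y)"
    by (auto simp: wordU_def positions_Cons)
  then show ?case
  proof cases
    case 1
    then show ?thesis using height_le_67_30[OF u4 Suc.prems(1)] by simp
  next
    case 2
    then show ?thesis using height_le_67_30[OF u3 v1] by (simp add: dC_vals)
  next
    case 3
    then show ?thesis using height_le_67_30[OF u2 v2] by (simp add: dC_vals)
  next
    case 4
    then show ?thesis using height_le_67_30[OF u1 v3] by (simp add: dC_vals)
  next
    case 5
    then show ?thesis using Suc.IH[OF apps_revU_in[OF Suc.prems(1)]]
      by simp
  qed
qed auto

lemma positions_V:
  assumes "apps L x \<in> {3/5..2}" "y \<in> {5/14..2/5}" "(u, v) \<in> positions (rep n wordV @ L) x y"
  shows "height u v \<le> 67/30 \<or> (u, v) \<in> positions L x (apps (rev (rep n wordV)) y)"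
  using assms(2,3)
proof (induction n arbitrary: y)
  case (Suc n)
  let ?X = "apps (rep n wordV @ L) x"
  have X: "?X \<in> {3/5..2}"
    using apps_rep_in[of "{3/5..2}" wordV "apps L x" n] apps_V_in assms(1) by fastforce
  have u1: "app C ?X \<in> {dC (3/5)..2/5}" by (rule app_C_in) (use X in auto)
  have u2: "app A (app C ?X) \<in> {1 + 1/4..1 + 2/5}" by (rule app_A_in) (use u1 in \<open>auto simp: dC_vals\<close>)
  have u3: "app B (app A (app C ?X)) \<in> {3/5..5/6}" by (rule app_B_in) (use u2 in auto)
  have u4: "apps wordV ?X \<in> {8/5..11/6}" using apps_V_in X by auto
  have v1: "app A y \<in> {1 + 5/14..1 + 2/5}" by (rule app_A_in) (use Suc.prems in auto)
  have v2: "app B (app A y) \<in> {3/5..5/6}" by (rule app_B_in) (use v1 in auto)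
  have v3: "app A (app B (app A y)) \<in> {1 + 3/5..1 + 5/6}" by (rule app_A_in) (use v2 in auto)
  from Suc.prems(2) consider
      "(u, v) = (apps wordV ?X, y)" | "(u, v) = (app B (app A (app C ?X)), app A y)"
    | "(u, v) = (app A (app C ?X), app B (app A y))" | "(u, v) = (app C ?X, app A (app B (app A y)))"
    | "(u, v) \<in> positions (rep n wordV @ L) x (apps (rev wordV) y)"
    by (auto simp: wordV_def positions_Cons)
  then show ?case
  proof cases
    case 1
    then show ?thesis using height_le_67_30[OF u4 Suc.prems(1)] by simp
  next
    case 2
    then show ?thesis using height_le_67_30[OF u3 v1] by (simp add: dC_vals)
  next
    case 3
    then show ?thesis using height_le_67_30[OF u2 v2] by (simp add: dC_vals)
  next
    case 4
    then show ?thesis using height_le_67_30[OF u1 v3] by (simp add: dC_vals)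
  next
    case 5
    then show ?thesis using Suc.IH[OF apps_revV_in[OF Suc.prems(1)]] by simp
  qed
qed auto

lemma continuous_on_apps: "continuous_on {0<..} (apps w)"
proof (induction w)
  case (Cons d w)
  have "continuous_on {0<..} (app d)"
  proof (cases d)
    case B
    have "app B = (\<lambda>z. (2*z + 1) / (2*z + 2))" by (auto simp: dB_def)
    then show ?thesis unfolding B by (auto intro!: continuous_intros)
  next
    case C
    have "app C = (\<lambda>z. z / (1 + 2*z))" by (auto simp: dC_def)
    then show ?thesis unfolding C by (auto intro!: continuous_intros)
  next
    case A
    have "app A = (\<lambda>z. 1 + z)" by auto
    then show ?thesis unfolding A by (auto intro!: continuous_intros)
  qed
  from continuous_on_compose2[OF this Cons.IH] show ?case
    by (auto intro: apps_pos)
qed simp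

lemma apps_fixed_point:
  assumes "0 < a" "a \<le> b" "\<And>z. z \<in> {a..b} \<Longrightarrow> apps w z \<in> {a..b}"
  obtains x where "x \<in> {a..b}" "apps w x = x"
proof -
  have "{a..b} \<noteq> {}" using assms(2) by simp
  moreover have "continuous_on {a..b} (apps w)"
    by (rule continuous_on_subset[OF continuous_on_apps]) (use assms(1) in auto)
  moreover have "apps w \<in> {a..b} \<rightarrow> {a..b}" using assms(3) by blast
  ultimately show thesis
    by (rule brouwer[OF compact_Icc is_interval_convex[OF is_interval_cc]]) (rule that)
qed

text \<open>Inversion turns \<open>ABAC\<close> into \<open>CBCA\<close>, and a \<open>C\<close>
  before periods of \<open>BCAC\<close> can be carried to their end, leaving periods of
  \<open>CBCA\<close>. One contraction with fixed point \<open>1 / (2 * amax)\<close> thus controls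
  both ends.\<close>

definition wordT :: "digit list" where "wordT = [C, B, C, A]"

lemma apps_T: "z > 0 \<Longrightarrow> apps wordT z = (5 + 4*z) / (18 + 14*z)"
proof -
  assume z: "z > 0"
  have "apps wordT z = dC (dB (dC (1 + z)))" by (simp add: wordT_def)
  also have "\<dots> = dC ((5 + 4*z) / (8 + 6*z))" using dB_dC_1[of z] z by simp
  also have "\<dots> = (5 + 4*z) / (18 + 14*z)"
    using z by (simp add: dC_def divide_simps)
  finally show ?thesis .
qed

lemma apps_T_contraction:
  assumes "z > 0"
  shows "\<bar>apps (rep n wordT) z - 1 / (2 * amax)\<bar> \<le> \<bar>z - 1 / (2 * amax)\<bar> * (1/2) ^ n"
proof (induction n)
  case (Suc n)
  define p where "p = 1 / (2 * amax)"
  have p: "p > 0" using amax_eq by (simp add: p_def)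
  have "p * amax = 1/2" using amax_eq by (simp add: p_def)
  have fp: "p = (5 + 4*p) / (18 + 14*p)"
  proof -
    have "14 * (p * p) + 14 * p = 5"
      using amax_eq unfolding p_def by (simp add: divide_simps)
    then show ?thesis using p by (simp add: field_simps)
  qed
  define u where "u = apps (rep n wordT) z"
  have u: "u > 0" using apps_pos[OF assms] by (simp add: u_def)
  have "apps wordT u - p = (5 + 4*u) / (18 + 14*u) - (5 + 4*p) / (18 + 14*p)"
    using apps_T[OF u] fp by simp
  also have "\<dots> = (u - p) * (2 / ((18 + 14*u) * (18 + 14*p)))"
    using u p by (simp add: divide_simps) (simp add: algebra_simps)
  finally have "apps wordT u - p = (u - p) * (2 / ((18 + 14*u) * (18 + 14*p)))" .
  moreover have "2 / ((18 + 14*u) * (18 + 14*p)) > 0" using u p by simp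
  ultimately have "\<bar>apps wordT u - p\<bar> = \<bar>u - p\<bar> * (2 / ((18 + 14*u) * (18 + 14*p)))"
    by (simp only: abs_mult abs_of_pos)
  also have "\<dots> \<le> \<bar>z - p\<bar> * (1/2) ^ n * (1/2)"
  proof (rule mult_mono)
    have "18 * 18 \<le> (18 + 14*u) * (18 + 14*p)" using u p by (intro mult_mono) auto
    then show "2 / ((18 + 14*u) * (18 + 14*p)) \<le> 1/2" by (simp add: field_simps)
  qed (use Suc.IH u p in \<open>auto simp: u_def p_def\<close>)
  finally show ?case by (simp add: u_def p_def mult_ac)
qed simp

lemma C_rep: "app C (apps (rep n (rev wordU)) z) = apps (rep n wordT) (app C z)"
  by (induction n) (simp_all add: wordU_def wordT_def)

lemma inv_rep_V: "z > 0 \<Longrightarrow> 1 / (2 * apps (rep n wordV) z) = apps (rep n wordT) (1 / (2*z))"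
proof (induction n)
  case (Suc n)
  define u where "u = apps (rep n wordV) z"
  have u: "u > 0" using apps_pos Suc.prems by (simp add: u_def)
  have c: "dC u > 0" "dB (1 + dC u) > 0"
    using dC_bounds(1)[OF u] dB_bounds(1)[of "1 + dC u"] by auto
  have "1 / (2 * apps wordV u) = dC (dB (dC (1 + 1 / (2*u))))"
    unfolding wordV_def using u c inv_1[OF c(2)] inv_dB[of "1 + dC u"] inv_1[OF c(1)] inv_dC[OF u]
    by simp
  then show ?case using Suc by (simp add: u_def wordT_def)
qed simp

definition approx_word :: "nat \<Rightarrow> digit list" where
  "approx_word n = rep (Suc n) wordU @ [A, B, C, B, A, C] @ rep (Suc n) wordV @ [B]"

text \<open>In \<open>B ABCBAC\<close> the first \<open>A\<close> and the following \<open>C\<close>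
  are the two neighbouring centres, with values \<open>mixed p q\<close> and
  \<open>mixed q p\<close>. All other cuts stay below \<open>67/30\<close>, whence the proviso that
  the larger value exceeds this bound.\<close>

lemma approx_word_value:
  "\<exists>p q. p > 0 \<and> q > 0 \<and> \<bar>p - 1 / (2 * amax)\<bar> \<le> (1/2) ^ n \<and> \<bar>q - 1 / (2 * amax)\<bar> \<le> (1/2) ^ n \<and>
    (67/30 < max (mixed p q) (mixed q p) \<longrightarrow>
      sqrt 2 * max (mixed p q) (mixed q p) \<in> markoff_spectrum \<and>
      sqrt 2 * max (mixed p q) (mixed q p) \<in> lagrange_spectrum)"
proof -
  let ?U = "rep (Suc n) wordU" and ?V = "rep (Suc n) wordV"
  have right: "app B x \<in> {3/5..5/6}" "apps (?V @ [B]) x \<in> {8/5..11/6}"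
    if x: "x \<in> {5/14..2/5}" for x
  proof -
    show 1: "app B x \<in> {3/5..5/6}" by (rule app_B_in) (use x in auto)
    have "apps (rep n wordV) (app B x) \<in> {3/5..2}"
      by (rule apps_rep_in) (use apps_V_in 1 in fastforce)+
    then show "apps (?V @ [B]) x \<in> {8/5..11/6}" using apps_V_in by simp
  qed
  have core: "app C Z \<in> {3/11..2/5}" "app A (app C Z) \<in> {14/11..7/5}"
    "app B (app A (app C Z)) \<in> {3/5..5/6}" "app C (app B (app A (app C Z))) \<in> {3/11..2/5}"
    "app B (app C (app B (app A (app C Z)))) \<in> {3/5..5/6}"
    "app A (app B (app C (app B (app A (app C Z))))) \<in> {8/5..11/6}"
    if Z: "Z \<in> {8/5..11/6}" for Z
  proof -
    have "app C Z \<in> {dC (3/5)..2/5}" by (rule app_C_in) (use Z in auto)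
    then show 1: "app C Z \<in> {3/11..2/5}" by (simp add: dC_vals)
    have "app A (app C Z) \<in> {1 + 3/11..1 + 2/5}" by (rule app_A_in) (use 1 in auto)
    then show 2: "app A (app C Z) \<in> {14/11..7/5}" by simp
    show 3: "app B (app A (app C Z)) \<in> {3/5..5/6}" by (rule app_B_in) (use 2 in auto)
    have "app C (app B (app A (app C Z))) \<in> {dC (3/5)..2/5}" by (rule app_C_in) (use 3 in auto)
    then show 4: "app C (app B (app A (app C Z))) \<in> {3/11..2/5}" by (simp add: dC_vals)
    show 5: "app B (app C (app B (app A (app C Z)))) \<in> {3/5..5/6}" by (rule app_B_in) (use 4 in auto)
    have "app A (app B (app C (app B (app A (app C Z))))) \<in> {1 + 3/5..1 + 5/6}"
      by (rule app_A_in) (use 5 in auto)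
    then show "app A (app B (app C (app B (app A (app C Z))))) \<in> {8/5..11/6}" by simp
  qed
  have core': "app A Y \<in> {8/5..11/6}" "app B (app A Y) \<in> {3/5..5/6}"
    "app C (app B (app A Y)) \<in> {3/11..2/5}" "app B (app C (app B (app A Y))) \<in> {3/5..5/6}"
    "app A (app B (app C (app B (app A Y)))) \<in> {8/5..11/6}"
    "app C (app A (app B (app C (app B (app A Y))))) \<in> {5/14..2/5}"
    if Y: "Y \<in> {3/5..5/6}" for Y
  proof -
    have "app A Y \<in> {1 + 3/5..1 + 5/6}" by (rule app_A_in) (use Y in auto)
    then show 1: "app A Y \<in> {8/5..11/6}" by simp
    show 2: "app B (app A Y) \<in> {3/5..5/6}" by (rule app_B_in) (use 1 in auto)
    have "app C (app B (app A Y)) \<in> {dC (3/5)..2/5}" by (rule app_C_in) (use 2 in auto)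
    then show 3: "app C (app B (app A Y)) \<in> {3/11..2/5}" by (simp add: dC_vals)
    show 4: "app B (app C (app B (app A Y))) \<in> {3/5..5/6}" by (rule app_B_in) (use 3 in auto)
    have "app A (app B (app C (app B (app A Y)))) \<in> {1 + 3/5..1 + 5/6}" by (rule app_A_in) (use 4 in auto)
    then show 5: "app A (app B (app C (app B (app A Y)))) \<in> {8/5..11/6}" by simp
    have "app C (app A (app B (app C (app B (app A Y))))) \<in> {dC (5/4)..2/5}"
      by (rule app_C_in) (use 5 in auto)
    then show "app C (app A (app B (app C (app B (app A Y))))) \<in> {5/14..2/5}" by (simp add: dC_vals)
  qed
  have left: "apps (rev ?U) y \<in> {3/5..5/6}" if "y \<in> {3/5..5/6}" for y
    unfolding rev_rep by (rule apps_rep_in[OF _ that]) (rule apps_revU_in)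
  have map_x: "apps (approx_word n) x \<in> {5/14..2/5}" if x: "x \<in> {5/14..2/5}" for x
  proof -
    have "apps ([A, B, C, B, A, C] @ ?V @ [B]) x \<in> {8/5..11/6}"
      using core(6)[OF right(2)[OF x]] by simp
    then have "apps (rep n wordU) (apps ([A, B, C, B, A, C] @ ?V @ [B]) x) \<in> {1/4..2}"
      by (intro apps_rep_in) (use apps_U_in in fastforce)+
    then show ?thesis unfolding approx_word_def using apps_U_in by simp
  qed
  have map_y: "apps (rev (approx_word n)) y \<in> {3/5..5/6}" if y: "y \<in> {3/5..5/6}" for y
  proof -
    have 1: "apps (rev [A, B, C, B, A, C]) (apps (rev ?U) y) \<in> {5/14..2/5}"
      using core'(6)[OF left[OF y]] by simp
    have "apps (rev ?V) (apps (rev [A, B, C, B, A, C]) (apps (rev ?U) y)) \<in> {5/14..2/5}"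
      unfolding rev_rep[of _ wordV] by (rule apps_rep_in[OF _ 1]) (rule apps_revV_in)
    then have "app B (apps (rev ?V) (apps (rev [A, B, C, B, A, C]) (apps (rev ?U) y))) \<in> {3/5..5/6}"
      by (intro app_B_in) auto
    moreover have "rev (approx_word n) = [B] @ rev ?V @ rev [A, B, C, B, A, C] @ rev ?U"
      unfolding approx_word_def by (simp only: rev_append rev.simps append_Nil append_assoc)
    ultimately show ?thesis by (simp only: apps_simps)
  qed
  obtain x where x: "x \<in> {5/14..2/5}" "apps (approx_word n) x = x"
    using apps_fixed_point[of "5/14" "2/5" "approx_word n"] map_x by auto
  obtain y where y: "y \<in> {3/5..5/6}" "apps (rev (approx_word n)) y = y"
    using apps_fixed_point[of "3/5" "5/6" "rev (approx_word n)"] map_y by auto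
  define Y Z where "Y = apps (rev ?U) y" and "Z = apps (?V @ [B]) x"
  have YI: "Y \<in> {3/5..5/6}" and ZI: "Z \<in> {8/5..11/6}"
    using left y right(2) x by (simp_all add: Y_def Z_def)
  define c1 c2 c3 c4 c5 c6 where "c1 = app C Z" and "c2 = app A c1" and "c3 = app B c2"
    and "c4 = app C c3" and "c5 = app B c4" and "c6 = app A c5"
  define e1 e2 e3 e4 e5 e6 where "e1 = app A Y" and "e2 = app B e1" and "e3 = app C e2"
    and "e4 = app B e3" and "e5 = app A e4" and "e6 = app C e5"
  have cI: "c1 \<in> {3/11..2/5}" "c2 \<in> {14/11..7/5}" "c3 \<in> {3/5..5/6}" "c4 \<in> {3/11..2/5}"
      "c5 \<in> {3/5..5/6}" "c6 \<in> {8/5..11/6}"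
    unfolding c1_def c2_def c3_def c4_def c5_def c6_def using core[OF ZI] .
  have eI: "e1 \<in> {8/5..11/6}" "e2 \<in> {3/5..5/6}" "e3 \<in> {3/11..2/5}" "e4 \<in> {3/5..5/6}"
      "e5 \<in> {8/5..11/6}" "e6 \<in> {5/14..2/5}"
    unfolding e1_def e2_def e3_def e4_def e5_def e6_def using core'[OF YI] .
  \<comment> \<open>The past of the middle block is \<open>BCA\<close> followed by \<open>p\<close>,
    and its future is \<open>ABCBAC\<close> followed by \<open>Z\<close>; these are the tails in the
    definition of \<open>mixed\<close>.\<close>
  define p q where "p = app C (apps (rep n (rev wordU)) y)" and "q = 1 / (2 * Z)"
  have y0: "y > 0" and x0: "x > 0" using x y by auto
  have pq0: "p > 0" "q > 0" using ZI app_pos apps_pos y0 by (auto simp: p_def q_def simp del: app.simps)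
  define a0 where "a0 = 1 / (2 * amax)"
  have a0: "0 < a0" "a0 < 1" using amax_eq by (simp_all add: a0_def field_simps)
  have pn: "\<bar>p - a0\<bar> \<le> (1/2) ^ n"
  proof -
    have "\<bar>p - a0\<bar> \<le> \<bar>app C y - a0\<bar> * (1/2) ^ n"
      unfolding p_def C_rep a0_def by (rule apps_T_contraction) (rule app_pos[OF y0])
    also have "\<dots> \<le> 1 * (1/2) ^ n"
      using dC_bounds[OF y0] a0 by (intro mult_right_mono) auto
    finally show ?thesis by simp
  qed
  have qn: "\<bar>q - a0\<bar> \<le> (1/2) ^ n"
  proof -
    have "app B x > 0" by (rule app_pos[OF x0])
    then have q': "q = apps (rep (Suc n) wordT) (1 / (2 * app B x))"
      using inv_rep_V[of "app B x" "Suc n"] by (simp add: q_def Z_def)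
    have "\<bar>q - a0\<bar> \<le> \<bar>1 / (2 * app B x) - a0\<bar> * (1/2) ^ Suc n"
      unfolding q' a0_def by (rule apps_T_contraction) (use \<open>app B x > 0\<close> in simp)
    also have "\<dots> \<le> 1 * (1/2) ^ n"
    proof (rule mult_mono)
      have "1 / (2 * app B x) = dB (1 / (2*x))" using inv_dB[OF x0] by simp
      then show "\<bar>1 / (2 * app B x) - a0\<bar> \<le> 1" using dB_bounds[of "1 / (2*x)"] x0 a0 by simp
    qed auto
    finally show ?thesis by simp
  qed
  have qe: "1 / (2 * dB (dC (1 + q))) = c3" "dB (dC (1 + q)) = 1 / (2 * c3)"
  proof -
    have "Z > 0" using ZI by simp
    have c: "c1 > 0" "c2 > 0" "c3 > 0" using cI by auto
    have "1 + q = 1 / (2 * c1)" using inv_dC[OF \<open>Z > 0\<close>] by (simp add: q_def c1_def)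
    then have "dC (1 + q) = 1 / (2 * c2)" using inv_1[OF c(1)] by (simp add: c2_def)
    then show 1: "dB (dC (1 + q)) = 1 / (2 * c3)" using inv_dB[OF c(2)] by (simp add: c3_def)
    show "1 / (2 * dB (dC (1 + q))) = c3" unfolding 1 using c by simp
  qed
  have pe: "dB (dC (1 + p)) = Y"
    unfolding Y_def rev_rep by (simp add: wordU_def p_def)
  have F1: "c6 + Y = mixed p q"
    unfolding mixed_def qe(1) pe by (simp add: c6_def c5_def c4_def)
  have F2: "1 / (2 * c4) + 1 / (2 * e2) = mixed q p"
  proof -
    have "Y > 0" "e1 > 0" "c3 > 0" using YI eI cI by auto
    have "dC (1 / (2 * Y)) = 1 / (2 * e1)" using inv_1[OF \<open>Y > 0\<close>] by (simp add: e1_def)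
    then have "dB (dC (1 / (2 * Y))) = 1 / (2 * e2)" using inv_dB[OF \<open>e1 > 0\<close>] by (simp add: e2_def)
    moreover have "1 / (2 * c4) = 1 + 1 / (2 * c3)" using inv_dC[OF \<open>c3 > 0\<close>] by (simp add: c4_def)
    ultimately show ?thesis unfolding mixed_def qe(2) pe by simp
  qed
  \<comment> \<open>Moving a \<open>C\<close> across the cut preserves the sum of the inverses, just
    as moving an \<open>A\<close> preserves the sum.\<close>
  have F2': "1 / (2 * c3) + 1 / (2 * e3) = mixed q p"
  proof -
    have "e2 > 0" "c3 > 0" using eI cI by auto
    then have "1 / (2 * e3) = 1 + 1 / (2 * e2)" "1 / (2 * c4) = 1 + 1 / (2 * c3)"
      using inv_dC by (simp_all add: e3_def c4_def)
    then show ?thesis using F2 by simp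
  qed
  define M where "M = max (mixed p q) (mixed q p)"
  have spectra: "sqrt 2 * M \<in> markoff_spectrum \<and> sqrt 2 * M \<in> lagrange_spectrum" if M: "67/30 < M"
  proof -
    let ?L = "[A, B, C, B, A, C] @ ?V @ [B]"
    have posL: "positions ?L x Y = {(c6, Y), (c5, e1), (c4, e2), (c3, e3), (c2, e4), (c1, e5)} \<union>
        positions (?V @ [B]) x e6"
      unfolding append_Cons append_Nil positions_Cons apps_simps(2) Z_def[symmetric]
        c1_def[symmetric] c2_def[symmetric] c3_def[symmetric] c4_def[symmetric] c5_def[symmetric] c6_def[symmetric]
        e1_def[symmetric] e2_def[symmetric] e3_def[symmetric] e4_def[symmetric] e5_def[symmetric] e6_def[symmetric]
      by blast
    have inv1: "1 / (2 * c6) + 1 / (2 * Y) \<le> 67/30" "1 / (2 * c5) + 1 / (2 * e1) \<le> 67/30"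
      by (rule inverse_sum_le[of "8/5" _ "3/5"] inverse_sum_le[of "3/5" _ "8/5"]; use cI eI YI in simp)+
    have sums: "c5 + e1 = mixed p q" using F1 by (simp add: c6_def e1_def)
    have h: "height c6 Y = max (mixed p q) (1 / (2 * c6) + 1 / (2 * Y))"
        "height c4 e2 = max (c4 + e2) (mixed q p)"
      unfolding height_def F1 F2 by simp_all
    have le: "height u v \<le> M" if uv: "(u, v) \<in> positions (approx_word n) x y" for u v
    proof -
      have "apps ?L x \<in> {1/4..2}" using cI(6) unfolding c6_def c5_def c4_def c3_def c2_def c1_def Z_def by simp
      from positions_U[OF this y(1), of u v "Suc n"] uv
      consider "height u v \<le> 67/30" | "(u, v) \<in> positions ?L x Y"
        unfolding approx_word_def Y_def by blast
      then show ?thesis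
      proof cases
        case 2
        then consider "(u, v) = (c6, Y)" | "(u, v) = (c5, e1)" | "(u, v) = (c4, e2)" | "(u, v) = (c3, e3)"
          | "(u, v) = (c2, e4)" | "(u, v) = (c1, e5)" | "(u, v) \<in> positions (?V @ [B]) x e6"
          unfolding posL by blast
        then show ?thesis
        proof cases
          case 1
          then show ?thesis using F1 inv1(1) M by (intro heightI) (auto simp: M_def)
        next
          case 2
          then show ?thesis using sums inv1(2) M by (intro heightI) (auto simp: M_def)
        next
          case 3
          then show ?thesis using cI(4) eI(2) F2 M by (intro heightI) (auto simp: M_def)
        next
          case 4
          then show ?thesis using cI(3) eI(3) F2' M by (intro heightI) (auto simp: M_def)
        next
          case 5
          then show ?thesis using height_le_67_30[OF cI(2) eI(4)] M by simp
        next
          case 6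
          then show ?thesis using height_le_67_30[OF cI(1) eI(5)] M by simp
        next
          case 7
          have "apps [B] x \<in> {3/5..2}" using right(1)[OF x(1)] by simp
          from positions_V[OF this eI(6) 7] consider "height u v \<le> 67/30"
            | "(u, v) \<in> positions [B] x (apps (rev ?V) e6)" by blast
          then show ?thesis
          proof cases
            case 2
            define y' where "y' = apps (rev ?V) e6"
            have y': "y' \<in> {5/14..2/5}" unfolding y'_def rev_rep
              by (rule apps_rep_in[OF _ eI(6)]) (rule apps_revV_in)
            have By': "app B y' \<in> {3/5..5/6}" by (rule app_B_in) (use y' in auto)
            from 2 have "(u, v) = (app B x, y') \<or> (u, v) = (x, app B y')"
              unfolding y'_def[symmetric] positions_Cons positions_Nil by auto
            then show ?thesis
              using height_le_67_30[OF right(1)[OF x(1)] y'] height_le_67_30[OF x(1) By'] M by auto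
          qed (use M in simp)
        qed
      qed (use M in simp)
    qed
    have "positions ?L x Y \<subseteq> positions (approx_word n) x y"
      unfolding approx_word_def positions_append[of ?U] Y_def by blast
    then have mem: "(c6, Y) \<in> positions (approx_word n) x y" "(c4, e2) \<in> positions (approx_word n) x y"
      unfolding posL by auto
    have att: "\<exists>u v. (u, v) \<in> positions (approx_word n) x y \<and> height u v = M"
    proof (cases "mixed q p \<le> mixed p q")
      case True
      then have "height c6 Y = M" using h(1) inv1(1) M by (simp add: M_def max_def)
      then show ?thesis using mem by blast
    next
      case False
      then have "height c4 e2 = M" using h(2) cI(4) eI(2) M by (simp add: M_def max_def)
      then show ?thesis using mem by blast
    qed
    have "B \<in> set (approx_word n)" by (simp add: approx_word_def)
    then show ?thesis using periodic_value[OF x0 x(2) y0 y(2) _ le] att by blast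
  qed
  then show ?thesis using pq0 pn qn unfolding M_def a0_def by blast
qed

text \<open>Both parameters of the approximating words tend to \<open>1 / (2 * amax)\<close>, so by
  continuity the larger of the two values tends to \<open>gap_end\<close> and eventually exceeds
  \<open>67/30\<close>.\<close>

lemma gap_end_in_closure:
  "sqrt 2 * gap_end \<in> closure markoff_spectrum" "sqrt 2 * gap_end \<in> closure lagrange_spectrum"
proof -
  obtain p q where pq: "\<And>n. p n > 0 \<and> q n > 0 \<and> \<bar>p n - 1 / (2 * amax)\<bar> \<le> (1/2) ^ n \<and>
      \<bar>q n - 1 / (2 * amax)\<bar> \<le> (1/2) ^ n \<and>
    (67/30 < max (mixed (p n) (q n)) (mixed (q n) (p n)) \<longrightarrow>
      sqrt 2 * max (mixed (p n) (q n)) (mixed (q n) (p n)) \<in> markoff_spectrum \<and>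
      sqrt 2 * max (mixed (p n) (q n)) (mixed (q n) (p n)) \<in> lagrange_spectrum)"
    using approx_word_value by metis
  define a0 where "a0 = 1 / (2 * amax)"
  have a0: "a0 > 0" using amax_eq by (simp add: a0_def)
  have lim0: "f \<longlonglongrightarrow> a0" if "\<And>n. \<bar>f n - a0\<bar> \<le> (1/2) ^ n" for f :: "nat \<Rightarrow> real"
  proof (rule LIM_zero_cancel, rule Lim_null_comparison)
    show "\<forall>\<^sub>F n in sequentially. norm (f n - a0) \<le> (1/2) ^ n" using that by simp
    show "(\<lambda>n. (1/2) ^ n :: real) \<longlonglongrightarrow> 0" by (rule LIMSEQ_realpow_zero) auto
  qed
  have lp: "p \<longlonglongrightarrow> a0" by (rule lim0, unfold a0_def) (use pq in blast)
  have lq: "q \<longlonglongrightarrow> a0" by (rule lim0, unfold a0_def) (use pq in blast)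
  have lim: "(\<lambda>n. mixed (f n) (g n)) \<longlonglongrightarrow> gap_end"
    if "f \<longlonglongrightarrow> a0" "g \<longlonglongrightarrow> a0" "\<And>n. f n > 0" "\<And>n. g n > 0" for f g
  proof -
    have e: "mixed (f n) (g n) = 1 + (5 + 4 * f n) / (8 + 6 * f n) + (21 + 16 * g n) / (34 + 26 * g n)" for n
      using that(3)[of n] that(4)[of n] by (intro mixed_eq) auto
    have "(\<lambda>n. mixed (f n) (g n)) \<longlonglongrightarrow> 1 + (5 + 4*a0) / (8 + 6*a0) + (21 + 16*a0) / (34 + 26*a0)"
      unfolding e using a0 by (intro tendsto_intros that) auto
    also have "1 + (5 + 4*a0) / (8 + 6*a0) + (21 + 16*a0) / (34 + 26*a0) = gap_end"
      using mixed_eq[of a0 a0] a0 mixed_amax[folded a0_def] by simp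
    finally show ?thesis .
  qed
  define m where "m = (\<lambda>n. max (mixed (p n) (q n)) (mixed (q n) (p n)))"
  have m: "m \<longlonglongrightarrow> gap_end"
  proof -
    have "m \<longlonglongrightarrow> max gap_end gap_end" unfolding m_def
      by (intro tendsto_max lim lp lq) (use pq in auto)
    then show ?thesis by simp
  qed
  have "67/30 < gap_end" using sqrt119 by (simp add: gap_end_def)
  then have ev: "\<forall>\<^sub>F n in sequentially. 67/30 < m n" by (rule order_tendstoD(1)[OF m])
  have lim_m: "(\<lambda>n. sqrt 2 * m n) \<longlonglongrightarrow> sqrt 2 * gap_end" by (intro tendsto_intros m)
  have cl: "sqrt 2 * gap_end \<in> closure X" if X: "\<And>n. 67/30 < m n \<Longrightarrow> sqrt 2 * m n \<in> X" for X
    by (rule Lim_in_closed_set[OF closed_closure _ _ lim_m])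
       (use ev X closure_subset in \<open>auto elim!: eventually_mono\<close>)
  show "sqrt 2 * gap_end \<in> closure markoff_spectrum" "sqrt 2 * gap_end \<in> closure lagrange_spectrum"
    by (rule cl; use pq in \<open>simp add: m_def\<close>)+
qed

text \<open>A larger open interval contains an end of the given one, and with it nearby points of
  the set. So the ends only have to be limits of spectral values.\<close>

lemma maximal_gapI:
  assumes "a < b" "\<And>m. m \<in> X \<Longrightarrow> a < m \<Longrightarrow> m < b \<Longrightarrow> False" "a \<in> closure X" "b \<in> closure X"
  shows "maximal_gap X {a<..<b}"
  unfolding maximal_gap_def
proof (intro conjI notI)
  show "open_interval {a<..<b}" using assms(1) by (auto simp: open_interval_def is_interval_oo)
  show "{a<..<b} \<inter> X = {}" using assms(2) by auto
  assume "\<exists>J. open_interval J \<and> {a<..<b} \<subset> J \<and> J \<inter> X = {}"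
  then obtain J where J: "open J" "is_interval J" "{a<..<b} \<subset> J" "J \<inter> X = {}"
    by (auto simp: open_interval_def)
  then obtain z where z: "z \<in> J" "z \<notin> {a<..<b}" by blast
  have "(a + b) / 2 \<in> {a<..<b}" using assms(1) by simp
  then have c: "(a + b) / 2 \<in> J" using J(3) by blast
  have "z \<le> a \<or> b \<le> z" using z(2) by auto
  then have "a \<in> J \<or> b \<in> J"
    using mem_is_interval_1_I[OF J(2) z(1) c, of a] mem_is_interval_1_I[OF J(2) c z(1), of b] assms(1)
    by auto
  moreover have "c \<notin> J" if "c \<in> closure X" for c
    using that J(1,4) open_Int_closure_eq_empty[of J X] by blast
  ultimately show False using assms(3,4) by blast
qed

theorem theorem1p3:
  "maximal_gap markoff_spectrum {sqrt 238 / 5 <..< sqrt 10} \<and>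
   maximal_gap lagrange_spectrum {sqrt 238 / 5 <..< sqrt 10} \<and>
   maximal_gap markoff_spectrum {sqrt 10 <..< (2124 * sqrt 2 + 48 * sqrt 238) / 1177} \<and>
   maximal_gap lagrange_spectrum {sqrt 10 <..< (2124 * sqrt 2 + 48 * sqrt 238) / 1177}"
proof -
  have lt: "sqrt 238 / 5 < sqrt 10" "sqrt 10 < sqrt 2 * gap_end"
    using gap_end_bounds by (simp_all flip: sqrt_scaling(1,2))
  have cl: "sqrt 238 / 5 \<in> closure markoff_spectrum" "sqrt 238 / 5 \<in> closure lagrange_spectrum"
    "sqrt 10 \<in> closure markoff_spectrum" "sqrt 10 \<in> closure lagrange_spectrum"
    using sqrt10_in_spectra sqrt238_in_spectra closure_subset by blast+
  show ?thesis unfolding sqrt_scaling(3)[symmetric]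
  proof (intro conjI)
    show "maximal_gap markoff_spectrum {sqrt 238 / 5<..<sqrt 10}"
      by (rule maximal_gapI) (use lt cl markoff_gap in force)+
    show "maximal_gap lagrange_spectrum {sqrt 238 / 5<..<sqrt 10}"
      by (rule maximal_gapI) (use lt cl lagrange_gap in force)+
    show "maximal_gap markoff_spectrum {sqrt 10<..<sqrt 2 * gap_end}"
      by (rule maximal_gapI) (use lt cl gap_end_in_closure markoff_gap in force)+
    show "maximal_gap lagrange_spectrum {sqrt 10<..<sqrt 2 * gap_end}"
      by (rule maximal_gapI) (use lt cl gap_end_in_closure lagrange_gap in force)+
  qed
qed

end
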